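(* Let $A$ be a strongly maximal TAF algebra with diagonal $D$, and let $\pi\colon A\to\mathcal{B}(\mathcal{H})$ be a nest representation whose restriction to $D$ is a $*$-representation and for which the von Neumann algebra $\mathcal{D}=\pi(D)''$ generated by $\pi(D)$ contains an atom. Then $\ker\pi$ is a meet irreducible ideal in $A$.
   Context: **AF algebra and canonical masa.** $B$ is an AF $C^*$-algebra and $D\subseteq B$ is a canonical masa: $B=\varinjlim(B_i,\phi_i)$ for finite dimensional $C^*$-algebras $B_i$ and embeddings $\phi_i\colon B_i\to B_{i+1}$, and $D=\varinjlim(D_i,\phi_i)$, where $D_i=D\cap B_i$ is a masa in $B_i$ and $\phi_i$ maps the normalizer of $D_i$ into the normalizer of $D_{i+1}$. The spectrum $X$ of $D$ (so $D\cong C(X)$) is a Cantor space. **TAF algebras.** A TAF algebra with diagonal $D$ is a closed subalgebra $A$ with $D\subseteq A\subseteq B$ and $A\cap A^*=D$. It is strongly maximal if $A+A^*$ is dense in $B$; equivalently, each $A_i=A\cap B_i$ is maximal triangular in $B_i$ with diagonal $D_i$. **Nest representations.** A nest representation of $A$ is a continuous algebra homomorphism $\pi\colon A\to\mathcal{B}(\mathcal{H})$, $\mathcal{H}$ a Hilbert space, such that the lattice of closed $\pi(A)$-invariant subspaces is totally ordered by inclusion. **Atoms.** An atom of a von Neumann algebra is a nonzero projection in it that majorizes no proper nonzero subprojection belonging to the algebra. **Meet irreducible ideals.** Ideals are closed and two-sided. An ideal $\mathcal{I}$ of $A$ is meet irreducible if, for all ideals $\mathcal{J},\mathcal{K}$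 of $A$, $\mathcal{I}=\mathcal{J}\cap\mathcal{K}$ implies $\mathcal{I}=\mathcal{J}$ or $\mathcal{I}=\mathcal{K}$. *)

theory Defs
  imports "HOL-Analysis.Analysis"
begin

section \<open>C*-algebras and complex Hilbert spaces\<close>

class complex_vector = real_vector +
  fixes scaleC :: "complex \<Rightarrow> 'a \<Rightarrow> 'a" (infixr "*\<^sub>C" 75)
  assumes scaleC_add_right: "c *\<^sub>C (x + y) = c *\<^sub>C x + c *\<^sub>C y"
    and scaleC_add_left: "(c + d) *\<^sub>C x = c *\<^sub>C x + d *\<^sub>C x"
    and scaleC_scaleC: "c *\<^sub>C (d *\<^sub>C x) = (c * d) *\<^sub>C x"
    and scaleC_one: "1 *\<^sub>C x = x"
    and scaleR_scaleC: "r *\<^sub>R x = complex_of_real r *\<^sub>C x"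

global_interpretation complex_vector:
  vector_space "scaleC :: complex \<Rightarrow> 'a \<Rightarrow> 'a::complex_vector"
  by unfold_locales
    (rule scaleC_add_right scaleC_add_left scaleC_scaleC scaleC_one)+

text \<open>No unit is required; \<open>adj\<close> is the involution.\<close>

class cstar_algebra = complex_vector + real_normed_algebra + banach +
  fixes adj :: "'a \<Rightarrow> 'a"
  assumes scaleC_mult_left: "(c *\<^sub>C x) * y = c *\<^sub>C (x * y)"
    and scaleC_mult_right: "x * (c *\<^sub>C y) = c *\<^sub>C (x * y)"
    and norm_scaleC: "norm (c *\<^sub>C x) = cmod c * norm x"
    and adj_adj: "adj (adj x) = x"
    and adj_add: "adj (x + y) = adj x + adj y"
    and adj_scaleC: "adj (c *\<^sub>C x) = cnj c *\<^sub>C adj x"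
    and adj_mult: "adj (x * y) = adj y * adj x"
    and cstar_identity: "norm (adj x * x) = (norm x)\<^sup>2"

text \<open>The last axiom ties the complex inner product, linear in its second argument, to the norm
  and topology of the underlying real Hilbert space; positive definiteness of \<open>cinner\<close> and
  \<open>norm x = sqrt (Re (cinner x x))\<close> are inherited from \<^class>\<open>real_inner\<close>.\<close>

class complex_hilbert = complex_vector + real_inner + banach +
  fixes cinner :: "'a \<Rightarrow> 'a \<Rightarrow> complex"
  assumes cinner_commute: "cinner x y = cnj (cinner y x)"
    and cinner_add_right: "cinner x (y + z) = cinner x y + cinner x z"
    and cinner_scaleC_right: "cinner x (c *\<^sub>C y) = c * cinner x y"
    and inner_eq_Re_cinner: "inner x y = Re (cinner x y)"


section \<open>AF algebras and canonical masas\<close>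

definition subalgebra :: "'b::cstar_algebra set \<Rightarrow> bool" where
  "subalgebra S \<longleftrightarrow> complex_vector.subspace S \<and> (\<forall>x\<in>S. \<forall>y\<in>S. x * y \<in> S)"

definition star_subalgebra :: "'b::cstar_algebra set \<Rightarrow> bool" where
  "star_subalgebra S \<longleftrightarrow> subalgebra S \<and> (\<forall>x\<in>S. adj x \<in> S)"

definition finite_dimensional :: "'a::complex_vector set \<Rightarrow> bool" where
  "finite_dimensional S \<longleftrightarrow> (\<exists>F. finite F \<and> S = complex_vector.span F)"

definition abelian :: "'b::cstar_algebra set \<Rightarrow> bool" where
  "abelian S \<longleftrightarrow> (\<forall>x\<in>S. \<forall>y\<in>S. x * y = y * x)"

definition masa_in :: "'b::cstar_algebra set \<Rightarrow> 'b set \<Rightarrow> bool" where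
  "masa_in C M \<longleftrightarrow> star_subalgebra C \<and> abelian C \<and> C \<subseteq> M \<and>
     (\<forall>C'. star_subalgebra C' \<and> abelian C' \<and> C \<subseteq> C' \<and> C' \<subseteq> M \<longrightarrow> C' = C)"

definition partial_isometry :: "'b::cstar_algebra \<Rightarrow> bool" where
  "partial_isometry v \<longleftrightarrow> v * adj v * v = v"

definition normalizer :: "'b::cstar_algebra set \<Rightarrow> 'b set \<Rightarrow> 'b set" where
  "normalizer C M =
     {v \<in> M. partial_isometry v \<and> (\<forall>d\<in>C. v * d * adj v \<in> C \<and> adj v * d * v \<in> C)}"

text \<open>The direct system \<open>(B\<^sub>i, \<phi>\<^sub>i)\<close> is given by its images in \<open>B\<close> (the whole type), so the
  \<open>\<phi>\<^sub>i\<close> are inclusions and the limit is the closure of the union.\<close>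

definition canonical_masa_sequence :: "(nat \<Rightarrow> 'b::cstar_algebra set) \<Rightarrow> 'b set \<Rightarrow> bool" where
  "canonical_masa_sequence Bs D \<longleftrightarrow>
     (\<forall>i. star_subalgebra (Bs i) \<and> finite_dimensional (Bs i) \<and> Bs i \<subseteq> Bs (Suc i)) \<and>
     closure (\<Union>i. Bs i) = UNIV \<and>
     (\<forall>i. masa_in (D \<inter> Bs i) (Bs i)) \<and>
     closure (\<Union>i. D \<inter> Bs i) = D \<and>
     (\<forall>i. normalizer (D \<inter> Bs i) (Bs i) \<subseteq> normalizer (D \<inter> Bs (Suc i)) (Bs (Suc i)))"

definition characters :: "'b::cstar_algebra set \<Rightarrow> ('b \<Rightarrow> complex) set" where
  "characters D = {\<tau> \<in> extensional D.
     (\<forall>x\<in>D. \<forall>y\<in>D. \<tau> (x + y) = \<tau> x + \<tau> y \<and> \<tau> (x * y) = \<tau> x * \<tau> y) \<and>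
     (\<forall>c. \<forall>x\<in>D. \<tau> (c *\<^sub>C x) = c * \<tau> x) \<and>
     (\<exists>x\<in>D. \<tau> x \<noteq> 0)}"

text \<open>The Gelfand spectrum, with the topology of pointwise convergence on \<open>D\<close>.\<close>

definition spectrum_topology :: "'b::cstar_algebra set \<Rightarrow> ('b \<Rightarrow> complex) topology" where
  "spectrum_topology D = subtopology (product_topology (\<lambda>_. euclidean) D) (characters D)"

definition cantor_space :: "'x topology \<Rightarrow> bool" where
  "cantor_space X \<longleftrightarrow>
     X homeomorphic_space product_topology (\<lambda>_::nat. discrete_topology (UNIV :: bool set)) UNIV"

definition canonical_masa :: "'b::cstar_algebra set \<Rightarrow> bool" where
  "canonical_masa D \<longleftrightarrow>
     (\<exists>Bs. canonical_masa_sequence Bs D) \<and> cantor_space (spectrum_topology D)"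


section \<open>TAF algebras and their ideals\<close>

definition taf_algebra :: "'b::cstar_algebra set \<Rightarrow> 'b set \<Rightarrow> bool" where
  "taf_algebra A D \<longleftrightarrow>
     canonical_masa D \<and> subalgebra A \<and> closed A \<and> D \<subseteq> A \<and> A \<inter> adj ` A = D"

definition strongly_maximal_taf :: "'b::cstar_algebra set \<Rightarrow> 'b set \<Rightarrow> bool" where
  "strongly_maximal_taf A D \<longleftrightarrow>
     taf_algebra A D \<and> closure {a + adj b | a b. a \<in> A \<and> b \<in> A} = UNIV"

definition closed_ideal :: "'b::cstar_algebra set \<Rightarrow> 'b set \<Rightarrow> bool" where
  "closed_ideal A I \<longleftrightarrow> I \<subseteq> A \<and> complex_vector.subspace I \<and> closed I \<and>
     (\<forall>a\<in>A. \<forall>x\<in>I. a * x \<in> I \<and> x * a \<in> I)"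

definition meet_irreducible :: "'b::cstar_algebra set \<Rightarrow> 'b set \<Rightarrow> bool" where
  "meet_irreducible A I \<longleftrightarrow> closed_ideal A I \<and>
     (\<forall>J K. closed_ideal A J \<and> closed_ideal A K \<and> I = J \<inter> K \<longrightarrow> I = J \<or> I = K)"


section \<open>Operators and representations\<close>

text \<open>The type \<^typ>\<open>'h \<Rightarrow>\<^sub>L 'h\<close> consists of the real-linear bounded operators; the algebra
  \<open>\<B>(\<H>)\<close> is its subset of complex-linear ones, with the same operator norm.\<close>

definition bounded_operators :: "('h::complex_hilbert \<Rightarrow>\<^sub>L 'h) set" where
  "bounded_operators = {T. \<forall>c x. blinfun_apply T (c *\<^sub>C x) = c *\<^sub>C blinfun_apply T x}"

definition adjoint_pair :: "('h::complex_hilbert \<Rightarrow>\<^sub>L 'h) \<Rightarrow> ('h \<Rightarrow>\<^sub>L 'h) \<Rightarrow> bool" where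
  "adjoint_pair S T \<longleftrightarrow> (\<forall>x y. cinner (S x) y = cinner x (T y))"

definition commutant :: "('h::complex_hilbert \<Rightarrow>\<^sub>L 'h) set \<Rightarrow> ('h \<Rightarrow>\<^sub>L 'h) set" where
  "commutant M = {T \<in> bounded_operators. \<forall>S\<in>M. T o\<^sub>L S = S o\<^sub>L T}"

definition projection :: "('h::complex_hilbert \<Rightarrow>\<^sub>L 'h) \<Rightarrow> bool" where
  "projection p \<longleftrightarrow> p \<in> bounded_operators \<and> p o\<^sub>L p = p \<and> adjoint_pair p p"

definition majorizes :: "('h::complex_hilbert \<Rightarrow>\<^sub>L 'h) \<Rightarrow> ('h \<Rightarrow>\<^sub>L 'h) \<Rightarrow> bool" where
  "majorizes p q \<longleftrightarrow> range (blinfun_apply q) \<subseteq> range (blinfun_apply p)"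

definition atom_of :: "('h::complex_hilbert \<Rightarrow>\<^sub>L 'h) set \<Rightarrow> ('h \<Rightarrow>\<^sub>L 'h) \<Rightarrow> bool" where
  "atom_of M p \<longleftrightarrow> p \<in> M \<and> projection p \<and> p \<noteq> 0 \<and>
     (\<forall>q\<in>M. projection q \<and> majorizes p q \<longrightarrow> q = 0 \<or> q = p)"

text \<open>Representations are total functions, of which only the values on \<open>A\<close> matter.\<close>

definition algebra_hom_on ::
  "'b::cstar_algebra set \<Rightarrow> ('b \<Rightarrow> 'h::complex_hilbert \<Rightarrow>\<^sub>L 'h) \<Rightarrow> bool" where
  "algebra_hom_on A \<pi> \<longleftrightarrow>
     (\<forall>a\<in>A. \<pi> a \<in> bounded_operators) \<and>
     (\<forall>a\<in>A. \<forall>b\<in>A. \<pi> (a + b) = \<pi> a + \<pi> b \<and> \<pi> (a * b) = \<pi> a o\<^sub>L \<pi> b) \<and>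
     (\<forall>c. \<forall>a\<in>A. \<forall>x. \<pi> (c *\<^sub>C a) x = c *\<^sub>C \<pi> a x)"

definition closed_invariant_subspaces ::
  "'b set \<Rightarrow> ('b \<Rightarrow> 'h::complex_hilbert \<Rightarrow>\<^sub>L 'h) \<Rightarrow> 'h set set" where
  "closed_invariant_subspaces A \<pi> =
     {M. complex_vector.subspace M \<and> closed M \<and> (\<forall>a\<in>A. \<forall>x\<in>M. \<pi> a x \<in> M)}"

definition nest_representation ::
  "'b::cstar_algebra set \<Rightarrow> ('b \<Rightarrow> 'h::complex_hilbert \<Rightarrow>\<^sub>L 'h) \<Rightarrow> bool" where
  "nest_representation A \<pi> \<longleftrightarrow> algebra_hom_on A \<pi> \<and> continuous_on A \<pi> \<and>
     (\<forall>M\<in>closed_invariant_subspaces A \<pi>. \<forall>N\<in>closed_invariant_subspaces A \<pi>. M \<subseteq> N \<or> N \<subseteq> M)"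

definition star_representation_on ::
  "'b::cstar_algebra set \<Rightarrow> ('b \<Rightarrow> 'h::complex_hilbert \<Rightarrow>\<^sub>L 'h) \<Rightarrow> bool" where
  "star_representation_on D \<pi> \<longleftrightarrow>
     algebra_hom_on D \<pi> \<and> (\<forall>d\<in>D. adjoint_pair (\<pi> d) (\<pi> (adj d)))"

end

theory Submission
  imports Defs "HOL-Computational_Algebra.Fundamental_Theorem_Algebra"
begin

text \<open>
  The model case is that of upper triangular matrices. There the matrix units of the algebra outside the
  kernel of a nest representation are the \<open>e\<^bsub>ut\<^esub>\<close> with \<open>p \<le> u \<le> t \<le> q\<close> for some interval of indices, and two
  ideals that are strictly larger than the kernel both contain the corner unit \<open>e\<^bsub>pq\<^esub>\<close>. In
  general there is no last matrix unit, but an atom provides a point \<open>x\<close> of the interval from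
  which one can move outwards in both directions.

  Minimality of the atom means that, from some level on, exactly one minimal projection \<open>x\<^sub>i\<close> of the
  masa survives below it. So there is a unit vector \<open>h\<close> on which \<open>D\<close> acts by a character \<open>\<omega>\<close> (if no
  projection survives, the representation is zero and the kernel is all of \<open>A\<close>). If two orthogonal
  vectors were fixed by all \<open>\<pi>(x\<^sub>i)\<close>, the subspaces that \<open>\<pi>(A)\<close> maps into their orthogonal complements
  would be incomparable; hence the \<open>\<pi>(x\<^sub>i)\<close> decrease strongly to the rank one projection onto \<open>h\<close>
  (\<open>x_tendsto\<close>).

  Let \<open>J\<close> be an ideal on which \<open>\<pi>\<close> does not vanish. A nest argument gives \<open>v \<in> J\<close> and \<open>a, b \<in> A\<close>
  such that \<open>\<pi>(a) h\<close>, \<open>\<pi>(v)\<close> and \<open>\<pi>(b)* h\<close> pair to something nonzero (\<open>ideal_pairing_nonzero\<close>). Closed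
  bimodules over \<open>D\<close> are locally spanned by products of matrix units with elements of \<open>D\<close>
  (\<open>bimodule_detected_on_arrows\<close>), because matrix units normalize \<open>D\<close> and the conditional expectation
  onto \<open>D\<close> is a limit of pinchings. Therefore \<open>J\<close> contains an element \<open>u g t*\<close>, where \<open>u\<close>, \<open>t\<close> are
  matrix units starting at \<open>x\<close>, \<open>g \<in> D\<close> does not vanish at \<open>\<omega>\<close>, and both \<open>u\<close> and \<open>t*\<close>, localized
  suitably, are elements of \<open>A\<close> that act nontrivially on \<open>h\<close> from the left and from the right
  (\<open>ideal_links_active_arrows\<close>).

  A second ideal \<open>K\<close> contains such an element \<open>u' g' t'*\<close>. Density of \<open>A + A*\<close> makes the germs of \<open>u\<close>
  and \<open>u'\<close> at \<open>\<omega>\<close> comparable: near \<open>\<omega>\<close> one of them is a left multiple of the other by elements of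
  \<open>A\<close> (\<open>arrows_comparable\<close>); the same holds for \<open>t\<close> and \<open>t'\<close>. Moving outwards inside the ideals,
  one may take \<open>u = u'\<close> and \<open>t = t'\<close>. Then both ideals contain \<open>u d x\<^sub>n d' t*\<close> for all \<open>n\<close> and suitable
  \<open>d, d' \<in> D\<close>, and the images of these elements converge strongly to \<open>\<pi>(u d)\<close> times the projection
  onto \<open>h\<close> times \<open>\<pi>(d' t*)\<close>, which is nonzero because the projection has rank one. So two ideals
  strictly larger than the kernel never intersect in the kernel.
\<close>

section \<open>Elementary C*-algebra\<close>

lemma adj_zero [simp]: "adj (0::'b::cstar_algebra) = 0"
  using adj_add[of 0 "0::'b"] by simp

lemma adj_minus: "adj (- x) = - adj (x::'b::cstar_algebra)"
  using adj_add[of x "-x"] by (simp add: eq_neg_iff_add_eq_0 add.commute)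

lemma adj_diff: "adj (x - y) = adj x - adj (y::'b::cstar_algebra)"
  using adj_add[of x "-y"] by (simp add: adj_minus)

lemma adj_sum: "adj (sum f S) = (\<Sum>i\<in>S. adj (f i :: 'b::cstar_algebra))"
  by (induction S rule: infinite_finite_induct) (auto simp: adj_add)

lemma norm_adj [simp]: "norm (adj x) = norm (x::'b::cstar_algebra)"
proof -
  have "norm y \<le> norm (adj y)" for y :: 'b
  proof -
    have "(norm y)\<^sup>2 \<le> norm (adj y) * norm y"
      using norm_mult_ineq[of "adj y" y] by (simp add: cstar_identity)
    then show ?thesis by (cases "y = 0") (auto simp: power2_eq_square)
  qed
  from this[of x] this[of "adj x"] show ?thesis by (simp add: adj_adj)
qed

lemma adj_mult_self_eq_0 [simp]: "adj x * x = 0 \<longleftrightarrow> x = (0::'b::cstar_algebra)"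
  using cstar_identity[of x] by auto

lemma bounded_linear_adj: "bounded_linear (adj :: 'b::cstar_algebra \<Rightarrow> 'b)"
  by (rule bounded_linear_intro[where K = 1]) (auto simp: adj_add adj_scaleC scaleR_scaleC)

lemmas tendsto_adj [tendsto_intros] = bounded_linear.tendsto[OF bounded_linear_adj]

lemma tendsto_scaleC [tendsto_intros]:
  fixes l :: "'b::cstar_algebra"
  assumes "(f \<longlongrightarrow> c) F" and "(g \<longlongrightarrow> l) F"
  shows "((\<lambda>i. f i *\<^sub>C g i) \<longlongrightarrow> c *\<^sub>C l) F"
proof -
  have "bounded_bilinear (scaleC :: complex \<Rightarrow> 'b \<Rightarrow> 'b)"
    by (rule bounded_bilinear.intro)
      (auto simp: scaleC_add_right scaleC_add_left scaleR_scaleC scaleC_scaleC norm_scaleC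
        scaleR_conv_of_real mult.commute intro!: exI[of _ 1])
  from bounded_bilinear.tendsto[OF this assms] show ?thesis .
qed

definition is_projection :: "'b::cstar_algebra \<Rightarrow> bool" where
  "is_projection q \<longleftrightarrow> q * q = q \<and> adj q = q"

lemma norm_projection_le_1:
  assumes "is_projection q" shows "norm q \<le> 1"
proof -
  have "(norm q)\<^sup>2 = norm q" using assms cstar_identity[of q] by (simp add: is_projection_def)
  then show ?thesis by (auto simp: power2_eq_square)
qed

lemma norm_projection_mult_le:
  assumes "is_projection q" shows "norm (q * c) \<le> norm c" "norm (c * q) \<le> norm c"
  using norm_mult_ineq[of q c] norm_mult_ineq[of c q] norm_projection_le_1[OF assms]
  by (smt (verit) mult_left_le_one_le mult_right_le_one_le norm_ge_zero)+

text \<open>The reflection \<open>1 - 2 q\<close> is unitary; written as an operator it makes sense without a unit.\<close>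

lemma norm_reflection_left:
  assumes "is_projection q" shows "norm (c - q * c - q * c) = norm c"
proof -
  let ?y = "c - q * c - q * c"
  have q: "q * q = q" "adj q = q" "q * (q * z) = q * z" for z
    using assms by (simp_all add: is_projection_def flip: mult.assoc)
  have "adj ?y = adj c - adj c * q - adj c * q" by (simp add: adj_diff adj_mult q)
  then have "adj ?y * ?y = (adj c - adj c * q - adj c * q) * ?y" by (rule arg_cong)
  also have "\<dots> = adj c * c" by (simp add: algebra_simps q)
  finally have "adj ?y * ?y = adj c * c" .
  then have "(norm ?y)\<^sup>2 = (norm c)\<^sup>2" using cstar_identity[of ?y] cstar_identity[of c] by simp
  then show ?thesis by simp
qed

lemma norm_reflection_right:
  assumes "is_projection q" shows "norm (c - c * q - c * q) = norm c"
proof -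
  have "adj (adj c - q * adj c - q * adj c) = c - c * q - c * q"
    using assms by (simp add: adj_diff adj_mult adj_adj is_projection_def)
  then show ?thesis using norm_reflection_left[OF assms, of "adj c"] by (metis norm_adj)
qed

lemma sum_orthogonal_projections:
  fixes t :: "'i \<Rightarrow> 'b::cstar_algebra"
  assumes "finite K" and t: "\<And>i. i \<in> K \<Longrightarrow> is_projection (t i)"
    and orth: "\<And>i j. i \<in> K \<Longrightarrow> j \<in> K \<Longrightarrow> i \<noteq> j \<Longrightarrow> t i * t j = 0"
  shows "is_projection (sum t K)"
    and "\<And>i. i \<in> K \<Longrightarrow> sum t K * t i = t i" and "\<And>i. i \<in> K \<Longrightarrow> t i * sum t K = t i"
proof -
  have tt: "t i * t i = t i" if "i \<in> K" for i using t[OF that] by (simp add: is_projection_def)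
  show l: "sum t K * t i = t i" if "i \<in> K" for i
  proof -
    have "sum t K * t i = (\<Sum>j\<in>K. t j * t i)" by (simp add: sum_distrib_right)
    also have "\<dots> = (\<Sum>j\<in>K. if j = i then t i else 0)"
      using orth tt that by (intro sum.cong) auto
    finally show ?thesis using assms(1) that by simp
  qed
  show "t i * sum t K = t i" if "i \<in> K" for i
  proof -
    have "t i * sum t K = (\<Sum>j\<in>K. t i * t j)" by (simp add: sum_distrib_left)
    also have "\<dots> = (\<Sum>j\<in>K. if j = i then t i else 0)"
      using orth tt that by (intro sum.cong) auto
    finally show ?thesis using assms(1) that by simp
  qed
  have "sum t K * sum t K = (\<Sum>i\<in>K. sum t K * t i)" by (rule sum_distrib_left)
  also have "\<dots> = sum t K" using l by (intro sum.cong) auto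
  finally have "sum t K * sum t K = sum t K" .
  moreover have "adj (sum t K) = sum t K"
    using t unfolding adj_sum is_projection_def by (intro sum.cong) auto
  ultimately show "is_projection (sum t K)" by (simp add: is_projection_def)
qed

text \<open>Averaging \<open>a\<close> with its two-sided reflection by \<open>r i\<close> and \<open>s i\<close> deletes the corners that
  couple the index \<open>i\<close> with the rest. Doing this for every index leaves the block diagonal
  \<open>\<Sum>i. r i * a * s i\<close> and a remainder in the complementary corner, which a final compression
  removes. Each step is contractive.\<close>

lemma norm_pinching_le:
  fixes r s :: "'i \<Rightarrow> 'b::cstar_algebra"
  assumes "finite I"
    and r: "\<And>i. i \<in> I \<Longrightarrow> is_projection (r i)" "\<And>i j. i \<in> I \<Longrightarrow> j \<in> I \<Longrightarrow> i \<noteq> j \<Longrightarrow> r i * r j = 0"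
    and s: "\<And>i. i \<in> I \<Longrightarrow> is_projection (s i)" "\<And>i j. i \<in> I \<Longrightarrow> j \<in> I \<Longrightarrow> i \<noteq> j \<Longrightarrow> s i * s j = 0"
  shows "norm (\<Sum>i\<in>I. r i * a * s i) \<le> norm a"
proof -
  define T where "T K = (\<Sum>i\<in>K. r i * a * s i)" for K
  define \<Gamma> where "\<Gamma> K = T K + (a - sum r K * a - a * sum s K + sum r K * a * sum s K)"
    for K
  have \<Gamma>: "norm (\<Gamma> K) \<le> norm a" if "K \<subseteq> I" for K
    using finite_subset[OF that assms(1)] that
  proof (induction K rule: finite_induct)
    case empty
    then show ?case by (simp add: \<Gamma>_def T_def)
  next
    case (insert k K)
    define p where "p = r k"
    define q where "q = s k"
    define f where "f = sum r K"
    define g where "g = sum s K"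
    define t where "t = T K"
    define x where "x = \<Gamma> K"
    have k: "is_projection p" "is_projection q" using insert.prems r s by (auto simp: p_def q_def)
    have z: "p * r i = 0" "s i * q = 0" if "i \<in> K" for i
      using that insert.hyps insert.prems r(2)[of k i] s(2)[of i k] by (auto simp: p_def q_def)
    have zf: "p * f = 0" "g * q = 0"
      using z by (simp_all add: f_def g_def sum_distrib_left sum_distrib_right)
    have "p * t = (\<Sum>i\<in>K. (p * r i) * a * s i)"
      by (simp add: t_def T_def sum_distrib_left mult.assoc)
    then have pt: "p * t = 0" using z by simp
    have "t * q = (\<Sum>i\<in>K. r i * a * (s i * q))"
      by (simp add: t_def T_def sum_distrib_right mult.assoc)
    then have tq: "t * q = 0" using z by simp
    have zf': "p * (f * c) = 0" for c
      using zf by (simp flip: mult.assoc)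
    have x: "x = t + (a - f * a - a * g + f * a * g)"
      by (simp add: x_def \<Gamma>_def t_def f_def g_def)
    have rx: "p * x = p * a - p * a * g"
      by (simp add: x algebra_simps pt zf')
    have xs: "x * q = a * q - f * a * q"
      by (simp add: x algebra_simps tq zf)
    have rxs: "p * x * q = p * a * q"
      by (simp add: rx algebra_simps zf)
    have T': "T (insert k K) = p * a * q + t" "sum r (insert k K) = p + f" "sum s (insert k K) = q + g"
      using insert.hyps by (simp_all add: T_def p_def q_def f_def g_def t_def)
    define y where "y = x - p * x - p * x"
    have \<Gamma>_insert: "\<Gamma> (insert k K) = x - p * x - x * q + p * x * q + p * x * q"
      unfolding rxs rx xs unfolding \<Gamma>_def T' x by (simp add: algebra_simps zf)
    have "\<Gamma> (insert k K) + \<Gamma> (insert k K) = x + (y - y * q - y * q)"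
      unfolding \<Gamma>_insert y_def by (simp add: algebra_simps)
    then have "norm (\<Gamma> (insert k K) + \<Gamma> (insert k K)) \<le> norm x + norm (y - y * q - y * q)"
      by (simp add: norm_triangle_ineq)
    also have "\<dots> = norm x + norm x"
      using k by (simp add: norm_reflection_left norm_reflection_right y_def)
    also have "\<dots> \<le> 2 * norm a" using insert by (simp add: x_def)
    finally show ?case by (simp flip: scaleR_2)
  qed
  note pr = sum_orthogonal_projections[OF assms(1), of r, OF r]
  note ps = sum_orthogonal_projections[OF assms(1), of s, OF s]
  define f where "f = sum r I"
  define g where "g = sum s I"
  have p: "is_projection f" "is_projection g" using pr(1) ps(1) by (auto simp: f_def g_def)
  have ff: "f * (f * c) = f * c" "g * g = g" for c
    using p by (simp_all add: is_projection_def flip: mult.assoc)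
  have "f * T I * g = (\<Sum>i\<in>I. (f * r i) * a * (s i * g))"
    by (simp add: T_def sum_distrib_left sum_distrib_right mult.assoc)
  also have "\<dots> = T I" unfolding T_def using pr(2) ps(3) by (intro sum.cong) (auto simp: f_def g_def)
  finally have "f * T I * g = T I" .
  then have "f * \<Gamma> I * g = T I"
    unfolding \<Gamma>_def f_def[symmetric] g_def[symmetric] by (simp add: algebra_simps ff)
  then have "norm (T I) \<le> norm (\<Gamma> I)"
    using norm_projection_mult_le[OF p(1), of "\<Gamma> I"]
      norm_projection_mult_le(2)[OF p(2), of "f * \<Gamma> I"] by simp
  then show ?thesis using \<Gamma>[of I] by (simp add: T_def)
qed

section \<open>Finite dimensional abelian C*-algebras\<close>

text \<open>A normal element is controlled by \<open>g* g\<close>, whose square is \<open>(g\<^sup>2)* g\<^sup>2\<close>.\<close>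

lemma normal_square_eq_0:
  assumes "adj g * g = g * adj g" and "g * g = 0" shows "g = (0::'b::cstar_algebra)"
proof -
  have "adj (adj g * g) * (adj g * g) = adj g * (g * adj g) * g"
    by (simp add: adj_mult adj_adj mult.assoc)
  also have "\<dots> = adj g * adj g * (g * g)"
    by (simp add: mult.assoc flip: assms(1))
  finally have "adj (adj g * g) * (adj g * g) = 0" using assms(2) by simp
  then show ?thesis unfolding adj_mult_self_eq_0 .
qed

text \<open>For a normal idempotent the element \<open>z - z* z\<close> satisfies \<open>w* w = 0\<close>, so \<open>z\<close> is self-adjoint.\<close>

lemma normal_idempotent_is_projection:
  assumes "adj z * z = z * adj z" and "z * z = z" shows "is_projection (z::'b::cstar_algebra)"
proof -
  have zz: "adj z * adj z = adj z" using assms(2) by (metis adj_mult)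
  have e: "z * (adj z * z) = adj z * z" "adj z * (adj z * z) = adj z * z"
     "z * (adj z) * z = adj z * z"
    using assms zz by (metis mult.assoc)+
  have "adj (z - adj z * z) * (z - adj z * z) = 0"
    using e assms(2) zz by (simp add: adj_diff adj_mult adj_adj algebra_simps)
  then have "z = adj z * z" unfolding adj_mult_self_eq_0 by simp
  then show ?thesis using assms(2) by (metis adj_adj adj_mult is_projection_def)
qed

text \<open>Since the algebra is finite dimensional, \<open>w, e w, e\<^sup>2 w, \<dots>\<close> are linearly dependent. Splitting
  the resulting polynomial into linear factors, the last nonzero partial product is an eigenvector of
  multiplication by \<open>e\<close>, and being a polynomial in \<open>e\<close> it acts on itself as a scalar, up to
  \<open>w\<close>.\<close>

lemma abelian_eigenvector:
  fixes C :: "'b::cstar_algebra set"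
  assumes C: "star_subalgebra C" "abelian C" "finite F" "C \<subseteq> complex_vector.span F"
    and ew: "e \<in> C" "w \<in> C" "w \<noteq> 0"
  obtains g \<alpha> \<gamma> where "g \<in> C" "g \<noteq> 0" "e * g = \<alpha> *\<^sub>C g" "g * g = \<gamma> *\<^sub>C (w * g)"
    "\<And>f. f * w = w \<Longrightarrow> f \<in> C \<Longrightarrow> f * g = g" "\<And>f. f * w = 0 \<Longrightarrow> f \<in> C \<Longrightarrow> f * g = 0"
proof -
  have sub: "complex_vector.subspace C" and mult: "\<And>x y. x \<in> C \<Longrightarrow> y \<in> C \<Longrightarrow> x * y \<in> C"
    and comm: "\<And>x y. x \<in> C \<Longrightarrow> y \<in> C \<Longrightarrow> x * y = y * x"
    using C by (auto simp: star_subalgebra_def subalgebra_def abelian_def)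
  define ev where "ev p = fold_coeffs (\<lambda>c x. c *\<^sub>C w + e * x) p 0" for p
  have ev_0 [simp]: "ev 0 = 0" by (simp add: ev_def)
  have ev_pCons [simp]: "ev (pCons c p) = c *\<^sub>C w + e * ev p" for c p
    by (cases "c = 0 \<and> p = 0") (auto simp: ev_def)
  have ev_add: "ev (p + q) = ev p + ev q" for p q
    by (induction p q rule: poly_induct2) (auto simp: algebra_simps scaleC_add_left)
  have ev_smult: "ev (smult c p) = c *\<^sub>C ev p" for c p
    by (induction p) (auto simp: scaleC_add_right scaleC_scaleC scaleC_mult_right)
  have ev_sum: "ev (sum f S) = (\<Sum>i\<in>S. ev (f i))" for f :: "nat \<Rightarrow> complex poly" and S
    by (induction S rule: infinite_finite_induct) (auto simp: ev_add)
  have ev_C: "ev p \<in> C" for p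
    by (induction p) (auto intro!: complex_vector.subspace_add[OF sub]
        complex_vector.subspace_scale[OF sub] mult ew complex_vector.subspace_0[OF sub])
  have "\<exists>p. p \<noteq> 0 \<and> ev p = 0"
  proof (rule ccontr)
    assume no: "\<not> ?thesis"
    define b where "b i = ev (monom 1 i)" for i
    have ev_diff: "ev (p - q) = ev p - ev q" for p q
      using ev_add[of "p - q" q] by simp
    have inj: "inj b"
    proof (rule injI)
      fix i j assume "b i = b j"
      then have "ev (monom 1 i - monom 1 j) = 0" by (simp add: ev_diff b_def)
      with no have "monom (1::complex) i = monom 1 j" by (metis right_minus_eq)
      then show "i = j" by (simp add: monom_eq_iff')
    qed
    let ?S = "b ` {..card F}"
    have "\<not> complex_vector.dependent ?S"
    proof
      assume "complex_vector.dependent ?S"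
      then obtain u where u: "\<exists>v\<in>?S. u v \<noteq> 0" "(\<Sum>v\<in>?S. u v *\<^sub>C v) = 0"
        using complex_vector.dependent_finite[of ?S] by auto
      let ?p = "\<Sum>i\<le>card F. smult (u (b i)) (monom 1 i)"
      have "ev ?p = (\<Sum>v\<in>?S. u v *\<^sub>C v)"
        by (subst sum.reindex) (auto simp: ev_sum ev_smult b_def intro!: inj_on_subset[OF inj])
      with u no have "?p = 0" by auto
      moreover obtain k where k: "k \<le> card F" "u (b k) \<noteq> 0" using u by auto
      moreover have "coeff ?p k = u (b k)" using k by (simp add: coeff_sum sum.remove[of _ k])
      ultimately show False by (metis coeff_0)
    qed
    moreover have "?S \<subseteq> complex_vector.span F" using C ev_C by (auto simp: b_def)
    ultimately have "card ?S \<le> card F"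
      using complex_vector.independent_span_bound[OF C(3)] by blast
    moreover have "card ?S = Suc (card F)"
      by (subst card_image) (auto intro!: inj_on_subset[OF inj])
    ultimately show False by simp
  qed
  then obtain p where "p \<noteq> 0" "ev p = 0" by blast
  then have "\<exists>r \<alpha>. ev r \<noteq> 0 \<and> e * ev r = \<alpha> *\<^sub>C ev r"
  proof (induction "degree p" arbitrary: p rule: less_induct)
    case less
    have "degree p \<noteq> 0"
    proof
      assume "degree p = 0"
      then obtain c where "p = [:c:]" by (metis degree_eq_zeroE)
      with less ew show False by (auto simp: complex_vector.scale_eq_0_iff)
    qed
    then obtain \<alpha> where "poly p \<alpha> = 0"
      using fundamental_theorem_of_algebra[of p] constant_degree[of p] by auto
    then obtain g where g: "p = [:-\<alpha>, 1:] * g" by (metis dvd_def poly_eq_0_iff_dvd)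
    have "p = smult (-\<alpha>) g + pCons 0 g" unfolding g by simp
    then have ev_p: "ev p = e * ev g - \<alpha> *\<^sub>C ev g"
      by (simp only: ev_add ev_smult ev_pCons) (simp add: complex_vector.scale_minus_left)
    show ?case
    proof (cases "ev g = 0")
      case True
      have "g \<noteq> 0" using less g by auto
      then have "degree g < degree p" unfolding g by (subst degree_mult_eq) auto
      with less True \<open>g \<noteq> 0\<close> show ?thesis by blast
    next
      case False
      then show ?thesis using ev_p less.prems by auto
    qed
  qed
  then obtain r \<alpha> where r: "ev r \<noteq> 0" "e * ev r = \<alpha> *\<^sub>C ev r" by blast
  have act: "ev p * ev r = poly p \<alpha> *\<^sub>C (w * ev r)" for p
  proof (induction p)
    case (pCons c p)
    have "e * (w * ev r) = \<alpha> *\<^sub>C (w * ev r)"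
    proof -
      have "e * (w * ev r) = w * (e * ev r)" using comm[OF ew(1,2)] by (simp flip: mult.assoc)
      then show ?thesis by (simp add: r(2) scaleC_mult_right)
    qed
    then show ?case using pCons
      by (simp add: distrib_right scaleC_mult_left mult.assoc scaleC_mult_right scaleC_add_left
          scaleC_scaleC mult.commute)
  qed simp
  have fix_w: "f * ev p = ev p" if "f * w = w" "f \<in> C" for f p
  proof (induction p)
    case (pCons c p)
    have "f * (e * ev p) = e * (f * ev p)"
      using comm[OF that(2) ew(1)] by (simp flip: mult.assoc)
    then show ?case using that pCons by (simp add: distrib_left scaleC_mult_right)
  qed simp
  have kill_w: "f * ev p = 0" if "f * w = 0" "f \<in> C" for f p
  proof (induction p)
    case (pCons c p)
    have "f * (e * ev p) = e * (f * ev p)"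
      using comm[OF that(2) ew(1)] by (simp flip: mult.assoc)
    then show ?case using that pCons by (simp add: distrib_left scaleC_mult_right)
  qed simp
  show ?thesis
    by (rule that[of "ev r" \<alpha> "poly r \<alpha>"]) (use ev_C r act fix_w kill_w in auto)
qed

definition projection_basis :: "'b::cstar_algebra set \<Rightarrow> 'b set \<Rightarrow> bool" where
  "projection_basis C Q \<longleftrightarrow> finite Q \<and> Q \<subseteq> C \<and> (\<forall>q\<in>Q. is_projection q \<and> q \<noteq> 0) \<and>
     (\<forall>q\<in>Q. \<forall>r\<in>Q. q \<noteq> r \<longrightarrow> q * r = 0) \<and>
     (\<forall>d\<in>C. \<forall>q\<in>Q. \<exists>c. q * d = c *\<^sub>C q) \<and> (\<forall>d\<in>C. (\<Sum>q\<in>Q. q * d) = d)"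

text \<open>An orthogonal family of nonzero projections of the largest possible size works: an
  eigenvector inside \<open>q C\<close> that is not a multiple of \<open>q\<close> would split \<open>q\<close>, and one orthogonal to the
  whole family would enlarge it.\<close>

lemma finite_dimensional_abelian_projection_basis:
  fixes C :: "'b::cstar_algebra set"
  assumes C: "star_subalgebra C" "abelian C" "finite F" "C \<subseteq> complex_vector.span F"
  shows "\<exists>Q. projection_basis C Q"
proof -
  have sub: "complex_vector.subspace C" and mult: "\<And>x y. x \<in> C \<Longrightarrow> y \<in> C \<Longrightarrow> x * y \<in> C"
    and adjC: "\<And>x. x \<in> C \<Longrightarrow> adj x \<in> C"
    and comm: "\<And>x y. x \<in> C \<Longrightarrow> y \<in> C \<Longrightarrow> x * y = y * x"
    using C by (auto simp: star_subalgebra_def subalgebra_def abelian_def)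
  define orth where "orth Q \<longleftrightarrow> finite Q \<and> Q \<subseteq> C \<and> (\<forall>q\<in>Q. is_projection q \<and> q \<noteq> 0) \<and>
     (\<forall>q\<in>Q. \<forall>r\<in>Q. q \<noteq> r \<longrightarrow> q * r = 0)" for Q
  have bound: "card Q \<le> card F" if orthQ: "orth Q" for Q
  proof -
    have "\<not> complex_vector.dependent Q"
    proof
      assume "complex_vector.dependent Q"
      then obtain u where u: "\<exists>v\<in>Q. u v \<noteq> 0" "(\<Sum>v\<in>Q. u v *\<^sub>C v) = 0"
        using complex_vector.dependent_finite[of Q] orthQ by (auto simp: orth_def)
      then obtain q where q: "q \<in> Q" "u q \<noteq> 0" by auto
      have qv: "q * v = (if v = q then q else 0)" if "v \<in> Q" for v
        using orthQ q that unfolding orth_def is_projection_def by (auto; metis)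
      have "q * (\<Sum>v\<in>Q. u v *\<^sub>C v) = (\<Sum>v\<in>Q. if v = q then u q *\<^sub>C q else 0)"
        unfolding sum_distrib_left by (intro sum.cong) (auto simp: scaleC_mult_right qv)
      also have "\<dots> = u q *\<^sub>C q" using q orthQ by (simp add: orth_def)
      finally have "q * (\<Sum>v\<in>Q. u v *\<^sub>C v) = u q *\<^sub>C q" .
      then show False using u q orthQ
        by (auto simp: orth_def complex_vector.scale_eq_0_iff)
    qed
    then show ?thesis
      using complex_vector.independent_span_bound[OF C(3)] orthQ C(4) by (auto simp: orth_def)
  qed
  have normalize: "\<exists>z c. z \<in> C \<and> is_projection z \<and> z \<noteq> 0 \<and> z = c *\<^sub>C g"
    if "g \<in> C" "g \<noteq> 0" "g * g = \<beta> *\<^sub>C g" for g \<beta>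
  proof -
    have n: "adj y * y = y * adj y" if "y \<in> C" for y using comm adjC that by blast
    have \<beta>: "\<beta> \<noteq> 0" using normal_square_eq_0[OF n] that by auto
    let ?z = "(1 / \<beta>) *\<^sub>C g"
    have "?z \<in> C" using that sub by (simp add: complex_vector.subspace_scale)
    moreover have "?z * ?z = ?z"
      using \<beta> that by (simp add: scaleC_mult_left scaleC_mult_right scaleC_scaleC)
    moreover have "?z \<noteq> 0" using \<beta> that by (simp add: complex_vector.scale_eq_0_iff)
    ultimately show ?thesis using normal_idempotent_is_projection n by blast
  qed
  have "orth {}" by (simp add: orth_def)
  then obtain Q where Q: "orth Q" and max: "\<And>Q'. orth Q' \<Longrightarrow> card Q' \<le> card Q"
    using ex_has_greatest_nat[of orth "{}" card "Suc (card F)"] bound le_imp_less_Suc by blast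
  have QC: "q \<in> C" "is_projection q" "q \<noteq> 0" "q * q = q" if "q \<in> Q" for q
    using Q that by (auto simp: orth_def is_projection_def)
  have Qo: "q * r = 0" if "q \<in> Q" "r \<in> Q" "q \<noteq> r" for q r using Q that by (auto simp: orth_def)
  have fin: "finite Q" using Q by (simp add: orth_def)
  have corner: "\<exists>c. q * d = c *\<^sub>C q" if d: "d \<in> C" and q: "q \<in> Q" for d q
  proof -
    have "q * d \<in> C" using mult d QC q by blast
    then obtain g \<alpha> \<gamma> where g: "g \<in> C" "g \<noteq> 0" "q * d * g = \<alpha> *\<^sub>C g" "g * g = \<gamma> *\<^sub>C (q * g)"
      "\<And>f. f * q = q \<Longrightarrow> f \<in> C \<Longrightarrow> f * g = g"
      using abelian_eigenvector[OF C, of "q * d" q] QC[OF q] by metis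
    have qg: "q * g = g" using g(5) QC q by blast
    obtain z c where z: "z \<in> C" "is_projection z" "z \<noteq> 0" "z = c *\<^sub>C g"
      using normalize[of g \<gamma>] g qg by auto
    have qz: "q * z = z" "z * q = z"
      using qg z QC[OF q] comm[of z q] by (auto simp: scaleC_mult_right)
    have "z = q"
    proof (rule ccontr)
      assume ne: "z \<noteq> q"
      let ?Q = "insert z (insert (q - z) (Q - {q}))"
      have pz: "z * z = z" "adj z = z" "adj q = q" "q * q = q"
        using z QC[OF q] by (auto simp: is_projection_def)
      have 1: "is_projection (q - z)"
        using pz qz by (simp add: is_projection_def adj_diff algebra_simps)
      have 2: "q - z \<noteq> 0" "q - z \<in> C" using ne QC q z sub
        by (auto intro: complex_vector.subspace_diff)
      have 3: "z * (q - z) = 0" "(q - z) * z = 0" using qz pz by (auto simp: algebra_simps)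
      have 4: "z * r = 0" "r * z = 0" "(q - z) * r = 0" "r * (q - z) = 0" if "r \<in> Q" "r \<noteq> q" for r
      proof -
        show a: "z * r = 0" "r * z = 0" using Qo[OF q that(1)] Qo[OF that(1) q] that qz
          by (metis mult.assoc mult_zero_left mult_zero_right)+
        show "(q - z) * r = 0" "r * (q - z) = 0" using a Qo[OF q that(1)] Qo[OF that(1) q] that
          by (auto simp: algebra_simps)
      qed
      have "a * b = 0" if "a \<in> ?Q" "b \<in> ?Q" "a \<noteq> b" for a b
      proof -
        have "a = z \<or> a = q - z \<or> a \<in> Q \<and> a \<noteq> q" "b = z \<or> b = q - z \<or> b \<in> Q \<and> b \<noteq> q"
          using that by auto
        then show ?thesis using \<open>a \<noteq> b\<close> 3 4 Qo by (elim disjE conjE) simp_all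
      qed
      moreover have "is_projection a \<and> a \<noteq> 0 \<and> a \<in> C" if "a \<in> ?Q" for a
        using that 1 2 z QC by auto
      ultimately have "orth ?Q"
        using fin unfolding orth_def by blast
      moreover have "z \<noteq> q - z" using 3 pz z by metis
      moreover have "z \<notin> Q - {q}" "q - z \<notin> Q - {q}"
        using 4(1)[of z] 4(3)[of "q - z"] pz z 1 2 unfolding is_projection_def by auto
      ultimately have "card ?Q = Suc (Suc (card (Q - {q})))"
        using fin by (subst card_insert_disjoint; simp)+
      also have "\<dots> = Suc (card Q)" using fin q by (simp only: card_Suc_Diff1)
      finally show False using max[OF \<open>orth ?Q\<close>] by simp
    qed
    then have "q * d * q = c *\<^sub>C (q * d * g)" using z(4) by (metis scaleC_mult_right)
    also have "\<dots> = \<alpha> *\<^sub>C q"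
      using \<open>z = q\<close> z(4) by (simp add: g(3) scaleC_scaleC mult.commute[of c])
        (simp flip: scaleC_scaleC)
    finally have "q * d * q = \<alpha> *\<^sub>C q" .
    then have "q * d = \<alpha> *\<^sub>C q" using comm[OF d QC(1)[OF q]] QC(4)[OF q] by (metis mult.assoc)
    then show ?thesis by blast
  qed
  have total: "(\<Sum>q\<in>Q. q * d) = d" if d: "d \<in> C" for d
  proof (rule ccontr)
    assume ne: "(\<Sum>q\<in>Q. q * d) \<noteq> d"
    let ?n = "d - (\<Sum>q\<in>Q. q * d)"
    have "?n \<in> C" using d QC mult sub
      by (intro complex_vector.subspace_diff complex_vector.subspace_sum) auto
    have qn: "q * ?n = 0" if "q \<in> Q" for q
    proof -
      have "q * (\<Sum>q\<in>Q. q * d) = (\<Sum>r\<in>Q. (q * r) * d)" by (simp add: sum_distrib_left mult.assoc)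
      also have "\<dots> = (\<Sum>r\<in>Q. if r = q then q * d else 0)"
        using Qo QC that by (intro sum.cong) auto
      also have "\<dots> = q * d" using that fin by simp
      finally show ?thesis by (simp add: algebra_simps)
    qed
    obtain g \<alpha> \<gamma> where g: "g \<in> C" "g \<noteq> 0" "?n * g = \<alpha> *\<^sub>C g" "g * g = \<gamma> *\<^sub>C (?n * g)"
      "\<And>f. f * ?n = 0 \<Longrightarrow> f \<in> C \<Longrightarrow> f * g = 0"
      using abelian_eigenvector[OF C, of ?n ?n] \<open>?n \<in> C\<close> ne by (metis right_minus_eq)
    obtain z c where z: "z \<in> C" "is_projection z" "z \<noteq> 0" "z = c *\<^sub>C g"
      using normalize[of g "\<gamma> * \<alpha>"] g by (auto simp: scaleC_scaleC)
    have qz: "q * z = 0" "z * q = 0" if "q \<in> Q" for q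
      using g(5)[OF qn[OF that]] QC[OF that] z comm[of z q] by (auto simp: scaleC_mult_right)
    have "z \<notin> Q" using qz z by (auto simp: is_projection_def)
    moreover have "orth (insert z Q)" using Q qz z by (auto simp: orth_def)
    ultimately show False using max[of "insert z Q"] fin by simp
  qed
  show ?thesis unfolding projection_basis_def
    using Q corner total by (auto simp: orth_def)
qed

section \<open>AF algebras with a canonical masa\<close>

lemma closure_increasing_abelian_subalgebras:
  fixes Cs :: "nat \<Rightarrow> 'b::cstar_algebra set"
  assumes Cs: "\<And>i. star_subalgebra (Cs i)" "\<And>i. abelian (Cs i)" "mono Cs"
  shows "star_subalgebra (closure (\<Union>i. Cs i))" "abelian (closure (\<Union>i. Cs i))"
proof -
  let ?U = "\<Union>i. Cs i"
  have common: "\<exists>i. a \<in> Cs i \<and> b \<in> Cs i" if "a \<in> ?U" "b \<in> ?U" for a b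
    using that monoD[OF Cs(3)] by (metis UN_E linear subsetD)
  have U: "0 \<in> ?U" "a + b \<in> ?U" "a * b \<in> ?U" "c *\<^sub>C a \<in> ?U" "adj a \<in> ?U" "a * b = b * a"
    if ab: "a \<in> ?U" "b \<in> ?U" for a b c
  proof -
    obtain i where i: "a \<in> Cs i" "b \<in> Cs i" using common[OF ab] by blast
    have "0 \<in> Cs i" "a + b \<in> Cs i" "a * b \<in> Cs i" "c *\<^sub>C a \<in> Cs i" "adj a \<in> Cs i"
      using Cs(1)[of i] i
      unfolding star_subalgebra_def subalgebra_def complex_vector.subspace_def by auto
    then show "0 \<in> ?U" "a + b \<in> ?U" "a * b \<in> ?U" "c *\<^sub>C a \<in> ?U" "adj a \<in> ?U" by blast+
    show "a * b = b * a" using Cs(2)[of i] i unfolding abelian_def by auto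
  qed
  have "0 \<in> ?U"
    using Cs(1)[of 0] unfolding star_subalgebra_def subalgebra_def complex_vector.subspace_def by blast
  have cl: "P (closure ?U) x y"
    if "x \<in> closure ?U" "y \<in> closure ?U"
      "\<And>a b. (\<And>n. a n \<in> ?U) \<Longrightarrow> (\<And>n. b n \<in> ?U) \<Longrightarrow> a \<longlonglongrightarrow> x \<Longrightarrow> b \<longlonglongrightarrow> y \<Longrightarrow> P (closure ?U) x y"
    for P x y
    using that unfolding closure_sequential by metis
  have cl_U: "x + y \<in> closure ?U \<and> x * y \<in> closure ?U \<and> (\<forall>c. c *\<^sub>C x \<in> closure ?U) \<and> adj x \<in> closure ?U
      \<and> x * y = y * x"
    if "x \<in> closure ?U" "y \<in> closure ?U" for x y
    using that
  proof (rule cl)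
    fix a b assume ab: "\<And>n. a n \<in> ?U" "\<And>n. b n \<in> ?U" "a \<longlonglongrightarrow> x" "b \<longlonglongrightarrow> y"
    have add: "(\<lambda>n. a n + b n) \<longlonglongrightarrow> x + y" and mult: "(\<lambda>n. a n * b n) \<longlonglongrightarrow> x * y"
      and adj: "(\<lambda>n. adj (a n)) \<longlonglongrightarrow> adj x" and scale: "(\<lambda>n. c *\<^sub>C a n) \<longlonglongrightarrow> c *\<^sub>C x" for c
      by (intro tendsto_intros ab)+
    moreover have "(\<lambda>n. a n * b n) \<longlonglongrightarrow> y * x"
      using tendsto_mult[OF ab(4,3)] U(6)[OF ab(1,2)] by (simp del: UN_iff)
    ultimately have "x * y = y * x" using LIMSEQ_unique by blast
    have lim: "z \<in> closure ?U" if "\<And>n. f n \<in> ?U" "f \<longlonglongrightarrow> z" for f z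
      using that unfolding closure_sequential by blast
    have "a n + b n \<in> ?U" "a n * b n \<in> ?U" "c *\<^sub>C a n \<in> ?U" "adj (a n) \<in> ?U" for n c
      using U(2-5)[OF ab(1)[of n] ab(2)[of n]] .
    note lim[OF this(1) add] lim[OF this(2) mult] lim[OF this(3) scale] lim[OF this(4) adj]
    with \<open>x * y = y * x\<close> show ?thesis by simp
  qed
  have "0 \<in> closure ?U" using closure_subset \<open>0 \<in> ?U\<close> by (rule subsetD)
  with cl_U show "star_subalgebra (closure ?U)" "abelian (closure ?U)"
    unfolding star_subalgebra_def subalgebra_def abelian_def complex_vector.subspace_def by metis+
qed

text \<open>The set \<open>insert b C\<close> is self-adjoint and commutative, so its bicommutant relative to \<open>M\<close> is an
  abelian *-subalgebra, which by maximality is no larger than \<open>C\<close>.\<close>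

lemma masa_contains_commuting:
  fixes C M :: "'b::cstar_algebra set"
  assumes M: "star_subalgebra M" and C: "masa_in C M"
    and b: "b \<in> M" "adj b = b" "\<And>d. d \<in> C \<Longrightarrow> b * d = d * b"
  shows "b \<in> C"
proof -
  define K where "K S = {c \<in> M. \<forall>s\<in>S. c * s = s * c}" for S
  let ?S = "insert b C"
  have SM: "?S \<subseteq> M" using b C by (auto simp: masa_in_def)
  have adjS: "adj s \<in> ?S" if "s \<in> ?S" for s
    using that b C by (auto simp: masa_in_def star_subalgebra_def)
  have alg: "star_subalgebra (K T)" if "\<And>s. s \<in> T \<Longrightarrow> adj s \<in> T" for T
  proof -
    have "adj c * s = s * adj c" if "c \<in> K T" "s \<in> T" for c s
    proof -
      have "c * adj s = adj s * c" using that \<open>\<And>s. s \<in> T \<Longrightarrow> adj s \<in> T\<close> by (auto simp: K_def)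
      then have "adj (c * adj s) = adj (adj s * c)" by simp
      then show ?thesis by (simp add: adj_mult adj_adj)
    qed
    moreover have "c * d * s = s * (c * d)" if "c * s = s * c" "d * s = s * d" for c d s :: 'b
      using that by (metis mult.assoc)
    ultimately show ?thesis using M
      unfolding star_subalgebra_def subalgebra_def complex_vector.subspace_def K_def
      by (auto simp: distrib_left distrib_right scaleC_mult_left scaleC_mult_right)
  qed
  have K1: "star_subalgebra (K ?S)" using alg adjS by blast
  then have "star_subalgebra (K (K ?S))" using alg unfolding star_subalgebra_def by blast
  moreover have comm: "s * t = t * s" if "s \<in> ?S" "t \<in> ?S" for s t
    using that b C unfolding masa_in_def abelian_def by auto
  then have "?S \<subseteq> K ?S" using SM by (auto simp: K_def)
  then have "K (K ?S) \<subseteq> K ?S" by (auto simp: K_def)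
  then have "abelian (K (K ?S))" unfolding abelian_def K_def by blast
  moreover have "?S \<subseteq> K (K ?S)" using SM by (auto simp: K_def)
  moreover have "K (K ?S) \<subseteq> M" by (auto simp: K_def)
  ultimately have "K (K ?S) = C" using C unfolding masa_in_def by blast
  then show ?thesis using \<open>?S \<subseteq> K (K ?S)\<close> by blast
qed

locale af_masa =
  fixes Bs :: "nat \<Rightarrow> 'b::cstar_algebra set" and D :: "'b set" and Q :: "nat \<Rightarrow> 'b set"
  assumes sequence: "canonical_masa_sequence Bs D"
    and basis: "\<And>i. projection_basis (D \<inter> Bs i) (Q i)"
begin

lemma Bs: "complex_vector.subspace (Bs i)" "a \<in> Bs i \<Longrightarrow> b \<in> Bs i \<Longrightarrow> a * b \<in> Bs i"
  "a \<in> Bs i \<Longrightarrow> adj a \<in> Bs i" "star_subalgebra (Bs i)"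
  using sequence by (auto simp: canonical_masa_sequence_def star_subalgebra_def subalgebra_def)

lemma Bs_mono: "i \<le> j \<Longrightarrow> Bs i \<subseteq> Bs j"
  using sequence lift_Suc_mono_le[of Bs i j] unfolding canonical_masa_sequence_def by blast

lemma Bs_dense:
  assumes "\<epsilon> > 0" obtains i b where "b \<in> Bs i" "norm (a - b) < \<epsilon>"
proof -
  have "a \<in> closure (\<Union>i. Bs i)" using sequence by (auto simp: canonical_masa_sequence_def)
  then show ?thesis using assms that unfolding closure_approachable
    by (metis UN_E dist_commute dist_norm)
qed

lemma masa: "masa_in (D \<inter> Bs i) (Bs i)"
  using sequence by (auto simp: canonical_masa_sequence_def)

lemma D_eq: "D = closure (\<Union>i. D \<inter> Bs i)"
  using sequence by (auto simp: canonical_masa_sequence_def)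

lemma D_closed: "closed D"
  using D_eq closed_closure by metis

lemma D_star_abelian: "star_subalgebra D" "abelian D"
proof -
  have "mono (\<lambda>i. D \<inter> Bs i)" using Bs_mono by (auto intro!: monoI)
  note * = closure_increasing_abelian_subalgebras[OF _ _ this, folded D_eq]
  show "star_subalgebra D" "abelian D" using masa by (intro *; auto simp: masa_in_def)+
qed

lemma D: "complex_vector.subspace D" "a \<in> D \<Longrightarrow> b \<in> D \<Longrightarrow> a * b \<in> D"
  "a \<in> D \<Longrightarrow> adj a \<in> D"  "a \<in> D \<Longrightarrow> b \<in> D \<Longrightarrow> a * b = b * a"
  using D_star_abelian by (auto simp: star_subalgebra_def subalgebra_def abelian_def)

lemma D_approx:
  assumes "d \<in> D" obtains e i where "e \<longlonglongrightarrow> d" "\<And>n::nat. e n \<in> D \<inter> Bs (i n)"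
proof -
  from assms have "d \<in> closure (\<Union>i. D \<inter> Bs i)" using D_eq by simp
  then obtain e where e: "\<And>n. e n \<in> (\<Union>i. D \<inter> Bs i)" "e \<longlonglongrightarrow> d"
    unfolding closure_sequential by metis
  then have "\<forall>n. \<exists>i. e n \<in> D \<inter> Bs i" by blast
  then show ?thesis using that e by metis
qed

lemma Q_finite: "finite (Q i)"
  using basis by (auto simp: projection_basis_def)

lemma Q:
  assumes "q \<in> Q i"
  shows "q \<in> D" "q \<in> Bs i" "is_projection q" "q * q = q" "adj q = q" "q \<noteq> 0"
  using assms basis[of i] by (auto simp: projection_basis_def is_projection_def)

lemma Q_orth: "q \<in> Q i \<Longrightarrow> r \<in> Q i \<Longrightarrow> q \<noteq> r \<Longrightarrow> q * r = 0"
  using basis[of i] by (auto simp: projection_basis_def)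

lemma Q_scalar:
  assumes "q \<in> Q i" "d \<in> D" "d \<in> Bs i" obtains c where "q * d = c *\<^sub>C q" "d * q = c *\<^sub>C q"
proof -
  obtain c where "q * d = c *\<^sub>C q"
    using assms basis[of i] unfolding projection_basis_def by (metis IntI)
  moreover have "d * q = q * d" using D(4) assms Q(1) by blast
  ultimately show ?thesis using that by metis
qed

lemma Q_sum: "d \<in> D \<Longrightarrow> d \<in> Bs i \<Longrightarrow> (\<Sum>q\<in>Q i. q * d) = d"
  using basis[of i] by (auto simp: projection_basis_def)

text \<open>Let \<open>f\<close> be the sum of the minimal projections, and \<open>c = b - f b\<close>. The element \<open>c c*\<close> of \<open>Bs i\<close>
  annihilates \<open>D \<inter> Bs i\<close> on both sides, so it belongs to the masa, where \<open>f\<close> is a unit; but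
  \<open>f c = 0\<close>.\<close>

lemma Q_sum_unit:
  assumes "b \<in> Bs i" shows "(\<Sum>q\<in>Q i. q) * b = b" "b * (\<Sum>q\<in>Q i. q) = b"
proof -
  define f where "f = (\<Sum>q\<in>Q i. q)"
  have f: "f * f = f" "adj f = f" "f \<in> Bs i"
  proof -
    have "is_projection f" using sum_orthogonal_projections(1)[of "Q i" "\<lambda>q. q"] Q_finite Q(3) Q_orth
      by (auto simp: f_def)
    then show "f * f = f" "adj f = f" by (auto simp: is_projection_def)
    show "f \<in> Bs i" unfolding f_def using Bs(1) Q(2) by (intro complex_vector.subspace_sum) auto
  qed
  have fd: "f * d = d" "d * f = d" if "d \<in> D" "d \<in> Bs i" for d
  proof -
    show "f * d = d" using Q_sum[OF that] by (simp add: f_def sum_distrib_right)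
    have "f * adj d = adj d"
      using Q_sum[OF D(3)[OF that(1)] Bs(3)[OF that(2)]] by (simp add: f_def sum_distrib_right)
    then show "d * f = d" by (metis adj_adj adj_mult f(2))
  qed
  have left: "f * b = b" if b: "b \<in> Bs i" for b
  proof -
    let ?c = "b - f * b"
    have fc: "f * ?c = 0" using f by (simp add: algebra_simps flip: mult.assoc)
    have "?c \<in> Bs i" using b f Bs by (auto intro: complex_vector.subspace_diff)
    then have cc: "?c * adj ?c \<in> Bs i" using Bs by blast
    have dc: "d * (?c * adj ?c) = 0" "(?c * adj ?c) * d = 0" if "d \<in> D" "d \<in> Bs i" for d
    proof -
      have "d * (?c * adj ?c) = d * (f * ?c) * adj ?c"
        using fd(2)[OF that] by (simp flip: mult.assoc)
      then show "d * (?c * adj ?c) = 0" using fc by simp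
      have "(?c * adj ?c) * d = ?c * adj (f * ?c) * d"
        using fd(1)[OF that] by (simp add: adj_mult f(2) mult.assoc)
      then show "(?c * adj ?c) * d = 0" using fc by simp
    qed
    have "?c * adj ?c \<in> D \<inter> Bs i"
      by (rule masa_contains_commuting[OF Bs(4) masa cc]) (auto simp: adj_mult adj_adj dc)
    then have "?c * adj ?c = f * ?c * adj ?c" using fd by (metis IntE mult.assoc)
    then have "adj ?c = 0" using adj_mult_self_eq_0[of "adj ?c"] fc by (simp add: adj_adj)
    then have "?c = 0" using norm_adj[of ?c] by simp
    then show ?thesis by simp
  qed
  show "(\<Sum>q\<in>Q i. q) * b = b" using left assms by (simp add: f_def)
  have "f * adj b = adj b" using left Bs assms by blast
  then show "b * (\<Sum>q\<in>Q i. q) = b" by (metis adj_adj adj_mult f(2) f_def)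
qed

text \<open>Since \<open>D \<inter> Bs i\<close> acts on \<open>q\<close> by scalars, a self-adjoint element of the corner \<open>q (Bs i) q\<close>
  commutes with it and so belongs to it.\<close>

lemma Q_minimal:
  assumes q: "q \<in> Q i" and b: "b \<in> Bs i" obtains c where "q * b * q = c *\<^sub>C q"
proof -
  have self: "\<exists>c. q * b * q = c *\<^sub>C q" if b: "b \<in> Bs i" "adj b = b" for b
  proof -
    let ?y = "q * b * q"
    have y: "?y \<in> Bs i" "adj ?y = ?y" using q b Bs Q by (auto simp: adj_mult mult.assoc)
    have "?y * d = d * ?y" if "d \<in> D \<inter> Bs i" for d
    proof -
      from that have "d \<in> D" "d \<in> Bs i" by auto
      then obtain c where "q * d = c *\<^sub>C q" "d * q = c *\<^sub>C q" by (rule Q_scalar[OF q])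
      then show ?thesis
        by (simp add: scaleC_mult_right mult.assoc) (simp add: scaleC_mult_left flip: mult.assoc)
    qed
    then have "?y \<in> D \<inter> Bs i" using masa_contains_commuting[OF Bs(4) masa y] by blast
    then obtain c where "q * ?y = c *\<^sub>C q" using Q_scalar[OF q] by blast
    then show ?thesis using Q(4)[OF q] by (metis mult.assoc)
  qed
  \<comment> \<open>The real and imaginary parts of \<open>2 b\<close>, the latter up to sign.\<close>
  define b1 where "b1 = b + adj b"
  define b2 where "b2 = \<i> *\<^sub>C (b - adj b)"
  have "b1 \<in> Bs i" "b2 \<in> Bs i" using b Bs
    by (auto simp: b1_def b2_def intro!: complex_vector.subspace_add complex_vector.subspace_diff
        complex_vector.subspace_scale)
  moreover have "adj b1 = b1" "adj b2 = b2"
    by (auto simp: b1_def b2_def adj_add adj_adj adj_scaleC adj_diff add.commute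
        complex_vector.scale_right_diff_distrib complex_vector.scale_minus_left)
  ultimately obtain c1 c2 where c: "q * b1 * q = c1 *\<^sub>C q" "q * b2 * q = c2 *\<^sub>C q"
    using self by blast
  have "b1 - \<i> *\<^sub>C b2 = (1 + 1) *\<^sub>C b"
    unfolding scaleC_add_left by (simp add: b1_def b2_def scaleC_scaleC scaleC_one
        complex_vector.scale_minus_left)
  then have "b = (1/2) *\<^sub>C (b1 - \<i> *\<^sub>C b2)" by (simp add: scaleC_scaleC scaleC_one)
  then have "q * b * q = (1/2) *\<^sub>C (q * b1 * q - \<i> *\<^sub>C (q * b2 * q))"
    by (simp add: scaleC_mult_right scaleC_mult_left right_diff_distrib left_diff_distrib)
  also have "\<dots> = ((c1 - \<i> * c2) / 2) *\<^sub>C q"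
    by (simp add: c scaleC_scaleC flip: complex_vector.scale_left_diff_distrib)
  finally show ?thesis using that by blast
qed

text \<open>By minimality of \<open>q\<close> and \<open>r\<close> an element \<open>b\<close> of \<open>q (Bs i) r\<close> has \<open>b* b\<close> and \<open>b b*\<close> equal to the
  same real multiple of \<open>r\<close> and \<open>q\<close>. The multiple cannot be negative: after scaling, \<open>c = b + b*\<close> would
  satisfy \<open>c\<^sup>2 = - (q + r)\<close>, so that \<open>w = (q + r) - \<i> c\<close> has \<open>w* w = 0\<close>, which forces the
  self-adjoint \<open>q + r\<close> to be equal to \<open>\<i> c\<close>.\<close>

lemma matrix_unit_exists:
  assumes q: "q \<in> Q i" and r: "r \<in> Q i" and b: "b \<in> Bs i" and nz: "q * b * r \<noteq> 0"
  obtains u where "u \<in> Bs i" "adj u * u = r" "u * adj u = q"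
proof -
  define v where "v = q * b * r"
  have vB: "v \<in> Bs i" and v0: "v \<noteq> 0" using q r b Bs Q nz by (auto simp: v_def)
  have v: "q * v = v" "v * r = v" using Q[OF q] Q[OF r]
    by (simp_all add: v_def mult.assoc) (simp flip: mult.assoc)
  have v': "adj v * q = adj v" "r * adj v = adj v"
    using v Q[OF q] Q[OF r] by (metis adj_mult)+
  obtain s where s: "adj v * v = s *\<^sub>C r"
  proof (rule Q_minimal[OF r, of "adj v * v"])
    show "adj v * v \<in> Bs i" using vB Bs by blast
    fix c assume "r * (adj v * v) * r = c *\<^sub>C r"
    then show thesis using that v v' by (simp add: mult.assoc) (metis mult.assoc)
  qed
  obtain s' where s': "v * adj v = s' *\<^sub>C q"
  proof (rule Q_minimal[OF q, of "v * adj v"])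
    show "v * adj v \<in> Bs i" using vB Bs by blast
    fix c assume "q * (v * adj v) * q = c *\<^sub>C q"
    then show thesis using that v v' by (simp add: mult.assoc) (metis mult.assoc)
  qed
  have "s *\<^sub>C v = v * (adj v * v)" using s v by (simp add: scaleC_mult_right)
  also have "\<dots> = s' *\<^sub>C v" using s' v by (simp add: scaleC_mult_left flip: mult.assoc)
  finally have ss: "s' = s" using v0 by (simp add: complex_vector.scale_cancel_right)
  have "adj (adj v * v) = adj v * v" by (simp add: adj_mult adj_adj)
  then have "cnj s *\<^sub>C r = s *\<^sub>C r" using s Q[OF r] by (simp add: adj_scaleC)
  then have "cnj s = s" using Q[OF r] by (simp add: complex_vector.scale_cancel_right)
  then obtain t where t: "s = complex_of_real t" by (metis complex_cnj_cancel_iff Reals_cases Reals_cnj_iff)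
  have s0: "s \<noteq> 0" using s v0 by (metis adj_mult_self_eq_0 complex_vector.scale_zero_left)
  \<comment> \<open>Rescaling \<open>v\<close> turns the multiple \<open>s = t\<close> into its sign.\<close>
  define k where "k = 1 / sqrt \<bar>t\<bar>"
  define u where "u = complex_of_real k *\<^sub>C v"
  have uB: "u \<in> Bs i" using vB Bs(1) by (auto simp: u_def complex_vector.subspace_scale)
  have kk: "complex_of_real k * complex_of_real k * s = of_real (sgn t)"
    using s0 unfolding t k_def by (simp flip: of_real_mult add: sgn_if field_simps abs_if)
  have uu: "adj u * u = of_real (sgn t) *\<^sub>C r" "u * adj u = of_real (sgn t) *\<^sub>C q"
    using kk s s' ss by (simp_all add: u_def adj_scaleC scaleC_mult_left scaleC_mult_right scaleC_scaleC mult.assoc)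
  have u: "q * u = u" "u * r = u" using v by (auto simp: u_def scaleC_mult_left scaleC_mult_right)
  have u': "adj u * q = adj u" "r * adj u = adj u"
    using u Q[OF q] Q[OF r] by (metis adj_mult)+
  show ?thesis
  proof (cases "t > 0")
    case True
    then show ?thesis using that uB uu by (simp add: scaleC_one)
  next
    case False
    then have "sgn t = -1" using s0 t by (auto simp: sgn_if)
    then have neg: "adj u * u = - r" "u * adj u = - q"
      using uu by (simp_all add: scaleC_one complex_vector.scale_minus_left)
    show ?thesis
    proof (cases "q = r")
      case True
      obtain c where "q * u * q = c *\<^sub>C q" using Q_minimal[OF q uB] .
      then have "u = c *\<^sub>C q" using u True by simp
      then have cc: "adj u * u = (c * cnj c) *\<^sub>C q"
        using Q[OF q] by (simp add: adj_scaleC scaleC_mult_left scaleC_mult_right scaleC_scaleC mult.commute)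
      have "(c * cnj c) *\<^sub>C q = - q" unfolding cc[symmetric] using neg(1) True by simp
      then have "(c * cnj c + 1) *\<^sub>C q = 0" by (simp add: scaleC_add_left scaleC_one)
      then have "c * cnj c + 1 = 0" using Q[OF q] by (simp add: complex_vector.scale_eq_0_iff)
      then have "complex_of_real ((cmod c)\<^sup>2 + 1) = 0" by (simp add: complex_mult_cnj cmod_power2)
      then show ?thesis by (smt (verit) of_real_eq_0_iff zero_le_power2)
    next
      case False
      then have qr: "q * r = 0" "r * q = 0" using Q_orth q r by auto
      have squares: "u * u = 0" "adj u * adj u = 0"
        using u u' qr by (metis mult.assoc mult_zero_left mult_zero_right)+
      have cross: "q * adj u = 0" "u * q = 0" "adj u * r = 0" "r * u = 0"
        using u u' qr by (metis mult.assoc mult_zero_left mult_zero_right)+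
      define c where "c = u + adj u"
      define w where "w = (q + r) - \<i> *\<^sub>C c"
      have c: "adj c = c" "c * c = - (q + r)" "(q + r) * c = c" "c * (q + r) = c"
        using neg squares u u' cross by (simp_all add: c_def adj_add adj_adj algebra_simps)
      have p: "(q + r) * (q + r) = q + r" "adj (q + r) = q + r"
        using Q[OF q] Q[OF r] qr by (simp_all add: adj_add algebra_simps)
      have adj_w: "adj w = (q + r) + \<i> *\<^sub>C c"
        using c p by (simp add: w_def adj_diff adj_scaleC complex_vector.scale_minus_left)
      have expand: "(e + \<i> *\<^sub>C c) * (e - \<i> *\<^sub>C c) = e * e - \<i> *\<^sub>C (e * c) + \<i> *\<^sub>C (c * e) + c * c" for e
        by (simp add: algebra_simps scaleC_mult_left scaleC_mult_right scaleC_scaleC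
            complex_vector.scale_minus_left scaleC_one)
      have "adj w * w = ((q + r) + \<i> *\<^sub>C c) * w" by (simp only: adj_w)
      also have "\<dots> = 0" unfolding w_def expand c p by simp
      finally have "w = 0" unfolding adj_mult_self_eq_0 .
      then have "q + r = \<i> *\<^sub>C c" "q + r = - (\<i> *\<^sub>C c)"
        using adj_w by (auto simp: w_def eq_neg_iff_add_eq_0)
      then have "(1 + 1) *\<^sub>C (q + r) = 0" unfolding scaleC_add_left scaleC_one
        by (metis add.right_inverse)
      then have "q + r = 0" by (simp add: complex_vector.scale_eq_0_iff)
      then have "q * (q + r) = 0" by simp
      then show ?thesis using qr Q[OF q] by (simp add: distrib_left)
    qed
  qed
qed

end

section \<open>The conditional expectation onto the masa\<close>

context af_masa
begin

definition pinch :: "nat \<Rightarrow> 'b \<Rightarrow> 'b" where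
  "pinch k c = (\<Sum>m\<in>Q k. m * c * m)"

definition expect :: "'b \<Rightarrow> 'b" where
  "expect c = lim (\<lambda>k. pinch k c)"

lemma norm_pinch_le: "norm (pinch k c) \<le> norm c"
  unfolding pinch_def by (rule norm_pinching_le) (auto intro: Q_finite Q(3) Q_orth)

lemma pinch_add: "pinch k (a + b) = pinch k a + pinch k b"
  by (simp add: pinch_def algebra_simps sum.distrib)

lemma pinch_diff: "pinch k (a - b) = pinch k a - pinch k b"
  by (simp add: pinch_def algebra_simps sum_subtractf)

lemma pinch_sum: "pinch k (sum f S) = (\<Sum>i\<in>S. pinch k (f i))"
  by (induction S rule: infinite_finite_induct) (auto simp: pinch_add, auto simp: pinch_def)

lemma pinch_adj: "pinch k (adj c) = adj (pinch k c)"
  unfolding pinch_def adj_sum by (intro sum.cong) (auto simp: adj_mult Q(5) mult.assoc)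

lemma pinch_masa:
  assumes "d \<in> D" "d \<in> Bs k" shows "pinch k d = d"
proof -
  have "m * d * m = m * d" if "m \<in> Q k" for m
    using D(4)[OF Q(1)[OF that] assms(1)] Q(4)[OF that] by (simp add: mult.assoc)
  then show ?thesis using Q_sum[OF assms] by (simp add: pinch_def)
qed

text \<open>A minimal projection of a later level lies below at most one minimal projection of an
  earlier level, so off-diagonal blocks at the earlier level are annihilated later on.\<close>

lemma pinch_block:
  assumes ik: "i \<le> k" and c: "c \<in> Bs i" and q: "q \<in> Q i" and r: "r \<in> Q i"
  shows "pinch k (q * c * r) = (if q = r then q * c * q else 0)"
proof (cases "q = r")
  case True
  obtain l where l: "q * c * q = l *\<^sub>C q" using Q_minimal[OF q c] .
  have "q * c * q \<in> D" "q * c * q \<in> Bs k"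
    using l D(1) Q[OF q] Bs_mono[OF ik] Bs(1)[of k]
    by (auto intro: complex_vector.subspace_scale)
  then show ?thesis using True pinch_masa by simp
next
  case False
  have "m * (q * c * r) * m = 0" if m: "m \<in> Q k" for m
  proof -
    have "q \<in> Bs k" "r \<in> Bs k" using Q q r Bs_mono[OF ik] by auto
    obtain l where l: "m * q = l *\<^sub>C m" using Q_scalar[OF m Q(1)[OF q] \<open>q \<in> Bs k\<close>] by metis
    obtain l' where l': "m * r = l' *\<^sub>C m" "r * m = l' *\<^sub>C m"
      using Q_scalar[OF m Q(1)[OF r] \<open>r \<in> Bs k\<close>] by metis
    have "(l * l') *\<^sub>C m = m * q * r"
      using l l' by (simp add: scaleC_mult_left scaleC_scaleC)
    also have "\<dots> = 0" using Q_orth[OF q r False] by (simp add: mult.assoc)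
    finally have "l * l' = 0" using Q(6)[OF m] by (simp add: complex_vector.scale_eq_0_iff)
    have "m * (q * c * r) * m = (m * q) * c * (r * m)" by (simp add: mult.assoc)
    also have "\<dots> = (l * l') *\<^sub>C (m * c * m)"
      by (simp add: l l' scaleC_mult_left scaleC_mult_right scaleC_scaleC mult.commute)
    finally show ?thesis using \<open>l * l' = 0\<close> by simp
  qed
  then show ?thesis using False by (simp add: pinch_def)
qed

lemma pinch_stable:
  assumes ik: "i \<le> k" and c: "c \<in> Bs i" shows "pinch k c = pinch i c"
proof -
  have "c = (\<Sum>q\<in>Q i. q) * c * (\<Sum>r\<in>Q i. r)" using Q_sum_unit[OF c] by simp
  also have "\<dots> = (\<Sum>q\<in>Q i. \<Sum>r\<in>Q i. q * c * r)"
    unfolding sum_distrib_right[of _ _ c] by (rule sum_product)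
  finally have "pinch k c = pinch k (\<Sum>q\<in>Q i. \<Sum>r\<in>Q i. q * c * r)" by (rule arg_cong)
  also have "\<dots> = (\<Sum>q\<in>Q i. \<Sum>r\<in>Q i. pinch k (q * c * r))" by (simp only: pinch_sum)
  also have "\<dots> = (\<Sum>q\<in>Q i. \<Sum>r\<in>Q i. if q = r then q * c * q else 0)"
    using pinch_block[OF ik c] by (intro sum.cong) auto
  also have "\<dots> = pinch i c" unfolding pinch_def
    using Q_finite by (intro sum.cong) auto
  finally show ?thesis .
qed

lemma pinch_in_masa:
  assumes "c \<in> Bs i" shows "pinch i c \<in> D"
  unfolding pinch_def
proof (rule complex_vector.subspace_sum[OF D(1)])
  fix q assume q: "q \<in> Q i"
  obtain l where "q * c * q = l *\<^sub>C q" using Q_minimal[OF q assms] .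
  then show "q * c * q \<in> D" using D(1) Q(1)[OF q] by (auto intro: complex_vector.subspace_scale)
qed

lemma pinch_tendsto: "(\<lambda>k. pinch k c) \<longlonglongrightarrow> expect c"
proof -
  have "Cauchy (\<lambda>k. pinch k c)"
  proof (rule metric_CauchyI)
    fix e :: real assume "e > 0"
    then have "e / 2 > 0" by simp
    then obtain i b where b: "b \<in> Bs i" "norm (c - b) < e / 2" by (rule Bs_dense)
    have near: "norm (pinch k c - pinch i b) < e / 2" if "k \<ge> i" for k
      using norm_pinch_le[of k "c - b"] b pinch_stable[OF that b(1)] by (simp add: pinch_diff)
    have "dist (pinch m c) (pinch n c) < e" if "m \<ge> i" "n \<ge> i" for m n
      using near[OF that(1)] near[OF that(2)] by (metis dist_norm dist_triangle_half_l)
    then show "\<exists>M. \<forall>m\<ge>M. \<forall>n\<ge>M. dist (pinch m c) (pinch n c) < e" by blast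
  qed
  then have "convergent (\<lambda>k. pinch k c)" by (rule Cauchy_convergent)
  then show ?thesis unfolding expect_def convergent_LIMSEQ_iff .
qed

lemma expect_eq:
  assumes "c \<in> Bs i" shows "expect c = pinch i c"
proof (rule LIMSEQ_unique[OF pinch_tendsto])
  show "(\<lambda>k. pinch k c) \<longlonglongrightarrow> pinch i c"
    by (intro tendsto_eventually eventually_sequentiallyI[of i]) (rule pinch_stable[OF _ assms])
qed

lemma expect_diff: "expect (a - b) = expect a - expect b"
  using tendsto_diff[OF pinch_tendsto[of a] pinch_tendsto[of b]] pinch_tendsto[of "a - b"]
  by (simp add: pinch_diff LIMSEQ_unique)

lemma expect_add: "expect (a + b) = expect a + expect b"
  using tendsto_add[OF pinch_tendsto[of a] pinch_tendsto[of b]] pinch_tendsto[of "a + b"]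
  by (simp add: pinch_add LIMSEQ_unique)

lemma expect_adj: "expect (adj c) = adj (expect c)"
  using tendsto_adj[OF pinch_tendsto[of c]] pinch_tendsto[of "adj c"]
  by (simp add: pinch_adj LIMSEQ_unique)

lemma norm_expect_le: "norm (expect c) \<le> norm c"
  by (rule Lim_bounded[OF tendsto_norm[OF pinch_tendsto]]) (auto intro: norm_pinch_le)

lemma tendsto_expect:
  assumes "f \<longlonglongrightarrow> c" shows "(\<lambda>n. expect (f n)) \<longlonglongrightarrow> expect c"
proof (rule metric_LIMSEQ_I)
  fix e :: real assume "e > 0"
  then obtain N where "\<forall>n\<ge>N. dist (f n) c < e" using assms unfolding lim_sequentially by blast
  moreover have "dist (expect (f n)) (expect c) \<le> dist (f n) c" for n
    unfolding dist_norm using norm_expect_le[of "f n - c"] by (simp add: expect_diff)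
  ultimately show "\<exists>no. \<forall>n\<ge>no. dist (expect (f n)) (expect c) < e"
    using order.strict_trans1 by blast
qed

lemma expect_in_masa: "expect c \<in> D"
proof -
  have "\<exists>b i. b \<in> Bs i \<and> norm (c - b) < inverse (real (Suc n))" for n
    by (rule Bs_dense[of "inverse (real (Suc n))" c]) auto
  then obtain b i where b: "\<And>n. b n \<in> Bs (i n)" "\<And>n. norm (c - b n) < inverse (real (Suc n))"
    by metis
  have "(\<lambda>n. b n - c) \<longlonglongrightarrow> 0"
    using b(2) by (intro Lim_null_comparison[OF _ LIMSEQ_inverse_real_of_nat])
      (auto simp: norm_minus_commute less_imp_le)
  then have "b \<longlonglongrightarrow> c" by (rule LIM_zero_cancel)
  then have lim: "(\<lambda>n. expect (b n)) \<longlonglongrightarrow> expect c" by (rule tendsto_expect)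
  have "expect (b n) \<in> D" for n using expect_eq[OF b(1)] pinch_in_masa[OF b(1)] by simp
  from closed_sequentially[OF D_closed this lim] show ?thesis .
qed

end

section \<open>Germs of matrix units at a point of the spectrum\<close>

text \<open>A point of the spectrum is a character \<open>\<omega>\<close>; at every level it lies in the support of exactly one
  minimal projection \<open>x i\<close>.\<close>

locale af_masa_point = af_masa Bs D Q
  for Bs :: "nat \<Rightarrow> 'b::cstar_algebra set" and D :: "'b set" and Q :: "nat \<Rightarrow> 'b set" +
  fixes x :: "nat \<Rightarrow> 'b" and \<omega> :: "'b \<Rightarrow> complex"
  assumes x: "x i \<in> Q i"
    and \<omega>_add: "\<And>d e. d \<in> D \<Longrightarrow> e \<in> D \<Longrightarrow> \<omega> (d + e) = \<omega> d + \<omega> e"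
    and \<omega>_mult: "\<And>d e. d \<in> D \<Longrightarrow> e \<in> D \<Longrightarrow> \<omega> (d * e) = \<omega> d * \<omega> e"
    and \<omega>_scale: "\<And>c d. d \<in> D \<Longrightarrow> \<omega> (c *\<^sub>C d) = c * \<omega> d"
    and \<omega>_adj: "\<And>d. d \<in> D \<Longrightarrow> \<omega> (adj d) = cnj (\<omega> d)"
    and \<omega>_continuous: "continuous_on D \<omega>"
    and \<omega>_x: "\<And>i. \<omega> (x i) = 1"
begin

lemmas x_proj = Q[OF x]

lemma tendsto_\<omega>:
  assumes "f \<longlonglongrightarrow> d" "\<And>n. f n \<in> D" "d \<in> D" shows "(\<lambda>n. \<omega> (f n)) \<longlonglongrightarrow> \<omega> d"
  using assms \<omega>_continuous unfolding continuous_on_sequentially comp_def by blast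

lemma x_mult_level:
  assumes "d \<in> D" "d \<in> Bs i" shows "x i * d = \<omega> d *\<^sub>C x i"
proof -
  obtain c where c: "x i * d = c *\<^sub>C x i" using Q_scalar[OF x assms] by blast
  have "\<omega> (x i * d) = \<omega> d" using \<omega>_mult[OF x_proj(1) assms(1)] \<omega>_x by simp
  then have "c = \<omega> d" using c \<omega>_scale[OF x_proj(1)] \<omega>_x by simp
  then show ?thesis using c by simp
qed

lemma x_mult:
  assumes "i \<le> j" shows "x j * x i = x j" "x i * x j = x j"
proof -
  show "x j * x i = x j"
    using x_mult_level[of "x i" j] x_proj(1) subsetD[OF Bs_mono[OF assms] x_proj(2)] \<omega>_x
    by (simp add: scaleC_one)
  then show "x i * x j = x j" using D(4) x_proj(1) by metis
qed

text \<open>For \<open>d\<close> of some finite level the sequence is eventually zero, and such \<open>d\<close> are dense.\<close>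

lemma x_localizes:
  assumes "d \<in> D" shows "(\<lambda>i. x i * d - \<omega> d *\<^sub>C x i) \<longlonglongrightarrow> 0"
proof (rule metric_LIMSEQ_I)
  fix \<epsilon> :: real assume "\<epsilon> > 0"
  obtain e l where e: "e \<longlonglongrightarrow> d" "\<And>n::nat. e n \<in> D \<inter> Bs (l n)" using D_approx[OF assms] by metis
  have "(\<lambda>n. norm (d - e n) + cmod (\<omega> (e n) - \<omega> d)) \<longlonglongrightarrow> norm (d - d) + cmod (\<omega> d - \<omega> d)"
    using e assms by (intro tendsto_intros tendsto_\<omega>) auto
  then have "\<forall>\<^sub>F n in sequentially. norm (d - e n) + cmod (\<omega> (e n) - \<omega> d) < \<epsilon>"
    using \<open>\<epsilon> > 0\<close> by (intro order_tendstoD) auto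
  then obtain n where n: "norm (d - e n) + cmod (\<omega> (e n) - \<omega> d) < \<epsilon>"
    by (auto simp: eventually_sequentially)
  have "norm (x i * d - \<omega> d *\<^sub>C x i) < \<epsilon>" if "i \<ge> l n" for i
  proof -
    have "x i * e n = \<omega> (e n) *\<^sub>C x i" using x_mult_level[of "e n" i] e(2)[of n] Bs_mono[OF that] by auto
    then have "x i * d - \<omega> d *\<^sub>C x i = x i * (d - e n) + (\<omega> (e n) - \<omega> d) *\<^sub>C x i"
      by (simp add: right_diff_distrib complex_vector.scale_left_diff_distrib)
    also have "norm \<dots> \<le> norm (d - e n) + cmod (\<omega> (e n) - \<omega> d)"
      using norm_projection_mult_le(1)[OF x_proj(3), of i "d - e n"] norm_projection_le_1[OF x_proj(3)[of i]]
      by (intro order.trans[OF norm_triangle_ineq] add_mono)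
        (auto simp: norm_scaleC mult_right_le_one_le)
    finally show ?thesis using n by simp
  qed
  then show "\<exists>no. \<forall>i\<ge>no. dist (x i * d - \<omega> d *\<^sub>C x i) 0 < \<epsilon>" by auto
qed

text \<open>Minimality of \<open>x i\<close> at its level turns the compression of \<open>b\<close> into that of \<open>expect b\<close>.\<close>

lemma x_compress: "(\<lambda>i. x i * b * x i - \<omega> (expect b) *\<^sub>C x i) \<longlonglongrightarrow> 0"
proof -
  have "(\<lambda>i. x i * b * x i - x i * expect b) \<longlonglongrightarrow> 0"
  proof (rule metric_LIMSEQ_I)
    fix \<epsilon> :: real assume "\<epsilon> > 0"
    then have "\<epsilon> / 2 > 0" by simp
    then obtain l c where c: "c \<in> Bs l" "norm (b - c) < \<epsilon> / 2" by (rule Bs_dense)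
    have "norm (x i * b * x i - x i * expect b) < \<epsilon>" if "i \<ge> l" for i
    proof -
      have ci: "c \<in> Bs i" using c Bs_mono[OF that] by blast
      have "x i * pinch i c = (\<Sum>m\<in>Q i. if m = x i then x i * c * x i else 0)"
        unfolding pinch_def sum_distrib_left
        using Q_orth[OF x] x_proj(4)[of i] by (intro sum.cong) (auto simp flip: mult.assoc)
      then have "x i * c * x i = x i * expect c"
        using Q_finite x by (simp add: expect_eq[OF ci])
      then have "x i * b * x i - x i * expect b = x i * (b - c) * x i - x i * expect (b - c)"
        by (simp add: expect_diff algebra_simps)
      also have "norm \<dots> \<le> norm (x i * (b - c) * x i) + norm (x i * expect (b - c))"
        by (rule norm_triangle_ineq4)
      also have "\<dots> \<le> norm (b - c) + norm (b - c)"
        using norm_projection_mult_le[OF x_proj(3)[of i]] norm_expect_le[of "b - c"]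
        by (intro add_mono) (meson order.trans)+
      finally show ?thesis using c by simp
    qed
    then show "\<exists>no. \<forall>i\<ge>no. dist (x i * b * x i - x i * expect b) 0 < \<epsilon>" by auto
  qed
  from tendsto_add[OF this x_localizes[OF expect_in_masa[of b]]] show ?thesis by simp
qed

text \<open>The germs of these matrix units at \<open>\<omega>\<close> are the elements with source \<open>\<omega>\<close> of the groupoid of the
  AF algebra.\<close>

definition arrow :: "nat \<Rightarrow> 'b \<Rightarrow> bool" where
  "arrow j u \<longleftrightarrow> u \<in> Bs j \<and> adj u * u = x j \<and> u * adj u \<in> Q j"

lemma arrow_mult:
  assumes "arrow j u"
  shows "u * x j = u" "u * adj u * u = u" "x j * adj u = adj u"
proof -
  have *: "adj (u - u * x j) * (u - u * x j) = 0"
  proof -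
    have "adj (u - u * x j) = adj u - x j * adj u" by (simp add: adj_diff adj_mult x_proj)
    then have "adj (u - u * x j) * (u - u * x j) = (adj u - x j * adj u) * (u - u * x j)"
      by (rule arg_cong)
    also have "\<dots> = adj u * u - adj u * u * x j - x j * (adj u * u) + x j * (adj u * u) * x j"
      by (simp add: algebra_simps)
    also have "\<dots> = 0" using assms by (simp add: arrow_def x_proj)
    finally show ?thesis .
  qed
  then show 1: "u * x j = u" unfolding adj_mult_self_eq_0 by simp
  then show "u * adj u * u = u" using assms by (simp add: arrow_def mult.assoc)
  show "x j * adj u = adj u" using 1 x_proj(5) by (metis adj_mult)
qed

lemma arrow_x: "arrow j (x j)"
  by (auto simp: arrow_def x_proj x)

text \<open>At its own level an arrow conjugates \<open>D \<inter> Bs j\<close> into multiples of its source and range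
  projections. The inclusions preserve normalizers, which takes care of the later levels.\<close>

lemma arrow_normalizer:
  assumes "arrow j u" "i \<ge> j" shows "u \<in> normalizer (D \<inter> Bs i) (Bs i)"
proof -
  let ?q = "u * adj u"
  have u: "u \<in> Bs j" "adj u * u = x j" and q: "?q \<in> Q j" using assms by (auto simp: arrow_def)
  have "u \<in> normalizer (D \<inter> Bs j) (Bs j)"
    unfolding normalizer_def mem_Collect_eq
  proof (intro conjI ballI)
    show "u \<in> Bs j" by (rule u)
    show "partial_isometry u" using arrow_mult[OF assms(1)] by (simp add: partial_isometry_def)
    fix d assume "d \<in> D \<inter> Bs j"
    then have d: "d \<in> D" "d \<in> Bs j" by auto
    have "u * d * adj u = u * (x j * d) * adj u"
      using arrow_mult[OF assms(1)] by (simp flip: mult.assoc)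
    also have "\<dots> = \<omega> d *\<^sub>C ?q"
      using arrow_mult[OF assms(1)]
      by (simp add: x_mult_level[OF d] scaleC_mult_left scaleC_mult_right)
    finally show "u * d * adj u \<in> D \<inter> Bs j"
      using Q(1,2)[OF q] D(1) Bs(1) by (auto intro: complex_vector.subspace_scale)
    obtain c where c: "?q * d = c *\<^sub>C ?q" using Q_scalar[OF q d] by metis
    have "adj u = adj u * ?q" using arrow_mult(2)[OF assms(1)] by (metis adj_adj adj_mult mult.assoc)
    then have "adj u * d * u = adj u * (?q * d) * u" by (metis mult.assoc)
    also have "\<dots> = c *\<^sub>C x j"
      unfolding c using \<open>adj u = adj u * ?q\<close> u
      by (simp add: scaleC_mult_left scaleC_mult_right)
    finally show "adj u * d * u \<in> D \<inter> Bs j"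
      using x_proj(1,2) D(1) Bs(1) by (auto intro: complex_vector.subspace_scale)
  qed
  with assms(2) show ?thesis
  proof (induction i rule: dec_induct)
    case (step i)
    then show ?case using sequence unfolding canonical_masa_sequence_def by blast
  qed
qed

lemma arrow_normalizes:
  assumes "arrow j u" "d \<in> D" shows "u * d * adj u \<in> D"
proof -
  obtain e l where e: "e \<longlonglongrightarrow> d" "\<And>n::nat. e n \<in> D \<inter> Bs (l n)" using D_approx[OF assms(2)] by metis
  have "u * e n * adj u \<in> D" for n
  proof -
    have "e n \<in> D \<inter> Bs (max j (l n))" using e(2)[of n] Bs_mono[of "l n" "max j (l n)"] by auto
    then show ?thesis using arrow_normalizer[OF assms(1), of "max j (l n)"]
      unfolding normalizer_def by auto
  qed
  moreover have "(\<lambda>n. u * e n * adj u) \<longlonglongrightarrow> u * d * adj u" by (intro tendsto_intros e)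
  ultimately show ?thesis by (rule closed_sequentially[OF D_closed])
qed

definition bimodule :: "'b set \<Rightarrow> bool" where
  "bimodule S \<longleftrightarrow> closed S \<and> complex_vector.subspace S \<and> (\<forall>d\<in>D. \<forall>s\<in>S. d * s \<in> S \<and> s * d \<in> S)"

lemma bimodule_adj:
  assumes "bimodule S" shows "bimodule (adj ` S)"
proof -
  have im: "s \<in> adj ` S \<longleftrightarrow> adj s \<in> S" for s by (metis adj_adj image_iff)
  have "closed (adj ` S)"
  proof -
    have "closed (adj -` S)"
      using assms bounded_linear_adj
      by (intro continuous_closed_vimage linear_continuous_at) (auto simp: bimodule_def)
    moreover have "adj -` S = adj ` S" using im by auto
    ultimately show ?thesis by simp
  qed
  then show ?thesis
    using assms D(3) unfolding bimodule_def complex_vector.subspace_def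
    by (auto simp: im adj_add adj_scaleC adj_mult simp del: image_iff)
qed

text \<open>Conjugating the pinching by \<open>u\<close> and \<open>t\<close> yields a sum that uses \<open>s\<close> only between elements of
  the masa, so it does not leave a bimodule that contains \<open>s\<close>.\<close>

lemma arrow_pinch:
  assumes "arrow k t"
  shows "(u * pinch n (adj u * s * t)) * adj t = (\<Sum>m\<in>Q n. (u * m * adj u) * s * (t * m * adj t))"
    and "u * pinch n (adj u * s * t) = (\<Sum>m\<in>Q n. (u * m * adj u) * s * (t * m * adj t)) * t"
proof -
  show "(u * pinch n (adj u * s * t)) * adj t = (\<Sum>m\<in>Q n. (u * m * adj u) * s * (t * m * adj t))"
    by (simp add: pinch_def sum_distrib_left sum_distrib_right mult.assoc)
  have "t * m * adj t * t = t * m" if "m \<in> Q n" for m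
  proof -
    have "t * m * adj t * t = t * (m * x k)" using assms by (simp add: arrow_def mult.assoc)
    also have "\<dots> = t * x k * m" using D(4)[OF Q(1)[OF that] x_proj(1)] by (simp add: mult.assoc)
    finally show ?thesis using arrow_mult[OF assms] by simp
  qed
  then show "u * pinch n (adj u * s * t) = (\<Sum>m\<in>Q n. (u * m * adj u) * s * (t * m * adj t)) * t"
    unfolding pinch_def sum_distrib_left sum_distrib_right
    by (intro sum.cong) (simp_all add: mult.assoc)
qed

lemma arrow_pinch_in_bimodule:
  assumes "bimodule S" "s \<in> S" "arrow j u" "arrow k t"
  shows "(\<Sum>m\<in>Q n. (u * m * adj u) * s * (t * m * adj t)) \<in> S"
  using assms arrow_normalizes[OF assms(3)] arrow_normalizes[OF assms(4)] Q(1)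
  by (intro complex_vector.subspace_sum) (auto simp: bimodule_def)

lemma arrow_expect_in_bimodule:
  assumes "bimodule S" "s \<in> S" "arrow j u" "arrow k t"
  shows "u * expect (adj u * s * t) * adj t \<in> S"
proof -
  have "closed S" using assms(1) by (simp add: bimodule_def)
  have "u * pinch n (adj u * s * t) * adj t \<in> S" for n
    unfolding arrow_pinch(1)[OF assms(4)] by (rule arrow_pinch_in_bimodule[OF assms])
  moreover have "(\<lambda>n. u * pinch n (adj u * s * t) * adj t) \<longlonglongrightarrow> u * expect (adj u * s * t) * adj t"
    by (intro tendsto_intros pinch_tendsto)
  ultimately show ?thesis by (rule closed_sequentially[OF \<open>closed S\<close>])
qed

lemma arrow_expect_in_closure:
  assumes "bimodule S" "s \<in> S" "arrow j u" "arrow k t"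
  shows "u * expect (adj u * s * t) \<in> closure ((\<lambda>s. s * t) ` S)"
proof -
  have "u * pinch n (adj u * s * t) \<in> (\<lambda>s. s * t) ` S" for n
    unfolding arrow_pinch(2)[OF assms(4)] using arrow_pinch_in_bimodule[OF assms] by blast
  moreover have "(\<lambda>n. u * pinch n (adj u * s * t)) \<longlonglongrightarrow> u * expect (adj u * s * t)"
    by (intro tendsto_intros pinch_tendsto)
  ultimately show ?thesis unfolding closure_sequential
    by (intro exI[of _ "\<lambda>n. u * pinch n (adj u * s * t)"] conjI allI)
qed

text \<open>The blocks \<open>u m u*\<close>, summed over the given arrows \<open>u\<close>, form an orthogonal family indexed by the
  minimal projections \<open>m\<close> of a later level, so that the sum is a limit of two-sided pinchings.\<close>

lemma norm_arrow_blocks_le: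
  assumes "R \<subseteq> Q j" and U: "\<And>q. q \<in> R \<Longrightarrow> arrow j (U q)" "\<And>q. q \<in> R \<Longrightarrow> U q * adj (U q) = q"
  shows "norm (\<Sum>q\<in>R. U q * expect (adj (U q) * y)) \<le> norm y"
proof -
  have fin: "finite R" using assms(1) Q_finite finite_subset by blast
  define r where "r m = (\<Sum>q\<in>R. U q * m * adj (U q))" for m
  have xm: "x j * m = m * x j" if "m \<in> Q n" for m n using D(4)[OF x_proj(1) Q(1)[OF that]] .
  have orth: "adj (U p) * U q = (if p = q then x j else 0)" if "p \<in> R" "q \<in> R" for p q
  proof (cases "p = q")
    case False
    have "adj (U p) * U q = adj (p * U p) * (q * U q)"
      using arrow_mult(2)[OF U(1)] U(2) that by simp
    also have "\<dots> = adj (U p) * (p * q) * U q"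
      using Q(5)[OF subsetD[OF assms(1) that(1)]] by (simp add: adj_mult mult.assoc)
    also have "p * q = 0" using Q_orth False that assms(1) by blast
    finally show ?thesis using False by (simp add: mult.assoc)
  qed (use U that in \<open>simp add: arrow_def\<close>)
  have rr: "r m * r m' = (\<Sum>q\<in>R. U q * (m * m') * adj (U q))" if m: "m \<in> Q n" for m m' n
  proof -
    have "r m * r m' = (\<Sum>p\<in>R. \<Sum>q\<in>R. (U p * m * adj (U p)) * (U q * m' * adj (U q)))"
      unfolding r_def by (rule sum_product)
    also have "\<dots> = (\<Sum>p\<in>R. \<Sum>q\<in>R. if p = q then U q * (m * m') * adj (U q) else 0)"
    proof (intro sum.cong refl)
      fix p q assume pq: "p \<in> R" "q \<in> R"
      have "(U p * m * adj (U p)) * (U q * m' * adj (U q)) = U p * m * (adj (U p) * U q) * m' * adj (U q)"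
        by (simp add: mult.assoc)
      also have "\<dots> = (if p = q then U q * (m * x j) * m' * adj (U q) else 0)"
        using orth[OF pq] by (simp add: mult.assoc)
      also have "\<dots> = (if p = q then U q * (m * m') * adj (U q) else 0)"
        using arrow_mult(1)[OF U(1)[OF pq(2)]] unfolding xm[OF m, symmetric]
        by (simp flip: mult.assoc)
      finally show "(U p * m * adj (U p)) * (U q * m' * adj (U q)) = \<dots>" .
    qed
    also have "\<dots> = (\<Sum>q\<in>R. U q * (m * m') * adj (U q))" using fin by simp
    finally show ?thesis .
  qed
  have bound: "norm (\<Sum>q\<in>R. U q * pinch n (adj (U q) * y)) \<le> norm y" for n
  proof -
    have "(\<Sum>q\<in>R. U q * pinch n (adj (U q) * y)) = (\<Sum>q\<in>R. \<Sum>m\<in>Q n. U q * m * adj (U q) * y * m)"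
      unfolding pinch_def by (simp add: sum_distrib_left mult.assoc)
    also have "\<dots> = (\<Sum>m\<in>Q n. \<Sum>q\<in>R. U q * m * adj (U q) * y * m)" by (rule sum.swap)
    also have "\<dots> = (\<Sum>m\<in>Q n. r m * y * m)" unfolding r_def sum_distrib_right ..
    finally have *: "(\<Sum>q\<in>R. U q * pinch n (adj (U q) * y)) = (\<Sum>m\<in>Q n. r m * y * m)" .
    show ?thesis unfolding *
    proof (rule norm_pinching_le)
      fix m m' assume m: "m \<in> Q n" "m' \<in> Q n"
      show "is_projection (r m)" unfolding is_projection_def
      proof
        show "r m * r m = r m" unfolding rr[OF m(1)] using Q(4)[OF m(1)] by (simp add: r_def)
        show "adj (r m) = r m" using Q(5)[OF m(1)]
          by (simp add: r_def adj_sum adj_mult adj_adj mult.assoc)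
      qed
      show "r m * r m' = 0" if "m \<noteq> m'" unfolding rr[OF m(1)] using Q_orth[OF m that] by simp
    qed (use Q_finite Q(3) Q_orth in auto)
  qed
  have "(\<lambda>n. \<Sum>q\<in>R. U q * pinch n (adj (U q) * y)) \<longlonglongrightarrow> (\<Sum>q\<in>R. U q * expect (adj (U q) * y))"
    by (intro tendsto_intros pinch_tendsto)
  from Lim_bounded[OF tendsto_norm[OF this], of 0] bound show ?thesis by blast
qed

text \<open>A closed bimodule is spanned, as far as the germ at \<open>x\<close> on the right can tell, by the elements
  \<open>u d\<close> that it contains: cutting an element \<open>a\<close> along the arrows \<open>u\<close> of a level gives
  \<open>\<Sum>u. u expect (u* a x\<^sub>j)\<close>, whose terms lie in the bimodule, whereas an approximant of \<open>a\<close> at that level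
  is reproduced by this operation.\<close>

lemma bimodule_detected_on_arrows:
  fixes f :: "'b \<Rightarrow> complex"
  assumes S: "bimodule S" and a: "a \<in> S"
    and f_diff: "\<And>s t. s \<in> S \<Longrightarrow> t \<in> S \<Longrightarrow> f (s - t) = f s - f t"
    and f_cont: "continuous_on S f" and f_x: "\<And>s j. s \<in> S \<Longrightarrow> f (s * x j) = f s" and "f a \<noteq> 0"
  obtains j u d where "arrow j u" "d \<in> D" "u * d \<in> S" "f (u * d) \<noteq> 0"
proof (rule ccontr)
  assume contra: "\<not> thesis"
  note found = that
  have none: "f (u * d) = 0" if "arrow j u" "d \<in> D" "u * d \<in> S" for j u d
    using contra found[OF that] by blast
  have sub: "complex_vector.subspace S" using S by (simp add: bimodule_def)
  have "0 \<in> S" using complex_vector.subspace_0[OF sub] .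
  then have "f 0 = 0" using f_diff[of 0 0] by simp
  have near: "\<exists>y\<in>S. norm y < \<epsilon> \<and> f y = f a" if "\<epsilon> > 0" for \<epsilon>
  proof -
    from that have "\<epsilon> / 2 > 0" by simp
    then obtain j b where b: "b \<in> Bs j" "norm (a - b) < \<epsilon> / 2" by (rule Bs_dense)
    define R where "R = {q \<in> Q j. \<exists>u. arrow j u \<and> u * adj u = q}"
    have "\<forall>q\<in>R. \<exists>u. arrow j u \<and> u * adj u = q" by (auto simp: R_def)
    then obtain U where U: "\<And>q. q \<in> R \<Longrightarrow> arrow j (U q)" "\<And>q. q \<in> R \<Longrightarrow> U q * adj (U q) = q" by metis
    have RQ: "R \<subseteq> Q j" by (auto simp: R_def)
    \<comment> \<open>The block operation fixes \<open>b x\<^sub>j\<close>, so it moves \<open>a x\<^sub>j\<close> by less than \<open>\<epsilon>\<close>; and \<open>f\<close> vanishes on its value at \<open>a\<close>.\<close>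
    define T where "T c = (\<Sum>q\<in>R. U q * expect (adj (U q) * (c * x j)))" for c
    have T_diff: "T (c - c') = T c - T c'" for c c'
      by (simp add: T_def algebra_simps expect_diff sum_subtractf)
    have block_S: "U q * (expect (adj (U q) * (a * x j)) * x j) \<in> S" if "q \<in> R" for q
      using arrow_expect_in_bimodule[OF S a U(1)[OF that] arrow_x[of j]] x_proj(5)
      by (simp add: mult.assoc)
    have fT: "T a * x j \<in> S \<and> f (T a * x j) = 0"
    proof -
      have fsum: "sum g R' \<in> S \<and> f (sum g R') = 0"
        if "finite R'" "\<And>q. q \<in> R' \<Longrightarrow> g q \<in> S" "\<And>q. q \<in> R' \<Longrightarrow> f (g q) = 0" for g :: "'b \<Rightarrow> 'b" and R'
        using that
      proof (induction R' rule: finite_induct)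
        case (insert q R')
        then have R': "sum g R' \<in> S" "f (sum g R') = 0" "g q \<in> S" "f (g q) = 0" by auto
        then have "g q + sum g R' \<in> S" using complex_vector.subspace_add[OF sub] by blast
        moreover have "f (- sum g R') = 0" "- sum g R' \<in> S"
          using f_diff[OF \<open>0 \<in> S\<close> R'(1)] R' \<open>f 0 = 0\<close> complex_vector.subspace_neg[OF sub] by auto
        then have "f (g q + sum g R') = 0" using f_diff[of "g q" "- sum g R'"] R' by simp
        ultimately show ?case using insert.hyps by simp
      qed (use \<open>0 \<in> S\<close> \<open>f 0 = 0\<close> in auto)
      have "T a * x j = (\<Sum>q\<in>R. U q * (expect (adj (U q) * (a * x j)) * x j))"
        by (simp add: T_def sum_distrib_right mult.assoc)
      then show ?thesis
        using fsum[of R] block_S none[OF U(1)] D(2)[OF expect_in_masa x_proj(1)]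
          finite_subset[OF RQ Q_finite] by simp
    qed
    have Tb: "T b * x j = b * x j"
    proof -
      have "U q * expect (adj (U q) * (b * x j)) = q * b * x j" if "q \<in> R" for q
      proof -
        let ?w = "adj (U q) * b"
        have w: "?w \<in> Bs j" using U(1)[OF that] b Bs by (auto simp: arrow_def)
        have "?w * x j = x j * ?w * x j"
          using arrow_mult(3)[OF U(1)[OF that]] by (simp flip: mult.assoc)
        moreover obtain c where "x j * ?w * x j = c *\<^sub>C x j" using Q_minimal[OF x w] .
        ultimately have c: "?w * x j = c *\<^sub>C x j" by simp
        have "c *\<^sub>C x j \<in> D" "c *\<^sub>C x j \<in> Bs j"
          using x_proj D(1) Bs(1) by (auto intro: complex_vector.subspace_scale)
        then have "expect (?w * x j) = ?w * x j" unfolding c using expect_eq pinch_masa by metis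
        then have "U q * expect (adj (U q) * (b * x j)) = (U q * adj (U q)) * b * x j"
          by (simp add: mult.assoc)
        then show ?thesis using U(2)[OF that] by simp
      qed
      then have "T b = (\<Sum>q\<in>R. q * b * x j)" unfolding T_def by (intro sum.cong) auto
      also have "\<dots> = (\<Sum>q\<in>Q j. q * b * x j)"
      proof (rule sum.mono_neutral_left[OF Q_finite RQ], intro ballI)
        fix q assume q: "q \<in> Q j - R"
        show "q * b * x j = 0"
        proof (rule ccontr)
          assume "q * b * x j \<noteq> 0"
          then obtain u where "u \<in> Bs j" "adj u * u = x j" "u * adj u = q"
            using matrix_unit_exists[of q j "x j" b] q x b by blast
          then show False using q by (auto simp: R_def arrow_def)
        qed
      qed
      also have "\<dots> = (\<Sum>q\<in>Q j. q) * b * x j" by (simp add: sum_distrib_right)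
      finally have "T b = b * x j" using Q_sum_unit(1)[OF b(1)] by simp
      then show ?thesis by (simp add: mult.assoc x_proj)
    qed
    define y where "y = a * x j - T a * x j"
    have "a * x j \<in> S" using S a x_proj(1) by (simp add: bimodule_def)
    then have "y \<in> S" "f y = f a"
      using fT f_diff[of "a * x j" "T a * x j"] f_x[OF a] sub
      by (auto simp: y_def intro: complex_vector.subspace_diff)
    moreover have "norm y < \<epsilon>"
    proof -
      have "y = (a - b) * x j - T (a - b) * x j" using Tb by (simp add: y_def T_diff algebra_simps)
      also have "norm \<dots> \<le> norm ((a - b) * x j) + norm (T (a - b) * x j)" by (rule norm_triangle_ineq4)
      also have "norm (T (a - b) * x j) \<le> norm ((a - b) * x j)"
        using norm_projection_mult_le(2)[OF x_proj(3)] norm_arrow_blocks_le[OF RQ U]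
        unfolding T_def by (rule order.trans)
      also have "norm ((a - b) * x j) \<le> norm (a - b)" by (rule norm_projection_mult_le[OF x_proj(3)])
      finally show ?thesis using b by simp
    qed
    ultimately show ?thesis by blast
  qed
  then have "\<forall>n. \<exists>y\<in>S. norm y < inverse (real (Suc n)) \<and> f y = f a" by simp
  then obtain y where y: "\<And>n. y n \<in> S" "\<And>n. norm (y n) < inverse (real (Suc n))" "\<And>n. f (y n) = f a"
    by metis
  have "y \<longlonglongrightarrow> 0"
    using y(2) by (intro Lim_null_comparison[OF _ LIMSEQ_inverse_real_of_nat]) (auto simp: less_imp_le)
  then have "(\<lambda>n. f (y n)) \<longlonglongrightarrow> f 0"
    using f_cont y(1) \<open>0 \<in> S\<close> unfolding continuous_on_sequentially comp_def by blast
  then have "(\<lambda>n::nat. f a) \<longlonglongrightarrow> 0" using y(3) \<open>f 0 = 0\<close> by simp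
  then show False using \<open>f a \<noteq> 0\<close> LIMSEQ_const_iff by metis
qed

text \<open>This is where strong maximality enters: \<open>u t*\<close> is a limit of sums \<open>a + b*\<close>, and the germ of
  \<open>u* u t* t\<close> at the point \<open>\<omega>\<close> is the identity, so the germ of \<open>u* a t\<close> or that of
  \<open>t* b u\<close> does not vanish there. Hence, near \<open>\<omega>\<close>, one of \<open>u\<close>, \<open>t\<close> is a left multiple of the
  other.\<close>

lemma arrows_comparable:
  assumes S: "bimodule S" "closure {a + adj b | a b. a \<in> S \<and> b \<in> S} = UNIV"
    and u: "arrow j u" and t: "arrow k t"
  shows "\<exists>g\<in>D. \<omega> g \<noteq> 0 \<and> (u * g \<in> closure ((\<lambda>s. s * t) ` S) \<or> t * g \<in> closure ((\<lambda>s. s * u) ` S))"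
proof -
  have "u * adj t \<in> closure {a + adj b | a b. a \<in> S \<and> b \<in> S}" using S by simp
  then obtain z where z: "\<And>n. z n \<in> {a + adj b | a b. a \<in> S \<and> b \<in> S}" "z \<longlonglongrightarrow> u * adj t"
    unfolding closure_sequential by blast
  have "\<forall>n. \<exists>a b. z n = a + adj b \<and> a \<in> S \<and> b \<in> S" using z(1) by blast
  then obtain a b where ab: "\<And>n. z n = a n + adj (b n)" "\<And>n. a n \<in> S" "\<And>n. b n \<in> S" by metis
  have "(\<lambda>n. expect (adj u * z n * t)) \<longlonglongrightarrow> expect (adj u * (u * adj t) * t)"
    by (intro tendsto_expect tendsto_intros z)
  moreover have "adj u * (u * adj t) * t = x j * x k"
    using u t by (simp add: arrow_def mult.assoc) (simp flip: mult.assoc add: x_proj)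
  moreover have "expect (x j * x k) = x j * x k"
  proof -
    have m: "x j * x k = x (max j k)" using x_mult by (metis linorder_le_cases max.absorb1 max.absorb2)
    show ?thesis unfolding m expect_eq[OF x_proj(2)] by (rule pinch_masa) (rule x_proj)+
  qed
  ultimately have "(\<lambda>n. expect (adj u * z n * t)) \<longlonglongrightarrow> x j * x k" by simp
  then have "(\<lambda>n. \<omega> (expect (adj u * z n * t))) \<longlonglongrightarrow> \<omega> (x j * x k)"
    by (rule tendsto_\<omega>) (auto intro: expect_in_masa D x_proj)
  then have "(\<lambda>n. \<omega> (expect (adj u * z n * t))) \<longlonglongrightarrow> 1" by (simp add: \<omega>_mult x_proj \<omega>_x)
  then have "\<forall>\<^sub>F n in sequentially. \<omega> (expect (adj u * z n * t)) \<noteq> 0"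
    by (rule tendsto_imp_eventually_ne) simp
  then obtain n where n: "\<omega> (expect (adj u * z n * t)) \<noteq> 0" by (auto simp: eventually_sequentially)
  have "expect (adj u * z n * t) = expect (adj u * a n * t) + adj (expect (adj t * b n * u))"
    by (simp add: ab(1) distrib_left distrib_right expect_add adj_mult adj_adj mult.assoc
        flip: expect_adj)
  then have "\<omega> (expect (adj u * a n * t)) \<noteq> 0 \<or> \<omega> (expect (adj t * b n * u)) \<noteq> 0"
    using n by (auto simp: \<omega>_add \<omega>_adj expect_in_masa D(3))
  then show ?thesis
    using arrow_expect_in_closure[OF S(1) ab(2) u t] arrow_expect_in_closure[OF S(1) ab(3) t u]
      expect_in_masa by blast
qed

end

section \<open>Complex Hilbert spaces\<close>

lemma cinner_add_left: "cinner (x + y) z = cinner x z + cinner (y::'h::complex_hilbert) z"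
  using cinner_commute[of "x + y" z] cinner_commute[of x z] cinner_commute[of y z]
  by (simp add: cinner_add_right)

lemma cinner_scaleC_left: "cinner (c *\<^sub>C x) y = cnj c * cinner x (y::'h::complex_hilbert)"
  using cinner_commute[of "c *\<^sub>C x" y] cinner_commute[of x y] by (simp add: cinner_scaleC_right)

lemma cinner_zero [simp]: "cinner x 0 = 0" "cinner 0 (x::'h::complex_hilbert) = 0"
  using cinner_add_right[of x 0 0] cinner_add_left[of 0 0 x] by auto

lemma cinner_diff_right: "cinner x (y - z) = cinner x y - cinner x (z::'h::complex_hilbert)"
  using cinner_add_right[of x "y - z" z] by simp

lemma cinner_self: "cinner x x = complex_of_real ((norm (x::'h::complex_hilbert))\<^sup>2)"
proof -
  have "Im (cinner x x) = 0" using cinner_commute[of x x] by (metis complex_cnj_cancel_iff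
      cnj.simps(2) neg_equal_zero)
  moreover have "Re (cinner x x) = (norm x)\<^sup>2"
    using inner_eq_Re_cinner[of x x] by (simp add: power2_norm_eq_inner)
  ultimately show ?thesis by (simp add: complex_eq_iff)
qed

lemma cinner_self_eq_0 [simp]: "cinner x x = 0 \<longleftrightarrow> x = (0::'h::complex_hilbert)"
  by (simp add: cinner_self)

lemma norm_scaleC_hilbert: "norm (c *\<^sub>C x) = cmod c * norm (x::'h::complex_hilbert)"
proof -
  have "complex_of_real ((norm (c *\<^sub>C x))\<^sup>2) = complex_of_real ((cmod c * norm x)\<^sup>2)"
    using cinner_self[of "c *\<^sub>C x"] cinner_self[of x] complex_norm_square[of c]
    by (simp add: cinner_scaleC_left cinner_scaleC_right power_mult_distrib mult.assoc mult.commute)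
  then show ?thesis by (simp only: of_real_eq_iff power2_eq_iff_nonneg norm_ge_zero mult_nonneg_nonneg)
qed

lemma tendsto_scaleC_hilbert [tendsto_intros]:
  fixes l :: "'h::complex_hilbert"
  assumes "(f \<longlongrightarrow> c) F" and "(g \<longlongrightarrow> l) F"
  shows "((\<lambda>i. f i *\<^sub>C g i) \<longlongrightarrow> c *\<^sub>C l) F"
proof -
  have "bounded_bilinear (scaleC :: complex \<Rightarrow> 'h \<Rightarrow> 'h)"
    by (rule bounded_bilinear.intro)
      (auto simp: scaleC_add_right scaleC_add_left scaleR_scaleC scaleC_scaleC norm_scaleC_hilbert
        scaleR_conv_of_real mult.commute intro!: exI[of _ 1])
  from bounded_bilinear.tendsto[OF this assms] show ?thesis .
qed

lemma cinner_eq_inner: "cinner x y = Complex (inner x y) (- inner x (\<i> *\<^sub>C (y::'h::complex_hilbert)))"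
  by (simp add: complex_eq_iff inner_eq_Re_cinner cinner_scaleC_right)

lemma tendsto_cinner [tendsto_intros]:
  fixes a b :: "'h::complex_hilbert"
  assumes "(f \<longlongrightarrow> a) F" and "(g \<longlongrightarrow> b) F"
  shows "((\<lambda>i. cinner (f i) (g i)) \<longlongrightarrow> cinner a b) F"
  unfolding cinner_eq_inner by (intro tendsto_intros assms)

text \<open>The representing vector is a multiple of the point of least norm on the affine hyperplane
  \<open>f = 1\<close>; a minimizing sequence is Cauchy by the parallelogram law.\<close>

lemma riesz_representation:
  fixes f :: "'h::complex_hilbert \<Rightarrow> complex"
  assumes add: "\<And>x y. f (x + y) = f x + f y" and scale: "\<And>c x. f (c *\<^sub>C x) = c * f x"
    and cont: "continuous_on UNIV f"
  obtains z where "\<And>y. cinner z y = f y"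
proof (cases "\<forall>y. f y = 0")
  case True
  then show ?thesis using that[of 0] by simp
next
  case False
  then obtain y1 where y1: "f y1 \<noteq> 0" by blast
  define C where "C = {y. f y = 1}"
  have scaleR: "f (r *\<^sub>R x) = complex_of_real r * f x" for r x
    unfolding scaleR_scaleC by (rule scale)
  have "(1 / f y1) *\<^sub>C y1 \<in> C" using y1 by (simp add: C_def scale)
  then have ne: "C \<noteq> {}" by blast
  have cl: "closed C" unfolding C_def
    by (rule closed_Collect_eq[OF cont continuous_on_const])
  define \<delta> where "\<delta> = Inf ((\<lambda>y. (norm y)\<^sup>2) ` C)"
  have bdd: "bdd_below ((\<lambda>y. (norm y)\<^sup>2) ` C)" by (rule bdd_belowI[of _ 0]) auto
  have low: "\<delta> \<le> (norm y)\<^sup>2" if "y \<in> C" for y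
    unfolding \<delta>_def using bdd that by (intro cInf_lower) auto
  have "\<exists>y\<in>C. (norm y)\<^sup>2 < \<delta> + inverse (real (Suc n))" for n
    using cInf_lessD[of "(\<lambda>y. (norm y)\<^sup>2) ` C" "\<delta> + inverse (real (Suc n))"] ne
    by (auto simp: \<delta>_def)
  then obtain y where y: "\<And>n. y n \<in> C" "\<And>n. (norm (y n))\<^sup>2 < \<delta> + inverse (real (Suc n))" by metis
  have close: "(norm (y m - y n))\<^sup>2 \<le> 2 * inverse (real (Suc m)) + 2 * inverse (real (Suc n))" for m n
  proof -
    have "(1/2) *\<^sub>R (y m + y n) \<in> C"
      using y(1)[of m] y(1)[of n] by (simp add: C_def scaleR add)
    from low[OF this] have "4 * \<delta> \<le> (norm (y m + y n))\<^sup>2" by (simp add: power2_eq_square)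
    moreover have "(norm (y m - y n))\<^sup>2 = 2 * (norm (y m))\<^sup>2 + 2 * (norm (y n))\<^sup>2 - (norm (y m + y n))\<^sup>2"
      by (simp add: power2_norm_eq_inner algebra_simps inner_commute)
    ultimately show ?thesis using y(2)[of m] y(2)[of n] by linarith
  qed
  have "Cauchy y"
  proof (rule metric_CauchyI)
    fix e :: real assume "e > 0"
    then have "e\<^sup>2 / 4 > 0" by simp
    then obtain N where N: "inverse (real (Suc N)) < e\<^sup>2 / 4"
      using reals_Archimedean by blast
    have "dist (y m) (y n) < e" if "m \<ge> N" "n \<ge> N" for m n
    proof -
      have "inverse (real (Suc m)) \<le> inverse (real (Suc N))" "inverse (real (Suc n)) \<le> inverse (real (Suc N))"
        using that by (auto intro!: le_imp_inverse_le)
      then have "(norm (y m - y n))\<^sup>2 < e\<^sup>2" using close[of m n] N by linarith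
      then show ?thesis using \<open>e > 0\<close> by (simp add: dist_norm power_less_imp_less_base)
    qed
    then show "\<exists>M. \<forall>m\<ge>M. \<forall>n\<ge>M. dist (y m) (y n) < e" by blast
  qed
  then have "convergent y" by (rule Cauchy_convergent)
  then obtain y0 where y0: "y \<longlonglongrightarrow> y0" by (auto simp: convergent_def)
  have "y0 \<in> C" by (rule closed_sequentially[OF cl y(1) y0])
  have min: "(norm y0)\<^sup>2 \<le> \<delta>"
  proof (rule LIMSEQ_le[of "\<lambda>n. (norm (y n))\<^sup>2" _ "\<lambda>n. \<delta> + inverse (real (Suc n))"])
    show "(\<lambda>n. (norm (y n))\<^sup>2) \<longlonglongrightarrow> (norm y0)\<^sup>2" by (intro tendsto_intros y0)
    show "(\<lambda>n. \<delta> + inverse (real (Suc n))) \<longlonglongrightarrow> \<delta>"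
      using tendsto_add[OF tendsto_const[of \<delta>] LIMSEQ_inverse_real_of_nat] by simp
    show "\<exists>N. \<forall>n\<ge>N. (norm (y n))\<^sup>2 \<le> \<delta> + inverse (real (Suc n))" using y(2) less_imp_le by blast
  qed
  have orth: "inner y0 v = 0" if "f v = 0" for v
  proof (rule ccontr)
    assume ne: "inner y0 v \<noteq> 0"
    then have v: "inner v v > 0" by auto
    \<comment> \<open>The minimizer of the norm along the line \<open>y0 + t v\<close>.\<close>
    define t where "t = - inner y0 v / inner v v"
    have "y0 + t *\<^sub>R v \<in> C" using \<open>y0 \<in> C\<close> that by (simp add: C_def add scaleR)
    from low[OF this] min have "inner y0 y0 \<le> inner (y0 + t *\<^sub>R v) (y0 + t *\<^sub>R v)"
      by (simp add: power2_norm_eq_inner)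
    also have "\<dots> = inner y0 y0 + 2 * t * inner y0 v + t * t * inner v v"
      by (simp add: algebra_simps inner_commute)
    also have "\<dots> = inner y0 y0 - (inner y0 v)\<^sup>2 / inner v v"
      using v by (simp add: t_def power2_eq_square)
    finally show False using ne v by (simp add: field_simps)
  qed
  have corth: "cinner y0 v = 0" if "f v = 0" for v
    using orth[OF that] orth[of "\<i> *\<^sub>C v"] that by (simp add: cinner_eq_inner scale zero_complex.code)
  have "y0 \<noteq> 0"
  proof
    assume "y0 = 0"
    then have "f y0 = 0" using scale[of 0 0] by simp
    then show False using \<open>y0 \<in> C\<close> by (simp add: C_def)
  qed
  define s where "s = complex_of_real ((norm y0)\<^sup>2)"
  have s: "s \<noteq> 0" "cnj s = s" using \<open>y0 \<noteq> 0\<close> by (simp_all add: s_def)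
  have "cinner ((1 / s) *\<^sub>C y0) y = f y" for y
  proof -
    have "f (y + (- f y) *\<^sub>C y0) = 0" using \<open>y0 \<in> C\<close> by (simp only: add scale) (simp add: C_def)
    from corth[OF this] have "cinner y0 y = f y * s"
      by (simp add: cinner_diff_right cinner_scaleC_right cinner_self s_def)
    then show ?thesis using s by (simp add: cinner_scaleC_left)
  qed
  then show ?thesis using that by blast
qed

lemma adjoint_vector_exists:
  fixes T :: "'h::complex_hilbert \<Rightarrow>\<^sub>L 'h"
  assumes "T \<in> bounded_operators"
  shows "\<exists>z. \<forall>y. cinner z y = cinner w (T y)"
proof (rule riesz_representation[of "\<lambda>y. cinner w (T y)"])
  show "continuous_on UNIV (\<lambda>y. cinner w (T y))"
    unfolding continuous_on_sequentially comp_def by (auto intro!: tendsto_intros)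
qed (use assms in \<open>auto simp: blinfun.add_right cinner_add_right bounded_operators_def cinner_scaleC_right\<close>)

section \<open>Nest representations at a point of the spectrum\<close>

locale nest_at_point = af_masa_point Bs D Q x \<omega>
  for Bs :: "nat \<Rightarrow> 'b::cstar_algebra set" and D Q x \<omega> +
  fixes A :: "'b set" and \<pi> :: "'b \<Rightarrow> 'h::complex_hilbert \<Rightarrow>\<^sub>L 'h" and h :: 'h
  assumes taf: "strongly_maximal_taf A D"
    and rep: "nest_representation A \<pi>"
    and star: "star_representation_on D \<pi>"
    and h: "cinner h h = 1"
    and h_eigen: "\<And>d. d \<in> D \<Longrightarrow> \<pi> d h = \<omega> d *\<^sub>C h"
begin

lemma A: "complex_vector.subspace A" "closed A" "d \<in> D \<Longrightarrow> d \<in> A" "a \<in> A \<Longrightarrow> b \<in> A \<Longrightarrow> a * b \<in> A"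
  using taf by (auto simp: strongly_maximal_taf_def taf_algebra_def subalgebra_def)

lemma \<pi>:
  "a \<in> A \<Longrightarrow> b \<in> A \<Longrightarrow> \<pi> (a + b) = \<pi> a + \<pi> b"
  "a \<in> A \<Longrightarrow> b \<in> A \<Longrightarrow> \<pi> (a * b) = \<pi> a o\<^sub>L \<pi> b"
  "a \<in> A \<Longrightarrow> \<pi> (c *\<^sub>C a) y = c *\<^sub>C \<pi> a y"
  "a \<in> A \<Longrightarrow> \<pi> a (c *\<^sub>C y) = c *\<^sub>C \<pi> a y"
  "a \<in> A \<Longrightarrow> \<pi> a \<in> bounded_operators"
  using rep by (auto simp: nest_representation_def algebra_hom_on_def bounded_operators_def)

lemma \<pi>_mult: "a \<in> A \<Longrightarrow> b \<in> A \<Longrightarrow> \<pi> (a * b) y = \<pi> a (\<pi> b y)"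
  by (simp add: \<pi>(2))

lemma \<pi>_diff: "a \<in> A \<Longrightarrow> b \<in> A \<Longrightarrow> \<pi> (a - b) = \<pi> a - \<pi> b"
  using \<pi>(1)[of "a - b" b] A(1) by (simp add: complex_vector.subspace_diff)

lemma \<pi>_0: "\<pi> 0 = 0"
  using \<pi>_diff[of 0 0] complex_vector.subspace_0[OF A(1)] by simp

lemma tendsto_\<pi>:
  assumes "f \<longlonglongrightarrow> a" "\<And>n. f n \<in> A" "a \<in> A" shows "(\<lambda>n. \<pi> (f n)) \<longlonglongrightarrow> \<pi> a"
  using rep assms unfolding nest_representation_def continuous_on_sequentially comp_def by blast

lemma tendsto_\<pi>_apply:
  assumes "f \<longlonglongrightarrow> a" "\<And>n. f n \<in> A" "a \<in> A" shows "(\<lambda>n. \<pi> (f n) y) \<longlonglongrightarrow> \<pi> a y"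
  by (intro blinfun.tendsto tendsto_\<pi>[OF assms] tendsto_const)

lemma \<pi>_adjoint: "d \<in> D \<Longrightarrow> cinner (\<pi> d y) z = cinner y (\<pi> (adj d) z)"
  using star by (auto simp: star_representation_on_def adjoint_pair_def)

lemma h_coeigen: "d \<in> D \<Longrightarrow> cinner h (\<pi> d z) = \<omega> d * cinner h z"
  using \<pi>_adjoint[OF D(3), of d h z] h_eigen[OF D(3), of d]
  by (simp add: adj_adj cinner_scaleC_left \<omega>_adj)

lemma h_x: "\<pi> (x i) h = h"
  using h_eigen[OF x_proj(1)] by (simp add: \<omega>_x scaleC_one)

lemma A_bimodule: "bimodule A"
  using A by (auto simp: bimodule_def)

lemma adj_A_iff: "s \<in> adj ` A \<longleftrightarrow> adj s \<in> A"
  by (metis adj_adj image_iff)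

lemma A_dense: "closure {a + adj b | a b. a \<in> A \<and> b \<in> A} = UNIV"
  using taf by (simp add: strongly_maximal_taf_def)

lemma adj_A_dense: "closure {a + adj b | a b. a \<in> adj ` A \<and> b \<in> adj ` A} = UNIV"
proof -
  have "{a + adj b | a b. a \<in> adj ` A \<and> b \<in> adj ` A} = {a + adj b | a b. a \<in> A \<and> b \<in> A}"
    unfolding adj_A_iff by (auto; metis adj_adj add.commute)
  then show ?thesis using A_dense by simp
qed

definition annihilator :: "'h \<Rightarrow> 'h set" where
  "annihilator k = {z. \<forall>b\<in>A. cinner k (\<pi> b z) = 0}"

lemma annihilator_invariant: "annihilator k \<in> closed_invariant_subspaces A \<pi>"
proof -
  have "closed {z. cinner k (\<pi> b z) = 0}" for b
  proof (rule closed_Collect_eq)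
    show "continuous_on UNIV (\<lambda>z. cinner k (\<pi> b z))"
      unfolding continuous_on_sequentially comp_def by (auto intro!: tendsto_intros)
  qed simp
  then have "closed (\<Inter>b\<in>A. {z. cinner k (\<pi> b z) = 0})" by blast
  moreover have "(\<Inter>b\<in>A. {z. cinner k (\<pi> b z) = 0}) = annihilator k" by (auto simp: annihilator_def)
  ultimately have "closed (annihilator k)" by simp
  moreover have "cinner k (\<pi> b (\<pi> a z)) = 0" if "z \<in> annihilator k" "a \<in> A" "b \<in> A" for a b z
    using that A(4) by (auto simp: annihilator_def simp flip: \<pi>_mult)
  ultimately show ?thesis
    unfolding closed_invariant_subspaces_def complex_vector.subspace_def
    by (auto simp: annihilator_def blinfun.add_right cinner_add_right \<pi>(4) cinner_scaleC_right)
qed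

lemma nest: "M \<in> closed_invariant_subspaces A \<pi> \<Longrightarrow> N \<in> closed_invariant_subspaces A \<pi> \<Longrightarrow> M \<subseteq> N \<or> N \<subseteq> M"
  using rep by (auto simp: nest_representation_def)

text \<open>Replacing \<open>b\<close> by its compression to \<open>x i\<close> does not change \<open>\<langle>k, \<pi>(b) l\<rangle>\<close>, and these compressions
  are asymptotically scalar multiples of \<open>x i\<close>.\<close>

lemma orthogonal_annihilates:
  assumes k: "\<And>i. \<pi> (x i) k = k" and l: "\<And>i. \<pi> (x i) l = l" and "cinner k l = 0"
  shows "l \<in> annihilator k"
  unfolding annihilator_def
proof safe
  fix b assume b: "b \<in> A"
  let ?c = "\<omega> (expect b)"
  have in_A: "x i * b * x i \<in> A" "?c *\<^sub>C x i \<in> A" for i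
    using A b x_proj(1) by (auto intro: complex_vector.subspace_scale)
  have "cinner k (\<pi> (x i * b * x i - ?c *\<^sub>C x i) l) = cinner k (\<pi> b l)" for i
  proof -
    have "cinner k (\<pi> (x i * b * x i) l) = cinner k (\<pi> (x i) (\<pi> b l))"
      using A b x_proj(1) l by (simp add: \<pi>_mult)
    also have "\<dots> = cinner k (\<pi> b l)" using \<pi>_adjoint[OF x_proj(1), of i k] k x_proj(5) by simp
    finally show ?thesis
      using in_A assms(3) l A(3)[OF x_proj(1)]
      by (simp add: \<pi>_diff blinfun.diff_left cinner_diff_right \<pi>(3) cinner_scaleC_right)
  qed
  moreover have "(\<lambda>i. cinner k (\<pi> (x i * b * x i - ?c *\<^sub>C x i) l)) \<longlonglongrightarrow> cinner k (\<pi> 0 l)"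
    using in_A A(1)
    by (intro tendsto_intros tendsto_\<pi>_apply x_compress complex_vector.subspace_diff complex_vector.subspace_0)
  ultimately show "cinner k (\<pi> b l) = 0" by (simp add: \<pi>_0 LIMSEQ_const_iff)
qed

text \<open>A nonzero vector \<open>k\<close> orthogonal to \<open>h\<close> and fixed by all \<open>\<pi>(x i)\<close> would lie in the annihilator of
  \<open>h\<close> but not in its own, and \<open>h\<close> the other way round, so that the annihilators would be
  incomparable.\<close>

lemma fixed_space_one_dimensional:
  assumes z: "\<And>i. \<pi> (x i) z = z" shows "z = cinner h z *\<^sub>C h"
proof -
  define k where "k = z - cinner h z *\<^sub>C h"
  have k: "\<pi> (x i) k = k" for i
    using z h_x A(3)[OF x_proj(1)] by (simp add: k_def blinfun.diff_right \<pi>(4))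
  have hk: "cinner h k = 0" using h by (simp add: k_def cinner_diff_right cinner_scaleC_right)
  then have kh: "cinner k h = 0" using cinner_commute[of k h] by simp
  have self: "l \<notin> annihilator l" if "l \<noteq> 0" "\<And>i. \<pi> (x i) l = l" for l
    using that A(3)[OF x_proj(1)] unfolding annihilator_def by (auto intro!: bexI[of _ "x 0"])
  have "k = 0"
  proof (rule ccontr)
    assume "k \<noteq> 0"
    moreover have "h \<noteq> 0" using h by auto
    ultimately show False
      using nest[OF annihilator_invariant annihilator_invariant, of h k] self[of k] self[of h] k h_x
        orthogonal_annihilates[of h k] orthogonal_annihilates[of k h] hk kh by blast
  qed
  then show ?thesis by (simp add: k_def)
qed

text \<open>The decreasing projections \<open>\<pi>(x i)\<close> converge strongly, and a limit vector is fixed by all of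
  them.\<close>

lemma x_tendsto: "(\<lambda>i. \<pi> (x i) w) \<longlonglongrightarrow> cinner h w *\<^sub>C h"
proof -
  let ?p = "\<lambda>i. \<pi> (x i) w"
  have pp: "\<pi> (x i) (?p j) = ?p j" if "i \<le> j" for i j
    using x_mult[OF that] A(3)[OF x_proj(1)] by (simp flip: \<pi>_mult)
  have cross: "inner (?p i) (?p j) = inner (?p j) (?p j)" if "i \<le> j" for i j
  proof -
    have "cinner (?p i) (?p j) = cinner w (?p j)"
      using \<pi>_adjoint[OF x_proj(1)] x_proj(5) pp[OF that] by simp
    moreover have "cinner (?p j) (?p j) = cinner w (?p j)"
      using \<pi>_adjoint[OF x_proj(1)] x_proj(5) pp[of j j] by simp
    ultimately show ?thesis by (simp add: inner_eq_Re_cinner)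
  qed
  have dist: "(norm (?p i - ?p j))\<^sup>2 = (norm (?p i))\<^sup>2 - (norm (?p j))\<^sup>2" if "i \<le> j" for i j
    using cross[OF that] by (simp add: power2_norm_eq_inner algebra_simps inner_commute)
  have "decseq (\<lambda>i. (norm (?p i))\<^sup>2)"
    unfolding decseq_def using dist by (metis diff_ge_0_iff_ge zero_le_power2)
  then have "convergent (\<lambda>i. (norm (?p i))\<^sup>2)"
    by (intro Bseq_monoseq_convergent decseq_bounded[of _ 0] decseq_imp_monoseq) auto
  then have C: "Cauchy (\<lambda>i. (norm (?p i))\<^sup>2)" by (rule convergent_Cauchy)
  have "Cauchy ?p"
  proof (rule metric_CauchyI)
    fix e :: real assume "e > 0"
    then have "e\<^sup>2 > 0" by simp
    then obtain M where M: "\<And>m n. m \<ge> M \<Longrightarrow> n \<ge> M \<Longrightarrow> dist ((norm (?p m))\<^sup>2) ((norm (?p n))\<^sup>2) < e\<^sup>2"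
      using C unfolding Cauchy_def by blast
    have lt: "dist (?p m) (?p n) < e" if "m \<ge> M" "m \<le> n" for m n
    proof -
      have "(norm (?p m - ?p n))\<^sup>2 < e\<^sup>2"
        using M[of m n] that dist[OF that(2)] by (simp add: dist_real_def)
      then show ?thesis using \<open>e > 0\<close> by (simp add: dist_norm power_less_imp_less_base)
    qed
    then show "\<exists>M. \<forall>m\<ge>M. \<forall>n\<ge>M. dist (?p m) (?p n) < e"
      by (metis dist_commute linorder_le_cases)
  qed
  then have "convergent ?p" by (rule Cauchy_convergent)
  then obtain z where z: "?p \<longlonglongrightarrow> z" by (auto simp: convergent_def)
  have "\<pi> (x j) z = z" for j
  proof (rule LIMSEQ_unique[OF _ z])
    have "(\<lambda>i. \<pi> (x j) (?p i)) \<longlonglongrightarrow> \<pi> (x j) z" by (intro tendsto_intros z)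
    then show "?p \<longlonglongrightarrow> \<pi> (x j) z"
      by (rule Lim_transform_eventually) (auto intro!: eventually_sequentiallyI[of j] pp)
  qed
  then have "z = cinner h z *\<^sub>C h" by (rule fixed_space_one_dimensional)
  moreover have "(\<lambda>i. cinner h (?p i)) \<longlonglongrightarrow> cinner h z" by (intro tendsto_intros z)
  then have "cinner h z = cinner h w" by (simp add: h_coeigen x_proj(1) \<omega>_x LIMSEQ_const_iff)
  ultimately show ?thesis using z by simp
qed

lemma ideal:
  assumes "closed_ideal A J"
  shows "closed J" "v \<in> J \<Longrightarrow> v \<in> A" "v \<in> J \<Longrightarrow> a \<in> A \<Longrightarrow> a * v \<in> J" "v \<in> J \<Longrightarrow> a \<in> A \<Longrightarrow> v * a \<in> J"
    "bimodule J"
  using assms A(3) by (auto simp: closed_ideal_def bimodule_def)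

definition cyclic_space :: "'h set" where
  "cyclic_space = closure ((\<lambda>a. \<pi> a h) ` A)"

lemma cyclic_spaceI: "a \<in> A \<Longrightarrow> \<pi> a h \<in> cyclic_space"
  unfolding cyclic_space_def by (rule subsetD[OF closure_subset imageI])

lemma cyclic_space_induct:
  assumes "m \<in> cyclic_space" "\<And>a. a \<in> A \<Longrightarrow> P (\<pi> a h)" "closed {z. P z}" shows "P m"
  using closure_minimal[of "(\<lambda>a. \<pi> a h) ` A" "{z. P z}"] assms by (auto simp: cyclic_space_def)

lemma cyclic_space_invariant: "cyclic_space \<in> closed_invariant_subspaces A \<pi>"
proof -
  let ?S = "(\<lambda>a. \<pi> a h) ` A"
  have "y + z \<in> cyclic_space \<and> c *\<^sub>C y \<in> cyclic_space \<and> (\<forall>b\<in>A. \<pi> b y \<in> cyclic_space)"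
    if yz: "y \<in> cyclic_space" "z \<in> cyclic_space" for y z c
  proof -
    obtain f g where f: "\<And>n. f n \<in> ?S" "f \<longlonglongrightarrow> y" and g: "\<And>n. g n \<in> ?S" "g \<longlonglongrightarrow> z"
      using yz unfolding cyclic_space_def closure_sequential by metis
    have S: "f n + g n \<in> ?S" "c *\<^sub>C f n \<in> ?S" "b \<in> A \<Longrightarrow> \<pi> b (f n) \<in> ?S" for n b
    proof -
      obtain a a' where a: "a \<in> A" "f n = \<pi> a h" "a' \<in> A" "g n = \<pi> a' h" using f(1)[of n] g(1)[of n] by blast
      have "f n + g n = \<pi> (a + a') h" using a by (simp add: \<pi>(1) blinfun.add_left)
      then show "f n + g n \<in> ?S" using a A(1) complex_vector.subspace_add by blast
      have "c *\<^sub>C f n = \<pi> (c *\<^sub>C a) h" using a by (simp add: \<pi>(3))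
      then show "c *\<^sub>C f n \<in> ?S" using a A(1) complex_vector.subspace_scale by blast
      assume "b \<in> A"
      then have "\<pi> b (f n) = \<pi> (b * a) h" using a by (simp add: \<pi>_mult)
      then show "\<pi> b (f n) \<in> ?S" using a \<open>b \<in> A\<close> A(4) by blast
    qed
    have lim: "l \<in> cyclic_space" if "\<And>n. s n \<in> ?S" "s \<longlonglongrightarrow> l" for s l
      using that unfolding cyclic_space_def closure_sequential by blast
    show ?thesis
      using lim[OF S(1) tendsto_add[OF f(2) g(2)]]
        lim[OF S(2) tendsto_scaleC_hilbert[OF tendsto_const f(2)]]
        lim[OF S(3) blinfun.tendsto[OF tendsto_const f(2)]] by blast
  qed
  moreover have "0 \<in> cyclic_space"
    using cyclic_spaceI[OF complex_vector.subspace_0[OF A(1)]] by (simp add: \<pi>_0)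
  ultimately show ?thesis
    unfolding closed_invariant_subspaces_def complex_vector.subspace_def
    by (simp add: cyclic_space_def)
qed

lemma annihilator_subset_cyclic_space: "annihilator h \<subseteq> cyclic_space"
proof -
  have "h \<in> cyclic_space" using cyclic_spaceI[OF A(3)[OF x_proj(1)]] unfolding h_x .
  moreover have "h \<notin> annihilator h"
    using h h_x A(3)[OF x_proj(1)] unfolding annihilator_def by (auto intro!: bexI[of _ "x 0"])
  ultimately show ?thesis using nest[OF annihilator_invariant cyclic_space_invariant, of h] by blast
qed

end

section \<open>Matrix units linked by an ideal\<close>

context nest_at_point
begin

text \<open>If all these pairings vanish, then \<open>\<pi>(v)*\<close> maps the cyclic space \<open>M\<close> of \<open>h\<close> into the annihilator
  of \<open>h\<close>, for every \<open>v\<close> in \<open>J\<close>. The annihilator is contained in \<open>M\<close> because the lattice is a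
  nest. Playing this off against the invariance of \<open>M\<close> under \<open>\<pi>(v)\<close> kills \<open>\<pi>(v)\<close> on \<open>M\<close>, then its
  component along \<open>h\<close>, and finally its whole range.\<close>

lemma ideal_pairing_nonzero:
  assumes J: "closed_ideal A J" and v: "v \<in> J" "\<pi> v \<noteq> 0"
  obtains v' a b z where "v' \<in> J" "a \<in> A" "b \<in> A" "\<And>y. cinner z y = cinner (\<pi> a h) (\<pi> v' y)"
    "cinner h (\<pi> b z) \<noteq> 0"
proof (rule ccontr)
  assume contra: "\<not> thesis"
  note found = that
  note J_A = ideal(2)[OF J]
  have J_mult: "a * v \<in> J" "v * a \<in> J" if "v \<in> J" "a \<in> A" for v a
    using ideal(3,4)[OF J] that by auto
  \<comment> \<open>The vector \<open>\<pi>(v)* w\<close>.\<close>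
  define ad where "ad v w = (SOME z. \<forall>y. cinner z y = cinner w (\<pi> v y))" for v w
  have ad: "cinner (ad v w) y = cinner w (\<pi> v y)" if "v \<in> J" for v w y
    using someI_ex[OF adjoint_vector_exists[OF \<pi>(5)[OF J_A[OF that]], of w]] unfolding ad_def by blast
  have in_ann: "ad v (\<pi> a h) \<in> annihilator h" if "v \<in> J" "a \<in> A" for v a
    using contra found[OF that _ ad[OF that(1)]] unfolding annihilator_def by blast
  have in_M: "ad v (\<pi> a h) \<in> cyclic_space" if "v \<in> J" "a \<in> A" for v a
    using in_ann[OF that] annihilator_subset_cyclic_space by blast
  have x0: "x 0 \<in> A" using A(3) x_proj(1) by blast
  have h_ann: "cinner h z = 0" if "z \<in> annihilator h" for z
    using that x0 h_coeigen[OF x_proj(1)] \<omega>_x by (auto simp: annihilator_def)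
  have M_eq_0: "m = 0" if "m \<in> cyclic_space" "\<And>a. a \<in> A \<Longrightarrow> cinner (\<pi> a h) m = 0" for m
  proof -
    have "closed {z. cinner z m = 0}"
      by (rule closed_Collect_eq)
        (auto simp: continuous_on_sequentially comp_def intro!: tendsto_intros)
    then have "cinner m m = 0" using cyclic_space_induct[OF that(1), of "\<lambda>z. cinner z m = 0"] that(2) by blast
    then show ?thesis by simp
  qed
  have vh: "\<pi> v h = 0" if "v \<in> J" for v
  proof (rule M_eq_0)
    show "\<pi> v h \<in> cyclic_space" using cyclic_spaceI J_A that by blast
    fix a assume "a \<in> A"
    then have "cinner h (ad v (\<pi> a h)) = 0" using h_ann in_ann that by blast
    then have "cinner (ad v (\<pi> a h)) h = 0" using cinner_commute[of "ad v (\<pi> a h)" h] by simp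
    then show "cinner (\<pi> a h) (\<pi> v h) = 0" using ad[OF that] by simp
  qed
  have vM: "\<pi> v m = 0" if "v \<in> J" "m \<in> cyclic_space" for v m
    using that(2)
  proof (rule cyclic_space_induct)
    show "\<pi> v (\<pi> a h) = 0" if "a \<in> A" for a
      using vh[OF J_mult(2)[OF \<open>v \<in> J\<close> that]] \<pi>_mult[OF J_A[OF \<open>v \<in> J\<close>] that] by simp
    show "closed {z. \<pi> v z = 0}"
      by (rule closed_Collect_eq)
        (auto simp: continuous_on_sequentially comp_def intro!: tendsto_intros)
  qed
  have ad_0: "ad v (\<pi> a h) = 0" if "v \<in> J" "a \<in> A" for v a
  proof -
    have "cinner (ad v (\<pi> a h)) (ad v (\<pi> a h)) = 0"
      unfolding ad[OF that(1)] using vM[OF that(1) in_M[OF that]] by simp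
    then show ?thesis by simp
  qed
  have hv: "cinner h (\<pi> v y) = 0" if "v \<in> J" for v y
    using ad[OF that, of h y] ad_0[OF that x0] by (simp add: h_x)
  have "\<pi> v y = 0" for y
  proof (rule M_eq_0)
    have "cinner h (\<pi> b (\<pi> v y)) = 0" if "b \<in> A" for b
      using hv[OF J_mult(1)[OF v(1) that]] \<pi>_mult[OF that J_A[OF v(1)]] by simp
    then have "\<pi> v y \<in> annihilator h" by (simp add: annihilator_def)
    then show "\<pi> v y \<in> cyclic_space" using annihilator_subset_cyclic_space by blast
    show "cinner (\<pi> a h) (\<pi> v y) = 0" if "a \<in> A" for a
      using ad[OF v(1), of "\<pi> a h" y] ad_0[OF v(1) that] by simp
  qed
  then have "\<pi> v = 0" by (intro blinfun_eqI) simp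
  then show False using v(2) by blast
qed

text \<open>For upper triangular matrices, with \<open>\<omega>\<close> the index \<open>x\<close> and \<open>u = e\<^bsub>ix\<^esub>\<close>, the arrow \<open>u\<close> is left
  active if \<open>i \<le> x\<close> and \<open>e\<^bsub>ix\<^esub>\<close> is outside the kernel, and right active if \<open>x \<le> i\<close> and \<open>e\<^bsub>xi\<^esub>\<close> is
  outside the kernel. An ideal links \<open>e\<^bsub>ix\<^esub>\<close> to \<open>e\<^bsub>jx\<^esub>\<close> if it contains \<open>e\<^bsub>ij\<^esub>\<close>. The factors from \<open>D\<close>
  restrict these conditions to germs at \<open>\<omega>\<close>.\<close>

definition left_active :: "'b \<Rightarrow> bool" where
  "left_active u \<longleftrightarrow> (\<exists>d\<in>D. u * d \<in> A \<and> \<pi> (u * d) h \<noteq> 0)"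

definition right_active :: "'b \<Rightarrow> bool" where
  "right_active t \<longleftrightarrow> (\<exists>d\<in>D. d * adj t \<in> A \<and> (\<exists>y. cinner h (\<pi> (d * adj t) y) \<noteq> 0))"

definition links :: "'b set \<Rightarrow> 'b \<Rightarrow> 'b \<Rightarrow> bool" where
  "links J u t \<longleftrightarrow> (\<exists>g\<in>D. \<omega> g \<noteq> 0 \<and> u * g * adj t \<in> J)"

lemma arrow_slide:
  assumes "arrow j u" "d \<in> D"
  shows "(u * d * adj u) * u = u * d" "adj u * (u * d * adj u) = d * adj u"
proof -
  have 1: "u * x j = u" "adj u * u = x j" "x j * adj u = adj u"
    using assms(1) arrow_mult by (auto simp: arrow_def)
  have dx: "d * x j = x j * d" using D(4)[OF assms(2) x_proj(1)] .
  have "(u * d * adj u) * u = u * (d * x j)" using 1 by (simp add: mult.assoc)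
  then show "(u * d * adj u) * u = u * d" unfolding dx using 1 by (simp flip: mult.assoc)
  have "adj u * (u * d * adj u) = x j * d * adj u" using 1 by (simp flip: mult.assoc)
  also have "\<dots> = d * adj u" using 1 unfolding dx[symmetric] by (simp add: mult.assoc)
  finally show "adj u * (u * d * adj u) = d * adj u" .
qed

lemma links_absorb:
  assumes J: "bimodule J" and u: "arrow j u" and "u * g * adj t \<in> J" "g \<in> D" "d \<in> D"
  shows "u * (d * g) * adj t \<in> J"
proof -
  have "(u * d * adj u) * (u * g * adj t) \<in> J"
    using arrow_normalizes[OF u assms(5)] J assms(3) by (auto simp: bimodule_def)
  also have "(u * d * adj u) * (u * g * adj t) = ((u * d * adj u) * u) * (g * adj t)"
    by (simp only: mult.assoc)
  also have "\<dots> = u * (d * g) * adj t"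
    unfolding arrow_slide(1)[OF u assms(5)] by (simp only: mult.assoc)
  finally show ?thesis .
qed

text \<open>The pairing for \<open>J\<close> is first localized at \<open>h\<close> on both sides, so that \<open>b = d t*\<close> and \<open>a = u c\<close>.
  Replacing the element \<open>w\<close> of \<open>J\<close> by \<open>u x\<^sub>n u* w t x\<^sub>n t*\<close> does not change its
  value; but if \<open>u* w t\<close> vanished at \<open>\<omega>\<close>, these elements would tend to zero. So its expectation \<open>g\<close>
  does not vanish there, and \<open>u g t*\<close> belongs to the bimodule \<open>J\<close>.\<close>

lemma ideal_links_active_arrows:
  assumes J: "closed_ideal A J" and v: "v \<in> J" "\<pi> v \<noteq> 0"
  obtains j k u t where "arrow j u" "arrow k t" "left_active u" "right_active t" "links J u t"
proof -
  obtain w a b z where w: "w \<in> J" "a \<in> A" "b \<in> A"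
    and z: "\<And>y. cinner z y = cinner (\<pi> a h) (\<pi> w y)" and nz: "cinner h (\<pi> b z) \<noteq> 0"
    using ideal_pairing_nonzero[OF J v] by metis
  have wA: "w \<in> A" using ideal(2)[OF J] w by blast
  \<comment> \<open>Germs are detected on the right, so \<open>b\<close> is localized through its adjoint.\<close>
  define f where "f s = cinner h (\<pi> (adj s) z)" for s
  obtain k t c where t: "arrow k t" "c \<in> D" "t * c \<in> adj ` A" "f (t * c) \<noteq> 0"
  proof (rule bimodule_detected_on_arrows[of "adj ` A" "adj b" f])
    show "bimodule (adj ` A)" by (rule bimodule_adj[OF A_bimodule])
    show "adj b \<in> adj ` A" using w by blast
    show "f (s - s') = f s - f s'" if "s \<in> adj ` A" "s' \<in> adj ` A" for s s'
      using that unfolding adj_A_iff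
      by (simp add: f_def adj_diff \<pi>_diff blinfun.diff_left cinner_diff_right)
    show "continuous_on (adj ` A) f"
      unfolding continuous_on_sequentially comp_def
    proof (intro allI ballI impI)
      fix s l assume l: "l \<in> adj ` A" and s: "(\<forall>n. s n \<in> adj ` A) \<and> s \<longlonglongrightarrow> l"
      then have "(\<lambda>n. \<pi> (adj (s n)) z) \<longlonglongrightarrow> \<pi> (adj l) z"
        unfolding adj_A_iff by (intro tendsto_\<pi>_apply tendsto_adj) auto
      then show "(\<lambda>n. f (s n)) \<longlonglongrightarrow> f l" unfolding f_def by (rule tendsto_cinner[OF tendsto_const])
    qed
    show "f (s * x j) = f s" if "s \<in> adj ` A" for s j
      using that A(3)[OF x_proj(1)] unfolding adj_A_iff
      by (simp add: f_def adj_mult x_proj(5) \<pi>_mult h_coeigen[OF x_proj(1)] \<omega>_x)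
    show "f (adj b) \<noteq> 0" using nz by (simp add: f_def adj_adj)
  qed blast
  define d where "d = adj c"
  have d: "d \<in> D" "d * adj t \<in> A" "cinner h (\<pi> (d * adj t) z) \<noteq> 0"
    using t D(3) unfolding adj_A_iff by (auto simp: d_def f_def adj_mult)
  then have act_t: "right_active t" unfolding right_active_def by blast
  \<comment> \<open>With \<open>y = \<pi>(d t*)* h\<close> the pairing becomes \<open>\<langle>\<pi>(w) y, \<pi>(a) h\<rangle>\<close> up to conjugation.\<close>
  obtain y where y: "\<And>l. cinner y l = cinner h (\<pi> (d * adj t) l)"
    using adjoint_vector_exists[OF \<pi>(5)[OF d(2)]] by metis
  define F where "F s = cinner (\<pi> w y) (\<pi> s h)" for s
  obtain j u e where u: "arrow j u" "e \<in> D" "u * e \<in> A" "F (u * e) \<noteq> 0"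
  proof (rule bimodule_detected_on_arrows[of A a F])
    show "F (s - s') = F s - F s'" if "s \<in> A" "s' \<in> A" for s s'
      using that by (simp add: F_def \<pi>_diff blinfun.diff_left cinner_diff_right)
    show "continuous_on A F"
      unfolding continuous_on_sequentially comp_def
    proof (intro allI ballI impI)
      fix s l assume l: "l \<in> A" and s: "(\<forall>n. s n \<in> A) \<and> s \<longlonglongrightarrow> l"
      then have "(\<lambda>n. \<pi> (s n) h) \<longlonglongrightarrow> \<pi> l h" by (intro tendsto_\<pi>_apply) auto
      then show "(\<lambda>n. F (s n)) \<longlonglongrightarrow> F l" unfolding F_def by (rule tendsto_cinner[OF tendsto_const])
    qed
    show "F (s * x j) = F s" if "s \<in> A" for s j
      using that A(3)[OF x_proj(1)] by (simp add: F_def \<pi>_mult h_x)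
    have "cinner y z \<noteq> 0" using y d by simp
    then have "cinner z y \<noteq> 0" using cinner_commute[of y z] by auto
    then have "cinner (\<pi> a h) (\<pi> w y) \<noteq> 0" using z by simp
    then show "F a \<noteq> 0" using cinner_commute[of "\<pi> a h"] unfolding F_def by auto
  qed (use A_bimodule w in auto)
  have act_u: "left_active u"
    unfolding left_active_def using u by (auto simp: F_def intro!: bexI[of _ e])
  let ?c = "adj u * w * t"
  let ?l = "\<omega> (expect ?c)"
  have inJ: "u * expect ?c * adj t \<in> J"
    using arrow_expect_in_bimodule[OF ideal(5)[OF J] w(1) u(1) t(1)] .
  have "?l \<noteq> 0"
  proof
    assume l0: "?l = 0"
    define W where "W n = u * (x n * ?c * x n) * adj t" for n
    have W: "W n = (u * x n * adj u) * w * (t * x n * adj t)" for n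
      by (simp add: W_def mult.assoc)
    have p: "u * x n * adj u \<in> D" "t * x n * adj t \<in> D" for n
      using arrow_normalizes u(1) t(1) x_proj(1) by blast+
    have W_A: "W n \<in> A" for n unfolding W using p[of n] A(3,4) wA by blast
    have "(\<lambda>n. x n * ?c * x n) \<longlonglongrightarrow> 0" using x_compress[of ?c] l0 by simp
    then have "W \<longlonglongrightarrow> u * 0 * adj t" unfolding W_def by (intro tendsto_intros)
    then have "(\<lambda>n. \<pi> (W n) y) \<longlonglongrightarrow> \<pi> 0 y"
      using W_A complex_vector.subspace_0[OF A(1)] by (intro tendsto_\<pi>_apply) auto
    then have "(\<lambda>n. cinner (\<pi> (W n) y) (\<pi> (u * e) h)) \<longlonglongrightarrow> cinner 0 (\<pi> (u * e) h)"
      unfolding \<pi>_0 by (intro tendsto_intros) simp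
    moreover have "cinner (\<pi> (W n) y) (\<pi> (u * e) h) = F (u * e)" for n
    proof -
      have "\<pi> (t * x n * adj t) y - y = 0"
      proof -
        have "cinner (\<pi> (t * x n * adj t) y) l = cinner y l" for l
        proof -
          have "cinner (\<pi> (t * x n * adj t) y) l = cinner h (\<pi> (d * adj t) (\<pi> (t * x n * adj t) l))"
            using \<pi>_adjoint[OF p(2)] y by (simp add: adj_mult adj_adj x_proj(5) mult.assoc)
          also have "\<dots> = cinner h (\<pi> (d * (adj t * (t * x n * adj t))) l)"
            using \<pi>_mult[OF d(2) A(3)[OF p(2)]] by (simp add: mult.assoc)
          also have "d * (adj t * (t * x n * adj t)) = x n * (d * adj t)"
            unfolding arrow_slide(2)[OF t(1) x_proj(1)]
            using D(4)[OF d(1) x_proj(1)] by (simp flip: mult.assoc)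
          also have "cinner h (\<pi> (x n * (d * adj t)) l) = cinner y l"
            using \<pi>_mult[OF A(3)[OF x_proj(1)] d(2)] h_coeigen[OF x_proj(1)] y by (simp add: \<omega>_x)
          finally show ?thesis .
        qed
        then have "cinner (\<pi> (t * x n * adj t) y - y) (\<pi> (t * x n * adj t) y - y) = 0"
          using cinner_add_left[of "\<pi> (t * x n * adj t) y - y" y "\<pi> (t * x n * adj t) y - y"] by simp
        then show ?thesis by simp
      qed
      then have fix_y: "\<pi> (t * x n * adj t) y = y" by simp
      have "\<pi> (u * x n * adj u) (\<pi> (u * e) h) = \<pi> ((u * x n * adj u) * u * e) h"
        using \<pi>_mult[OF A(3)[OF p(1)] u(3)] by (simp add: mult.assoc)
      also have "(u * x n * adj u) * u * e = (u * e) * x n"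
        unfolding arrow_slide(1)[OF u(1) x_proj(1)] using D(4)[OF u(2) x_proj(1)] by (simp add: mult.assoc)
      also have "\<pi> ((u * e) * x n) h = \<pi> (u * e) h"
        using \<pi>_mult[OF u(3) A(3)[OF x_proj(1)]] h_x by simp
      finally have fix_u: "\<pi> (u * x n * adj u) (\<pi> (u * e) h) = \<pi> (u * e) h" .
      have "\<pi> (W n) y = \<pi> (u * x n * adj u) (\<pi> w y)"
        unfolding W using p[THEN A(3)] wA A(4) fix_y by (simp add: \<pi>_mult)
      then show ?thesis
        using \<pi>_adjoint[OF p(1)] fix_u by (simp add: F_def adj_mult adj_adj x_proj(5) mult.assoc)
    qed
    ultimately show False using u(4) by (simp add: LIMSEQ_const_iff)
  qed
  then have "links J u t" unfolding links_def using inJ expect_in_masa by blast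
  then show ?thesis using that[OF u(1) t(1) act_u act_t] by blast
qed

text \<open>Ideals are closed and absorb \<open>A\<close> on the left, so a link of \<open>t\<close> is inherited by every arrow whose
  germ is a limit of left multiples of that of \<open>t\<close>.\<close>

lemma links_closure_left:
  assumes J: "closed_ideal A J" and u: "arrow j u" and "links J t s" "e \<in> D" "\<omega> e \<noteq> 0"
    and cl: "u * e \<in> closure ((\<lambda>a. a * t) ` A)"
  shows "links J u s"
proof -
  obtain g where g: "g \<in> D" "\<omega> g \<noteq> 0" "t * g * adj s \<in> J" using assms(3) by (auto simp: links_def)
  obtain f where f: "\<And>n. f n \<in> (\<lambda>a. a * t) ` A" "f \<longlonglongrightarrow> u * e"
    using cl unfolding closure_sequential by blast
  have mem: "f n * g * adj s \<in> J" for n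
  proof -
    obtain a where "a \<in> A" "f n = a * t" using f(1)[of n] by blast
    then show ?thesis using ideal(3)[OF J g(3)] by (simp add: mult.assoc)
  qed
  have "(\<lambda>n. f n * g * adj s) \<longlonglongrightarrow> u * e * g * adj s" by (intro tendsto_intros f)
  from closed_sequentially[OF ideal(1)[OF J] mem this]
  have "u * (e * g) * adj s \<in> J" by (simp add: mult.assoc)
  then show ?thesis unfolding links_def
    using D(2)[OF assms(4) g(1)] \<omega>_mult[OF assms(4) g(1)] g(2) assms(5) by (intro bexI[of _ "e * g"]) auto
qed

text \<open>On the right, arrows enter through their adjoints, and so does \<open>A\<close>.\<close>

lemma links_closure_right:
  assumes J: "closed_ideal A J" and "links J u t" "e \<in> D" "\<omega> e \<noteq> 0"
    and cl: "s * e \<in> closure ((\<lambda>a. a * t) ` (adj ` A))"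
  shows "links J u s"
proof -
  obtain g where g: "g \<in> D" "\<omega> g \<noteq> 0" "u * g * adj t \<in> J" using assms(2) by (auto simp: links_def)
  obtain f where f: "\<And>n. f n \<in> (\<lambda>a. a * t) ` (adj ` A)" "f \<longlonglongrightarrow> s * e"
    using cl unfolding closure_sequential by blast
  have mem: "u * g * adj (f n) \<in> J" for n
  proof -
    obtain a where "a \<in> A" "f n = adj a * t" using f(1)[of n] by blast
    then show ?thesis using ideal(4)[OF J g(3)] by (simp add: mult.assoc adj_mult adj_adj)
  qed
  have "(\<lambda>n. u * g * adj (f n)) \<longlonglongrightarrow> u * g * adj (s * e)" by (intro tendsto_intros f)
  from closed_sequentially[OF ideal(1)[OF J] mem this]
  have "u * (g * adj e) * adj s \<in> J" by (simp add: mult.assoc adj_mult)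
  then show ?thesis unfolding links_def
    using D(2)[OF g(1) D(3)[OF assms(3)]] \<omega>_mult[OF g(1) D(3)[OF assms(3)]] \<omega>_adj[OF assms(3)] g(2) assms(4)
    by (intro bexI[of _ "g * adj e"]) auto
qed

text \<open>By comparability of arrows on each side, the two ideals link a common pair \<open>u\<close>, \<open>t\<close> of active
  arrows. The elements \<open>u c x\<^sub>n g d t*\<close> then lie in both ideals, and their images tend strongly to a
  product through the rank one projection onto \<open>h\<close>, which is nonzero.\<close>

lemma ideals_meet_outside_kernel:
  assumes J: "closed_ideal A J" "v \<in> J" "\<pi> v \<noteq> 0" and K: "closed_ideal A K" "w \<in> K" "\<pi> w \<noteq> 0"
  shows "\<exists>a\<in>J \<inter> K. \<pi> a \<noteq> 0"
proof -
  obtain j k u t where ut: "arrow j u" "arrow k t" "left_active u" "right_active t" "links J u t"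
    using ideal_links_active_arrows[OF J] by metis
  obtain j' k' u' t' where ut': "arrow j' u'" "arrow k' t'" "left_active u'" "right_active t'" "links K u' t'"
    using ideal_links_active_arrows[OF K] by metis
  have "\<exists>i r. arrow i r \<and> left_active r \<and> links J r t \<and> links K r t'"
    using arrows_comparable[OF A_bimodule A_dense ut(1) ut'(1)]
      links_closure_left[OF K(1) ut(1) ut'(5)] links_closure_left[OF J(1) ut'(1) ut(5)] ut ut' by blast
  then obtain i r where r: "arrow i r" "left_active r" "links J r t" "links K r t'" by blast
  have "\<exists>i s. arrow i s \<and> right_active s \<and> links J r s \<and> links K r s"
    using arrows_comparable[OF bimodule_adj[OF A_bimodule] adj_A_dense ut(2) ut'(2)]
      links_closure_right[OF K(1) r(4)] links_closure_right[OF J(1) r(3)] ut ut' r by blast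
  then obtain i' s where s: "arrow i' s" "right_active s" "links J r s" "links K r s" by blast
  obtain g where g: "g \<in> D" "\<omega> g \<noteq> 0" "r * g * adj s \<in> J" using s by (auto simp: links_def)
  obtain g' where g': "g' \<in> D" "\<omega> g' \<noteq> 0" "r * g' * adj s \<in> K" using s by (auto simp: links_def)
  obtain c where c: "c \<in> D" "r * c \<in> A" "\<pi> (r * c) h \<noteq> 0" using r by (auto simp: left_active_def)
  obtain d y where d: "d \<in> D" "d * adj s \<in> A" "cinner h (\<pi> (d * adj s) y) \<noteq> 0"
    using s by (auto simp: right_active_def)
  define a where "a n = (r * c) * (x n * ((g * g') * (d * adj s)))" for n
  have gg: "g * g' \<in> D" using D g g' by blast
  have mid: "x n * ((g * g') * (d * adj s)) \<in> A" for n
    using A gg d x_proj(1) by blast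
  have a_JK: "a n \<in> J \<inter> K" for n
  proof -
    have abs: "r * ((c * x n * e * d) * f) * adj s \<in> I"
      if "closed_ideal A I" "f \<in> D" "e \<in> D" "r * f * adj s \<in> I" for e f I
      using links_absorb[OF ideal(5)[OF that(1)] r(1) that(4) that(2), of "c * x n * e * d"]
        D(2) c(1) d(1) x_proj(1) that(3) by blast
    have "(c * x n * g' * d) * g = c * x n * (g * g') * d"
      using D(4)[OF d(1) g(1)] D(4)[OF g(1) g'(1)] by (simp add: mult.assoc)
    moreover have "(c * x n * g * d) * g' = c * x n * (g * g') * d"
      using D(4)[OF d(1) g'(1)] by (simp add: mult.assoc)
    ultimately have "r * (c * x n * (g * g') * d) * adj s \<in> J \<inter> K"
      using abs[OF J(1) g(1) g'(1) g(3)] abs[OF K(1) g'(1) g(1) g'(3)] by simp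
    then show ?thesis by (simp add: a_def mult.assoc)
  qed
  have "\<exists>n. \<pi> (a n) \<noteq> 0"
  proof (rule ccontr)
    assume none: "\<not> ?thesis"
    define l where "l = \<pi> ((g * g') * (d * adj s)) y"
    have "\<pi> (a n) y = \<pi> (r * c) (\<pi> (x n) l)" for n
      unfolding a_def l_def using mid[of n] c(2) A gg d(2) x_proj(1)[of n] by (simp add: \<pi>_mult)
    then have "\<pi> (r * c) (\<pi> (x n) l) = 0" for n using none by simp
    moreover have "(\<lambda>n. \<pi> (r * c) (\<pi> (x n) l)) \<longlonglongrightarrow> \<pi> (r * c) (cinner h l *\<^sub>C h)"
      by (intro tendsto_intros x_tendsto)
    ultimately have "cinner h l *\<^sub>C \<pi> (r * c) h = 0" using c(2) by (simp add: \<pi>(4) LIMSEQ_const_iff)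
    moreover have "cinner h l \<noteq> 0"
      using gg d g g' A(3)[OF gg] by (simp add: l_def \<pi>_mult h_coeigen \<omega>_mult)
    ultimately show False using c(3) by (simp add: complex_vector.scale_eq_0_iff)
  qed
  then show ?thesis using a_JK by blast
qed

end

section \<open>From an atom to a point of the spectrum\<close>

lemma subset_bicommutant:
  assumes "M \<subseteq> bounded_operators" shows "M \<subseteq> commutant (commutant M)"
  using assms by (auto simp: commutant_def)

lemma commutant_compose:
  assumes "S \<in> commutant M" "T \<in> commutant M" shows "S o\<^sub>L T \<in> commutant M"
proof -
  have "(S o\<^sub>L T) o\<^sub>L R = R o\<^sub>L (S o\<^sub>L T)" if "R \<in> M" for R
  proof (rule blinfun_eqI)
    fix y
    have "S (R z) = R (S z)" "T (R z) = R (T z)" for z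
      using assms that unfolding commutant_def by (metis (mono_tags, lifting) blinfun_apply_blinfun_compose mem_Collect_eq)+
    then show "((S o\<^sub>L T) o\<^sub>L R) y = (R o\<^sub>L (S o\<^sub>L T)) y" by simp
  qed
  then show ?thesis using assms by (auto simp: commutant_def bounded_operators_def)
qed

text \<open>A commutative set lies in its commutant, so \<open>p\<close> commutes with it and \<open>p S\<close> is a
  projection of the bicommutant below \<open>p\<close>.\<close>

lemma atom_dichotomy:
  assumes M: "M \<subseteq> bounded_operators" "\<And>S T. S \<in> M \<Longrightarrow> T \<in> M \<Longrightarrow> S o\<^sub>L T = T o\<^sub>L S"
    and p: "atom_of (commutant (commutant M)) p" and S: "S \<in> M"
  shows "p o\<^sub>L S = S o\<^sub>L p" and "projection S \<Longrightarrow> p o\<^sub>L S = 0 \<or> p o\<^sub>L S = p"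
proof -
  have "S \<in> commutant M" using M S by (auto simp: commutant_def)
  moreover have pM: "p \<in> commutant (commutant M)" "projection p" using p by (auto simp: atom_of_def)
  ultimately show comm: "p o\<^sub>L S = S o\<^sub>L p" by (auto simp: commutant_def)
  assume proj: "projection S"
  have "p o\<^sub>L S \<in> commutant (commutant M)"
    using commutant_compose[OF pM(1)] subset_bicommutant[OF M(1)] S by blast
  moreover have "projection (p o\<^sub>L S)" unfolding projection_def
  proof (intro conjI)
    show "p o\<^sub>L S \<in> bounded_operators"
      using pM proj by (auto simp: projection_def bounded_operators_def)
    have pS: "p (S z) = S (p z)" for z using comm by (metis blinfun_apply_blinfun_compose)
    have idem: "p (p z) = p z" "S (S z) = S z" for z
      using pM proj unfolding projection_def by (metis blinfun_apply_blinfun_compose)+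
    show "(p o\<^sub>L S) o\<^sub>L (p o\<^sub>L S) = p o\<^sub>L S" by (rule blinfun_eqI) (simp add: pS idem)
    show "adjoint_pair (p o\<^sub>L S) (p o\<^sub>L S)"
      using pM proj by (simp add: projection_def adjoint_pair_def) (metis pS)
  qed
  moreover have "majorizes p (p o\<^sub>L S)" by (auto simp: majorizes_def)
  ultimately show "p o\<^sub>L S = 0 \<or> p o\<^sub>L S = p" using p by (auto simp: atom_of_def)
qed

lemma canonical_masa_sequence_shift:
  assumes "canonical_masa_sequence Bs D" shows "canonical_masa_sequence (\<lambda>i. Bs (i + n)) D"
proof -
  have "Bs i \<subseteq> Bs (Suc i)" for i using assms by (auto simp: canonical_masa_sequence_def)
  then have "Bs i \<subseteq> Bs (i + n)" for i by (rule lift_Suc_mono_le) simp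
  then have "(\<Union>i. Bs (i + n)) = (\<Union>i. Bs i)" "(\<Union>i. D \<inter> Bs (i + n)) = (\<Union>i. D \<inter> Bs i)" by blast+
  then show ?thesis using assms by (simp add: canonical_masa_sequence_def)
qed

lemma canonical_masa_sequence_basis:
  assumes "canonical_masa_sequence Bs D" obtains Q where "af_masa Bs D Q"
proof -
  have "\<exists>Q. projection_basis (D \<inter> Bs i) Q" for i
  proof -
    obtain F where "finite F" "Bs i = complex_vector.span F"
      using assms unfolding canonical_masa_sequence_def finite_dimensional_def by metis
    moreover have "star_subalgebra (D \<inter> Bs i)" "abelian (D \<inter> Bs i)"
      using assms by (auto simp: canonical_masa_sequence_def masa_in_def)
    ultimately show ?thesis using finite_dimensional_abelian_projection_basis[of "D \<inter> Bs i" F] by blast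
  qed
  then obtain Q where "\<And>i. projection_basis (D \<inter> Bs i) (Q i)" by metis
  then show ?thesis using that assms by (auto simp: af_masa_def)
qed

context af_masa
begin

lemma unit_tendsto: "(\<lambda>i. a * (\<Sum>q\<in>Q i. q)) \<longlonglongrightarrow> a" "(\<lambda>i. (\<Sum>q\<in>Q i. q) * a) \<longlonglongrightarrow> a"
proof -
  have f: "is_projection (\<Sum>q\<in>Q i. q)" for i
    using sum_orthogonal_projections(1)[of "Q i" "\<lambda>q. q"] Q_finite Q(3) Q_orth by auto
  have right: "(\<lambda>i. a * (\<Sum>q\<in>Q i. q)) \<longlonglongrightarrow> a" for a
  proof (rule metric_LIMSEQ_I)
    fix e :: real assume "e > 0"
    then have "e / 2 > 0" by simp
    then obtain l b where b: "b \<in> Bs l" "norm (a - b) < e / 2" by (rule Bs_dense)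
    have "dist (a * (\<Sum>q\<in>Q i. q)) a < e" if "i \<ge> l" for i
    proof -
      have "b * (\<Sum>q\<in>Q i. q) = b" using Q_sum_unit(2)[of b i] b Bs_mono[OF that] by blast
      then have "a * (\<Sum>q\<in>Q i. q) - a = (a - b) * (\<Sum>q\<in>Q i. q) - (a - b)"
        by (simp add: left_diff_distrib)
      also have "norm \<dots> \<le> norm ((a - b) * (\<Sum>q\<in>Q i. q)) + norm (a - b)"
        by (rule norm_triangle_ineq4)
      also have "\<dots> \<le> norm (a - b) + norm (a - b)"
        using norm_projection_mult_le(2)[OF f] by (rule add_right_mono)
      finally show ?thesis using b by (simp add: dist_norm)
    qed
    then show "\<exists>N. \<forall>i\<ge>N. dist (a * (\<Sum>q\<in>Q i. q)) a < e" by blast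
  qed
  show "(\<lambda>i. a * (\<Sum>q\<in>Q i. q)) \<longlonglongrightarrow> a" by (rule right)
  have "(\<lambda>i. adj (adj a * (\<Sum>q\<in>Q i. q))) \<longlonglongrightarrow> adj (adj a)" by (intro tendsto_adj right)
  then show "(\<lambda>i. (\<Sum>q\<in>Q i. q) * a) \<longlonglongrightarrow> a"
    using f by (simp add: adj_mult adj_adj is_projection_def)
qed

end

lemma kernel_closed_ideal:
  assumes "strongly_maximal_taf A D" "nest_representation A \<pi>"
  shows "closed_ideal A {a \<in> A. \<pi> a = 0}"
proof -
  have A: "closed A" "complex_vector.subspace A" "\<And>a b. a \<in> A \<Longrightarrow> b \<in> A \<Longrightarrow> a * b \<in> A"
    using assms(1) by (auto simp: strongly_maximal_taf_def taf_algebra_def subalgebra_def)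
  have \<pi>: "continuous_on A \<pi>" "\<And>a b. a \<in> A \<Longrightarrow> b \<in> A \<Longrightarrow> \<pi> (a + b) = \<pi> a + \<pi> b"
    "\<And>a b. a \<in> A \<Longrightarrow> b \<in> A \<Longrightarrow> \<pi> (a * b) = \<pi> a o\<^sub>L \<pi> b"
    "\<And>c a x. a \<in> A \<Longrightarrow> \<pi> (c *\<^sub>C a) x = c *\<^sub>C \<pi> a x"
    using assms(2) by (auto simp: nest_representation_def algebra_hom_on_def)
  have "closed {a \<in> A. \<pi> a = 0}"
    using continuous_closed_preimage_constant[OF \<pi>(1) A(1)] .
  moreover have "\<pi> 0 = 0" using \<pi>(2)[of 0 0] complex_vector.subspace_0[OF A(2)] by simp
  moreover have "\<pi> (c *\<^sub>C a) = 0" if "a \<in> A" "\<pi> a = 0" for c a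
    using \<pi>(4)[OF that(1)] that(2) by (intro blinfun_eqI) simp
  ultimately show ?thesis
    using A \<pi> unfolding closed_ideal_def complex_vector.subspace_def
    by (auto intro!: blinfun_eqI)
qed

text \<open>If the atom \<open>p\<close> is orthogonal to \<open>\<pi>(D)\<close>, then any \<open>h\<close> in its range is killed by \<open>\<pi>(A)\<close> and
  orthogonal to the range of \<open>\<pi>(A)\<close>, because the units of the finite dimensional algebras form an
  approximate unit. So the line through \<open>h\<close> and its orthogonal complement are both invariant, and in a
  nest this leaves only the zero representation.\<close>

lemma (in af_masa) degenerate_representation_zero:
  fixes \<pi> :: "'b \<Rightarrow> 'h::complex_hilbert \<Rightarrow>\<^sub>L 'h"
  assumes taf: "strongly_maximal_taf A D" and rep: "nest_representation A \<pi>"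
    and star: "star_representation_on D \<pi>" and h: "h \<noteq> 0"
    and kill: "\<And>i q. q \<in> Q i \<Longrightarrow> \<pi> q h = 0" and a: "a \<in> A"
  shows "\<pi> a = 0"
proof -
  define f where "f i = (\<Sum>q\<in>Q i. q)" for i
  have A: "closed A" "complex_vector.subspace A" "\<And>a b. a \<in> A \<Longrightarrow> b \<in> A \<Longrightarrow> a * b \<in> A" "D \<subseteq> A"
    using taf by (auto simp: strongly_maximal_taf_def taf_algebra_def subalgebra_def)
  have \<pi>: "continuous_on A \<pi>" "\<And>a b. a \<in> A \<Longrightarrow> b \<in> A \<Longrightarrow> \<pi> (a + b) = \<pi> a + \<pi> b"
    "\<And>a b. a \<in> A \<Longrightarrow> b \<in> A \<Longrightarrow> \<pi> (a * b) = \<pi> a o\<^sub>L \<pi> b"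
    "\<And>a c y. a \<in> A \<Longrightarrow> \<pi> a (c *\<^sub>C y) = c *\<^sub>C \<pi> a y"
    using rep by (auto simp: nest_representation_def algebra_hom_on_def bounded_operators_def)
  have "\<pi> 0 = 0" using \<pi>(2)[of 0 0] complex_vector.subspace_0[OF A(2)] by simp
  have fD: "f i \<in> D" for i unfolding f_def using Q(1) D(1) by (intro complex_vector.subspace_sum) auto
  have adj_f: "adj (f i) = f i" for i using Q(5) by (simp add: f_def adj_sum)
  have "\<pi> (sum (\<lambda>q. q) R) h = 0 \<and> sum (\<lambda>q. q) R \<in> A" if "finite R" "R \<subseteq> Q i" for R i
    using that
  proof (induction R rule: finite_induct)
    case (insert q R)
    then have "q \<in> A" using Q(1) A(4) by blast
    then show ?case using insert kill A(2)
      by (auto simp: \<pi>(2) blinfun.add_left intro: complex_vector.subspace_add)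
  qed (use \<open>\<pi> 0 = 0\<close> complex_vector.subspace_0[OF A(2)] in auto)
  then have fh: "\<pi> (f i) h = 0" for i using Q_finite by (auto simp: f_def)
  have lim: "(\<lambda>n. \<pi> (s n) y) \<longlonglongrightarrow> \<pi> l y" if "s \<longlonglongrightarrow> l" "\<And>n. s n \<in> A" "l \<in> A" for s :: "nat \<Rightarrow> 'b" and l y
  proof -
    have "(\<lambda>n. \<pi> (s n)) \<longlonglongrightarrow> \<pi> l"
      using \<pi>(1) that unfolding continuous_on_sequentially comp_def by blast
    then show ?thesis by (intro blinfun.tendsto tendsto_const)
  qed
  have ah: "\<pi> a h = 0" if "a \<in> A" for a
  proof -
    have "(\<lambda>i. \<pi> (a * f i) h) \<longlonglongrightarrow> \<pi> a h"
      using unit_tendsto(1)[of a] that A fD unfolding f_def[symmetric] by (intro lim) auto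
    moreover have "\<pi> (a * f i) h = 0" for i using that \<pi>(3) A(4) fD fh by (auto simp: subset_iff)
    ultimately show ?thesis by (simp add: LIMSEQ_const_iff)
  qed
  have ha: "cinner h (\<pi> a y) = 0" if "a \<in> A" for a y
  proof -
    have "(\<lambda>i. cinner h (\<pi> (f i * a) y)) \<longlonglongrightarrow> cinner h (\<pi> a y)"
      using unit_tendsto(2)[of a] that A fD unfolding f_def[symmetric]
      by (intro tendsto_cinner tendsto_const lim) auto
    moreover have "cinner h (\<pi> (f i * a) y) = 0" for i
    proof -
      have "cinner h (\<pi> (f i * a) y) = cinner h (\<pi> (f i) (\<pi> a y))"
        using that \<pi>(3) A(4) fD by (auto simp: subset_iff)
      also have "\<dots> = cinner (\<pi> (f i) h) (\<pi> a y)"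
        using star fD[of i] adj_f[of i] unfolding star_representation_on_def adjoint_pair_def by metis
      finally show ?thesis using fh by simp
    qed
    ultimately show ?thesis by (simp add: LIMSEQ_const_iff)
  qed
  define L where "L = {z. z = (cinner h z / cinner h h) *\<^sub>C h}"
  define P where "P = {z. cinner h z = 0}"
  have hh: "cinner h h \<noteq> 0" using h by simp
  have "L \<in> closed_invariant_subspaces A \<pi>"
  proof -
    have "closed L" unfolding L_def
      by (rule closed_Collect_eq)
        (use hh in \<open>auto simp: continuous_on_sequentially comp_def intro!: tendsto_intros\<close>)
    moreover have L: "z \<in> L \<longleftrightarrow> (\<exists>c. z = c *\<^sub>C h)" for z
      using hh by (auto simp: L_def cinner_scaleC_right)
    have "\<pi> a z = 0" if "a \<in> A" "z \<in> L" for a z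
      using that ah \<pi>(4) unfolding L by fastforce
    moreover have "0 \<in> L" "\<And>y z. y \<in> L \<Longrightarrow> z \<in> L \<Longrightarrow> y + z \<in> L" "\<And>c z. z \<in> L \<Longrightarrow> c *\<^sub>C z \<in> L"
      unfolding L by (metis complex_vector.scale_zero_left, metis scaleC_add_left, metis scaleC_scaleC)
    ultimately show ?thesis
      unfolding closed_invariant_subspaces_def complex_vector.subspace_def by simp
  qed
  moreover have "P \<in> closed_invariant_subspaces A \<pi>"
  proof -
    have "closed P" unfolding P_def
      by (rule closed_Collect_eq)
        (auto simp: continuous_on_sequentially comp_def intro!: tendsto_intros)
    then show ?thesis
      unfolding closed_invariant_subspaces_def complex_vector.subspace_def
      by (auto simp: P_def cinner_add_right cinner_scaleC_right ha)
  qed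
  moreover have "h \<in> L" "h \<notin> P" using hh by (auto simp: L_def P_def scaleC_one)
  ultimately have "P \<subseteq> L" using rep unfolding nest_representation_def by blast
  show ?thesis
  proof (rule blinfun_eqI)
    fix y
    have "\<pi> a y \<in> P" using ha[OF a] by (simp add: P_def)
    then have "\<pi> a y \<in> L" using \<open>P \<subseteq> L\<close> by blast
    then show "\<pi> a y = blinfun_apply 0 y" using ha[OF a, of y] by (simp add: L_def)
  qed
qed

text \<open>Below the atom \<open>p\<close>, at most one minimal projection of each level survives, and from the first
  level on where one survives it does so at every later level. These projections determine the point.\<close>

lemma (in af_masa) nest_at_point_exists:
  fixes \<pi> :: "'b \<Rightarrow> 'h::complex_hilbert \<Rightarrow>\<^sub>L 'h"
  assumes taf: "strongly_maximal_taf A D" and rep: "nest_representation A \<pi>"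
    and star: "star_representation_on D \<pi>" and p: "atom_of (commutant (commutant (\<pi> ` D))) p"
    and q0: "q0 \<in> Q n" "p o\<^sub>L \<pi> q0 \<noteq> 0"
  obtains x \<omega> h where "nest_at_point (\<lambda>i. Bs (i + n)) D (\<lambda>i. Q (i + n)) x \<omega> A \<pi> h"
proof -
  have \<pi>: "\<And>a b. a \<in> D \<Longrightarrow> b \<in> D \<Longrightarrow> \<pi> (a + b) = \<pi> a + \<pi> b"
    "\<And>a b. a \<in> D \<Longrightarrow> b \<in> D \<Longrightarrow> \<pi> (a * b) = \<pi> a o\<^sub>L \<pi> b"
    "\<And>c a y. a \<in> D \<Longrightarrow> \<pi> (c *\<^sub>C a) y = c *\<^sub>C \<pi> a y"
    "\<And>a c y. a \<in> D \<Longrightarrow> \<pi> a (c *\<^sub>C y) = c *\<^sub>C \<pi> a y"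
    "\<And>a. a \<in> D \<Longrightarrow> \<pi> a \<in> bounded_operators"
    "\<And>a. a \<in> D \<Longrightarrow> adjoint_pair (\<pi> a) (\<pi> (adj a))"
    using star by (auto simp: star_representation_on_def algebra_hom_on_def bounded_operators_def)
  have "continuous_on D \<pi>"
    using rep taf by (auto simp: nest_representation_def strongly_maximal_taf_def taf_algebra_def
        intro: continuous_on_subset)
  note atom = atom_dichotomy[OF _ _ p]
  have bdd: "\<pi> ` D \<subseteq> bounded_operators" using \<pi>(5) by blast
  have comm: "S o\<^sub>L T = T o\<^sub>L S" if "S \<in> \<pi> ` D" "T \<in> \<pi> ` D" for S T
    using that D(4) by (auto simp flip: \<pi>(2))
  have proj: "projection (\<pi> q)" if "q \<in> Q i" for q i
    using \<pi>(2)[of q q] \<pi>(5,6)[of q] Q[OF that] by (auto simp: projection_def)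
  have "\<exists>q\<in>Q (i + n). p o\<^sub>L \<pi> q = p" for i
  proof (rule ccontr)
    assume none: "\<not> ?thesis"
    \<comment> \<open>Otherwise \<open>p\<close> would annihilate every summand of \<open>q0 = \<Sum>q. q q0\<close>.\<close>
    have "q0 \<in> Bs (i + n)" using Q(2)[OF q0(1)] Bs_mono[of n "i + n"] by auto
    then have sum: "(\<Sum>q\<in>Q (i + n). q * q0) = q0" using Q_sum[OF Q(1)[OF q0(1)]] by blast
    have zero: "p o\<^sub>L \<pi> q = 0" if "q \<in> Q (i + n)" for q
      using none that atom(2)[OF bdd comm imageI[OF Q(1)[OF that]] proj[OF that]] by blast
    have "\<pi> 0 = 0" using \<pi>(1)[of 0 0] complex_vector.subspace_0[OF D(1)] by simp
    have "p (\<pi> (\<Sum>q\<in>R. q * q0) y) = 0 \<and> (\<Sum>q\<in>R. q * q0) \<in> D" if "finite R" "R \<subseteq> Q (i + n)" for R y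
      using that
    proof (induction R rule: finite_induct)
      case (insert q R)
      then have q: "q \<in> D" "q * q0 \<in> D" "p o\<^sub>L \<pi> q = 0" using Q(1) D(2) q0(1) zero by auto
      have "p (\<pi> q z) = 0" for z using q(3) by (metis blinfun_apply_blinfun_compose blinfun.zero_left)
      then have "p (\<pi> (q * q0) y) = 0" using \<pi>(2)[OF q(1) Q(1)[OF q0(1)]] by simp
      then show ?case using insert q D(1)
        by (auto simp: \<pi>(1) blinfun.add_left blinfun.add_right intro: complex_vector.subspace_add)
    qed (use \<open>\<pi> 0 = 0\<close> complex_vector.subspace_0[OF D(1)] in auto)
    from this[OF Q_finite order.refl] have "p o\<^sub>L \<pi> q0 = 0"
      unfolding sum by (intro blinfun_eqI) simp
    then show False using q0(2) by blast
  qed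
  then obtain x where x: "\<And>i. x i \<in> Q (i + n)" "\<And>i. p o\<^sub>L \<pi> (x i) = p" by metis
  have "p \<noteq> 0" using p by (auto simp: atom_of_def)
  then obtain z where z: "p z \<noteq> 0" using blinfun_eqI[of p 0] by auto
  define h where "h = (1 / norm (p z)) *\<^sub>R p z"
  have hh: "cinner h h = 1" using z by (simp add: h_def cinner_self)
  have xh: "\<pi> (x i) h = h" for i
  proof -
    have "\<pi> (x i) o\<^sub>L p = p" using atom(1)[OF bdd comm imageI[OF Q(1)[OF x(1)]]] x(2) by metis
    then have "\<pi> (x i) (p z) = p z" by (metis blinfun_apply_blinfun_compose)
    then show ?thesis by (simp add: h_def blinfun.scaleR_right)
  qed
  define \<omega> where "\<omega> d = cinner h (\<pi> d h)" for d
  have shift: "canonical_masa_sequence (\<lambda>i. Bs (i + n)) D"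
    by (rule canonical_masa_sequence_shift[OF sequence])
  interpret shifted: af_masa "\<lambda>i. Bs (i + n)" D "\<lambda>i. Q (i + n)"
    using shift basis by unfold_locales
  have lim: "(\<lambda>k. \<pi> (s k) y) \<longlonglongrightarrow> \<pi> l y" if "s \<longlonglongrightarrow> l" "\<And>k. s k \<in> D" "l \<in> D" for s :: "nat \<Rightarrow> 'b" and l y
  proof -
    have "(\<lambda>k. \<pi> (s k)) \<longlonglongrightarrow> \<pi> l"
      using \<open>continuous_on D \<pi>\<close> that unfolding continuous_on_sequentially comp_def by blast
    then show ?thesis by (intro blinfun.tendsto tendsto_const)
  qed
  have level: "\<pi> d h = \<omega> d *\<^sub>C h" if d: "d \<in> D" "d \<in> Bs (i + n)" for d i
  proof -
    obtain c where c: "d * x i = c *\<^sub>C x i" using Q_scalar[OF x(1) d] by blast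
    have "\<pi> d h = \<pi> (d * x i) h" using \<pi>(2)[OF d(1) Q(1)[OF x(1)]] xh by simp
    then have "\<pi> d h = c *\<^sub>C h" using \<pi>(3)[OF Q(1)[OF x(1)]] xh by (simp add: c)
    then show ?thesis using hh by (simp add: \<omega>_def cinner_scaleC_right)
  qed
  have eigen: "\<pi> d h = \<omega> d *\<^sub>C h" if d: "d \<in> D" for d
  proof -
    obtain e l where e: "e \<longlonglongrightarrow> d" "\<And>k::nat. e k \<in> D \<inter> Bs (l k + n)" using shifted.D_approx[OF d] by metis
    have *: "(\<lambda>k. \<pi> (e k) h) \<longlonglongrightarrow> \<pi> d h" using e d by (intro lim) auto
    then have "(\<lambda>k. \<omega> (e k) *\<^sub>C h) \<longlonglongrightarrow> \<omega> d *\<^sub>C h" unfolding \<omega>_def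
      by (intro tendsto_scaleC_hilbert tendsto_cinner tendsto_const)
    moreover have "\<omega> (e k) *\<^sub>C h = \<pi> (e k) h" for k using level[of "e k" "l k"] e(2)[of k] by simp
    ultimately have "(\<lambda>k. \<pi> (e k) h) \<longlonglongrightarrow> \<omega> d *\<^sub>C h" by simp
    with * show ?thesis by (rule LIMSEQ_unique)
  qed
  have "nest_at_point (\<lambda>i. Bs (i + n)) D (\<lambda>i. Q (i + n)) x \<omega> A \<pi> h"
  proof unfold_locales
    show "x i \<in> Q (i + n)" for i by (rule x)
    show "\<omega> (d + e) = \<omega> d + \<omega> e" if "d \<in> D" "e \<in> D" for d e
      using that by (simp add: \<omega>_def \<pi>(1) blinfun.add_left cinner_add_right)
    show "\<omega> (d * e) = \<omega> d * \<omega> e" if "d \<in> D" "e \<in> D" for d e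
    proof -
      have "\<pi> (d * e) h = (\<omega> e * \<omega> d) *\<^sub>C h"
        using that by (simp add: \<pi>(2) eigen \<pi>(4) scaleC_scaleC)
      then show ?thesis using hh by (simp add: \<omega>_def[of "d * e"] cinner_scaleC_right mult.commute)
    qed
    show "\<omega> (c *\<^sub>C d) = c * \<omega> d" if "d \<in> D" for c d
      using that by (simp add: \<omega>_def \<pi>(3) cinner_scaleC_right)
    show "\<omega> (adj d) = cnj (\<omega> d)" if "d \<in> D" for d
    proof -
      have "\<omega> (adj d) = cinner (\<pi> d h) h" using \<pi>(6)[OF that] by (simp add: \<omega>_def adjoint_pair_def)
      also have "\<dots> = cnj (\<omega> d)" unfolding \<omega>_def by (rule cinner_commute)
      finally show ?thesis .
    qed
    show "continuous_on D \<omega>"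
      unfolding continuous_on_sequentially comp_def
    proof (intro allI ballI impI)
      fix s l assume "l \<in> D" "(\<forall>n. s n \<in> D) \<and> s \<longlonglongrightarrow> l"
      then have "(\<lambda>k. \<pi> (s k) h) \<longlonglongrightarrow> \<pi> l h" by (intro lim) auto
      then show "(\<lambda>n. \<omega> (s n)) \<longlonglongrightarrow> \<omega> l" unfolding \<omega>_def by (rule tendsto_cinner[OF tendsto_const])
    qed
    show "\<omega> (x i) = 1" for i using xh hh by (simp add: \<omega>_def)
  qed (use taf rep star hh eigen in auto)
  then show ?thesis using that by blast
qed

section \<open>Meet irreducibility of the kernel\<close>

theorem theorem3p9:
  fixes A D :: "'b::cstar_algebra set"
    and \<pi> :: "'b \<Rightarrow> 'h::complex_hilbert \<Rightarrow>\<^sub>L 'h"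
  assumes "strongly_maximal_taf A D"
    and "nest_representation A \<pi>"
    and "star_representation_on D \<pi>"
    and "\<exists>p. atom_of (commutant (commutant (\<pi> ` D))) p"
  shows "meet_irreducible A {a \<in> A. \<pi> a = 0}"
proof -
  let ?I = "{a \<in> A. \<pi> a = 0}"
  obtain p where p: "atom_of (commutant (commutant (\<pi> ` D))) p" using assms(4) by blast
  obtain Bs where "canonical_masa_sequence Bs D"
    using assms(1) by (auto simp: strongly_maximal_taf_def taf_algebra_def canonical_masa_def)
  then obtain Q where "af_masa Bs D Q" by (rule canonical_masa_sequence_basis)
  then interpret af_masa Bs D Q .
  have "?I = J \<or> ?I = K" if J: "closed_ideal A J" and K: "closed_ideal A K" and JK: "?I = J \<inter> K" for J K
  proof (rule ccontr)
    assume "\<not> ?thesis"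
    then have "J \<noteq> ?I" "K \<noteq> ?I" by auto
    moreover have "?I \<subseteq> J" "?I \<subseteq> K" using JK by auto
    moreover have "J \<subseteq> A" "K \<subseteq> A" using J K by (auto simp: closed_ideal_def)
    ultimately obtain v w where v: "v \<in> J" "\<pi> v \<noteq> 0" and w: "w \<in> K" "\<pi> w \<noteq> 0" by blast
    show False
    proof (cases "\<exists>i. \<exists>q\<in>Q i. p o\<^sub>L \<pi> q \<noteq> 0")
      case True
      then obtain n q where q: "q \<in> Q n" "p o\<^sub>L \<pi> q \<noteq> 0" by blast
      obtain x \<omega> h where "nest_at_point (\<lambda>i. Bs (i + n)) D (\<lambda>i. Q (i + n)) x \<omega> A \<pi> h"
        using nest_at_point_exists[OF assms(1-3) p q] .
      from nest_at_point.ideals_meet_outside_kernel[OF this J v K w]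
      show False using JK by blast
    next
      case False
      have "p \<noteq> 0" using p by (auto simp: atom_of_def)
      then obtain z where z: "p z \<noteq> 0" using blinfun_eqI[of p 0] by auto
      have "\<pi> q (p z) = 0" if q: "q \<in> Q i" for q i
      proof -
        have "\<pi> ` D \<subseteq> bounded_operators"
          using assms(3) by (auto simp: star_representation_on_def algebra_hom_on_def)
        moreover have "S o\<^sub>L T = T o\<^sub>L S" if "S \<in> \<pi> ` D" "T \<in> \<pi> ` D" for S T
          using that assms(3) D(4) unfolding star_representation_on_def algebra_hom_on_def
          by (metis imageE)
        ultimately have "p o\<^sub>L \<pi> q = \<pi> q o\<^sub>L p" using atom_dichotomy(1)[OF _ _ p] Q(1)[OF q] by blast
        then have "\<pi> q o\<^sub>L p = 0" using False q by auto
        then show ?thesis by (metis blinfun_apply_blinfun_compose blinfun.zero_left)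
      qed
      from degenerate_representation_zero[OF assms(1-3) z this] v J
      show False by (auto simp: closed_ideal_def)
    qed
  qed
  then show ?thesis unfolding meet_irreducible_def
    using kernel_closed_ideal[OF assms(1,2)] by blast
qed

end
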